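(* For each $\sigma\in\mathcal{S}$ there is a real number $c=c(\sigma)$ with $0\le c<1$ such that the joint spectrum of $(\lambda_2,\widehat\lambda_2,\omega_2,\widehat\omega_2)$ is dense in the curve $$\Big\{\Big(x,\;1-\frac{1}{1+(1+\sigma)x},\;\frac{1+(1+\sigma)x}{\sigma},\;1+(1+\sigma)x\Big)\;:\;x\in[c,1]\Big\},$$ i.e. the points of the joint spectrum lying on this curve form a dense subset of the curve.
   Context: $\mathcal{S}$ is the set of all real numbers $\sigma(\underline{s})=1/\limsup_{k\to\infty}[s_{k+1};s_k,\dots,s_1]$, where $\underline{s}=(s_k)_{k\ge0}$ ranges over bounded sequences of positive integers and $[a_0;a_1,\dots]$ denotes a continued fraction. Let $\xi\in\mathbb{R}$ be not algebraic of degree $\le 2$. $\omega_2(\xi)$ (resp. $\widehat\omega_2(\xi)$) is the supremum of the real $\omega$ such that, for arbitrarily large $X$ (resp. for all sufficiently large $X$), there is a non-zero $(x_0,x_1,x_2)\in\mathbb{Z}^3$ with $|x_0+x_1\xi+x_2\xi^2|\le X^{-\omega}$ and $\max(|x_1|,|x_2|)\le X$. $\lambda_2(\xi)$ (resp. $\widehat\lambda_2(\xi)$) is the supremum of the real $\lambda$ such that, for arbitrarily large $X$ (resp. for all sufficiently large $X$), there is a non-zero $(x_0,x_1,x_2)\in\mathbb{Z}^3$ with $|x_0|\le X$ and $\max(|x_0\xi-x_1|,|x_0\xi^2-x_2|)\le X^{-\lambda}$. The joint spectrum of $(\lambda_2,\widehat\lambda_2,\omega_2,\widehat\omega_2)$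 is the set of all values $(\lambda_2(\xi),\widehat\lambda_2(\xi),\omega_2(\xi),\widehat\omega_2(\xi))$ where $\xi$ ranges over the real numbers which are not algebraic of degree $\le2$. *)

theory Defs
  imports "HOL-Analysis.Analysis" "HOL-Computational_Algebra.Polynomial"
begin

text \<open>The finite continued fraction \<open>[a\<^sub>0; a\<^sub>1, \<dots>, a\<^sub>n]\<close>; the value on the empty list is a
  dummy.\<close>

fun contfrac :: "nat list \<Rightarrow> real" where
  "contfrac [] = 0"
| "contfrac [a] = real a"
| "contfrac (a # b # bs) = real a + 1 / contfrac (b # bs)"

text \<open>The list below is \<open>[s\<^sub>k\<^sub>+\<^sub>1, s\<^sub>k, \<dots>, s\<^sub>1]\<close>. For a bounded sequence of positive integers the
  continued fractions lie in a bounded interval \<open>[1, B + 1]\<close>, so the upper limit, taken in the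
  extended reals, is a real number that is at least 1.\<close>

definition sigma :: "(nat \<Rightarrow> nat) \<Rightarrow> real" where
  "sigma s = 1 / real_of_ereal (limsup (\<lambda>k. ereal (contfrac (map s (rev [1..<k + 2])))))"

definition sigma_values :: "real set" where
  "sigma_values = {sigma s | s. (\<forall>k. s k > 0) \<and> bdd_above (range s)}"

definition algebraic_of_degree_le :: "nat \<Rightarrow> real \<Rightarrow> bool" where
  "algebraic_of_degree_le n \<xi> \<longleftrightarrow>
     (\<exists>p :: real poly. (\<forall>i. coeff p i \<in> \<int>) \<and> p \<noteq> 0 \<and> degree p \<le> n \<and> poly p \<xi> = 0)"

definition omega_solvable :: "real \<Rightarrow> real \<Rightarrow> real \<Rightarrow> bool" where
  "omega_solvable \<xi> \<omega> X \<longleftrightarrow>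
     (\<exists>x0 x1 x2 :: int. (x0, x1, x2) \<noteq> (0, 0, 0) \<and>
        \<bar>of_int x0 + of_int x1 * \<xi> + of_int x2 * \<xi>\<^sup>2\<bar> \<le> X powr (-\<omega>) \<and>
        max \<bar>of_int x1\<bar> \<bar>of_int x2\<bar> \<le> X)"

definition lambda_solvable :: "real \<Rightarrow> real \<Rightarrow> real \<Rightarrow> bool" where
  "lambda_solvable \<xi> l X \<longleftrightarrow>
     (\<exists>x0 x1 x2 :: int. (x0, x1, x2) \<noteq> (0, 0, 0) \<and>
        \<bar>of_int x0\<bar> \<le> X \<and>
        max \<bar>of_int x0 * \<xi> - of_int x1\<bar> \<bar>of_int x0 * \<xi>\<^sup>2 - of_int x2\<bar> \<le> X powr (-l))"

text \<open>The exponents may be infinite (for instance for Liouville numbers), hence they are suprema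
  in the extended reals.\<close>

definition omega2 :: "real \<Rightarrow> ereal" where
  "omega2 \<xi> = Sup {ereal \<omega> | \<omega>. \<exists>\<^sub>F X in at_top. omega_solvable \<xi> \<omega> X}"

definition omega2_hat :: "real \<Rightarrow> ereal" where
  "omega2_hat \<xi> = Sup {ereal \<omega> | \<omega>. \<forall>\<^sub>F X in at_top. omega_solvable \<xi> \<omega> X}"

definition lambda2 :: "real \<Rightarrow> ereal" where
  "lambda2 \<xi> = Sup {ereal l | l. \<exists>\<^sub>F X in at_top. lambda_solvable \<xi> l X}"

definition lambda2_hat :: "real \<Rightarrow> ereal" where
  "lambda2_hat \<xi> = Sup {ereal l | l. \<forall>\<^sub>F X in at_top. lambda_solvable \<xi> l X}"

definition joint_spectrum :: "(ereal \<times> ereal \<times> ereal \<times> ereal) set" where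
  "joint_spectrum =
     {(lambda2 \<xi>, lambda2_hat \<xi>, omega2 \<xi>, omega2_hat \<xi>) | \<xi>. \<not> algebraic_of_degree_le 2 \<xi>}"

text \<open>The points of the curve are finite; they are embedded in \<open>ereal \<times> ereal \<times> ereal \<times> ereal\<close>,
  whose topology induces the usual one on quadruples of reals.\<close>

definition spectrum_curve :: "real \<Rightarrow> real \<Rightarrow> (ereal \<times> ereal \<times> ereal \<times> ereal) set" where
  "spectrum_curve \<sigma> c =
     {(ereal x,
       ereal (1 - 1 / (1 + (1 + \<sigma>) * x)),
       ereal ((1 + (1 + \<sigma>) * x) / \<sigma>),
       ereal (1 + (1 + \<sigma>) * x)) | x. x \<in> {c..1}}"

end

theory Submission
  imports Defs
begin

text \<open>Fix \<open>s\<close> with \<open>\<sigma> = \<sigma>(s)\<close> and an integer \<open>p\<close>. Starting from two symmetric integer matrices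
  \<open>(a p; p 0)\<close> and \<open>(a+p p; p 0)\<close> with \<open>a\<close> prime to \<open>p\<close>, let \<open>M\<^sub>k\<^sub>+\<^sub>1 = M\<^sub>k\<^bsup>s\<^esup> M\<^sub>k\<^sub>-\<^sub>1\<close>,
  \<open>s = s\<^sub>k\<^sub>+\<^sub>1\<close>, be the products along the standard words of a Sturmian word. Their palindromic
  prefixes are symmetric matrices \<open>(x\<^sub>0 x\<^sub>1; x\<^sub>1 x\<^sub>2)\<close>, that is, integer points close to the line
  through \<open>(1, \<xi>, \<xi>\<^sup>2)\<close>, with error about \<open>|det| / x\<^sub>0\<close>. Write \<open>|det M\<^sub>k| = \<parallel>M\<^sub>k\<parallel>\<^bsup>\<delta>+o(1)\<^esup>\<close> and \<open>x = 1 - \<delta>\<close>. The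
  points \<open>M\<^sub>k\<^bsup>j\<^esup> P\<^sub>k\<^sub>-\<^sub>1\<close> (\<open>P\<^sub>k\<close> the palindrome in \<open>M\<^sub>k\<close>) span a plane whose primitive normal vector \<open>Z\<^sub>k\<close>
  is the quadratic form of fixed points of \<open>M\<^sub>k\<close>. For \<open>x\<close> close to 1 these points and forms capture
  all good approximations, and the four exponents follow: the lower bounds by evaluating them, with
  Dirichlet's theorem in the planes for the uniform exponent of simultaneous approximation; the upper
  bounds because an integer scalar product of absolute value less than 1 vanishes, so a better
  approximation would have to be a multiple of a known one. The entries off the corner are divisible
  by \<open>p\<close>, so all the vectors are primitive although the determinants are large. Finally
  \<open>\<delta> = 2 log p / \<Lambda>\<close>, where \<open>\<Lambda>\<close> is the growth rate of \<open>log \<parallel>M\<^sub>k\<parallel>\<close> per letter; letting \<open>p \<rightarrow> \<infinity>\<close> with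
  \<open>a\<close> about \<open>p\<^bsup>T\<^esup>\<close> gives \<open>\<delta> \<rightarrow> 2 / T\<close> for arbitrary \<open>T > 2\<close>.\<close>

section \<open>Integer vectors in dimension three\<close>

definition primitive3 :: "int \<Rightarrow> int \<Rightarrow> int \<Rightarrow> bool" where
  "primitive3 x0 x1 x2 \<longleftrightarrow> (\<exists>g0 g1 g2. g0 * x0 + g1 * x1 + g2 * x2 = 1)"

text \<open>By the double cross product formula the product of \<open>x\<close> and \<open>y\<close>
  is parallel to \<open>z\<close>. Pairing it with a Bezout vector \<open>g\<close> of
  \<open>z\<close> shows that the factor is an integer.\<close>

lemma cross_proportional:
  fixes x0 x1 x2 y0 y1 y2 z0 z1 z2 :: int
  assumes "primitive3 z0 z1 z2"
    and x: "z0 * x0 + z1 * x1 + z2 * x2 = 0" and y: "z0 * y0 + z1 * y1 + z2 * y2 = 0"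
  obtains c where "x1 * y2 - x2 * y1 = c * z0" "x2 * y0 - x0 * y2 = c * z1" "x0 * y1 - x1 * y0 = c * z2"
proof -
  obtain g0 g1 g2 where g: "g0 * z0 + g1 * z1 + g2 * z2 = 1"
    using assms(1) unfolding primitive3_def by blast
  define v0 v1 v2 where v: "v0 = x1 * y2 - x2 * y1" "v1 = x2 * y0 - x0 * y2" "v2 = x0 * y1 - x1 * y0"
  have "v1 * z2 - v2 * z1 = y0 * (z0 * x0 + z1 * x1 + z2 * x2) - x0 * (z0 * y0 + z1 * y1 + z2 * y2)"
    "v2 * z0 - v0 * z2 = y1 * (z0 * x0 + z1 * x1 + z2 * x2) - x1 * (z0 * y0 + z1 * y1 + z2 * y2)"
    "v0 * z1 - v1 * z0 = y2 * (z0 * x0 + z1 * x1 + z2 * x2) - x2 * (z0 * y0 + z1 * y1 + z2 * y2)"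
    unfolding v by algebra+
  then have e: "v1 * z2 = v2 * z1" "v2 * z0 = v0 * z2" "v0 * z1 = v1 * z0"
    using x y by simp_all
  define c where "c = g0 * v0 + g1 * v1 + g2 * v2"
  have "v0 = c * z0" "v1 = c * z1" "v2 = c * z2"
    using e g unfolding c_def by algebra+
  then show thesis using that[of c] unfolding v by simp
qed

lemma parallel_multiple:
  fixes x0 x1 x2 y0 y1 y2 :: int
  assumes "primitive3 y0 y1 y2"
    and e: "x1 * y2 = x2 * y1" "x2 * y0 = x0 * y2" "x0 * y1 = x1 * y0"
  obtains d where "x0 = d * y0" "x1 = d * y1" "x2 = d * y2"
proof -
  obtain g0 g1 g2 where g: "g0 * y0 + g1 * y1 + g2 * y2 = 1"
    using assms(1) unfolding primitive3_def by blast
  define d where "d = g0 * x0 + g1 * x1 + g2 * x2"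
  have "x0 = d * y0" "x1 = d * y1" "x2 = d * y2"
    using e g unfolding d_def by algebra+
  then show thesis using that by blast
qed

text \<open>The witness is the cross product of \<open>z\<close> with a Bezout vector
  \<open>g\<close> of \<open>x\<close>: the double product of \<open>x\<close>, \<open>z\<close>,
  \<open>g\<close> equals \<open>z\<close> times \<open>g.x = 1\<close> minus \<open>g\<close> times
  \<open>z.x = 0\<close>.\<close>

lemma orthogonal_plane_basis:
  fixes x0 x1 x2 z0 z1 z2 :: int
  assumes "primitive3 x0 x1 x2" and x: "z0 * x0 + z1 * x1 + z2 * x2 = 0"
  obtains u0 u1 u2 where "z0 * u0 + z1 * u1 + z2 * u2 = 0"
    "x1 * u2 - x2 * u1 = z0" "x2 * u0 - x0 * u2 = z1" "x0 * u1 - x1 * u0 = z2"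
proof -
  obtain g0 g1 g2 where g: "g0 * x0 + g1 * x1 + g2 * x2 = 1"
    using assms(1) unfolding primitive3_def by blast
  define u0 u1 u2 where u: "u0 = z1 * g2 - z2 * g1" "u1 = z2 * g0 - z0 * g2" "u2 = z0 * g1 - z1 * g0"
  have "z0 * u0 + z1 * u1 + z2 * u2 = 0" unfolding u by algebra
  moreover have "x1 * u2 - x2 * u1 = z0" "x2 * u0 - x0 * u2 = z1" "x0 * u1 - x1 * u0 = z2"
    unfolding u using x g by algebra+
  ultimately show thesis using that by blast
qed

lemma dot_expand:
  fixes \<xi> :: real
  shows "real_of_int (z0 * x0 + z1 * x1 + z2 * x2) =
    x0 * (z0 + z1 * \<xi> + z2 * \<xi>\<^sup>2) - z1 * (x0 * \<xi> - x1) - z2 * (x0 * \<xi>\<^sup>2 - x2)"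
  by (simp add: algebra_simps)

lemma dot_eq_0:
  fixes \<xi> :: real and z0 z1 z2 x0 x1 x2 :: int
  assumes "\<bar>x0\<bar> * \<bar>z0 + z1 * \<xi> + z2 * \<xi>\<^sup>2\<bar> + \<bar>z1\<bar> * \<bar>x0 * \<xi> - x1\<bar> + \<bar>z2\<bar> * \<bar>x0 * \<xi>\<^sup>2 - x2\<bar> < 1"
  shows "z0 * x0 + z1 * x1 + z2 * x2 = 0"
proof -
  have "\<bar>real_of_int (z0 * x0 + z1 * x1 + z2 * x2)\<bar> < 1"
    using assms unfolding dot_expand[of z0 x0 z1 x1 z2 x2 \<xi>] by (simp add: abs_mult[symmetric])
  then show ?thesis by linarith
qed

section \<open>Filters and suprema\<close>

text \<open>Monotonicity allows testing only exponents in a window around \<open>v\<close>, which is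
  where the estimates below are proved.\<close>

lemma Sup_ereal_eq:
  fixes P :: "real \<Rightarrow> bool"
  assumes anti: "\<And>u v. u \<le> v \<Longrightarrow> P v \<Longrightarrow> P u" and "l < v" "v < r"
    and lo: "\<And>u. l < u \<Longrightarrow> u < v \<Longrightarrow> P u" and hi: "\<And>u. v < u \<Longrightarrow> u < r \<Longrightarrow> \<not> P u"
  shows "Sup {ereal u | u. P u} = ereal v"
proof (rule antisym)
  show "Sup {ereal u |u. P u} \<le> ereal v"
  proof (rule Sup_least, clarsimp)
    fix u assume "P u"
    show "u \<le> v"
    proof (rule ccontr)
      assume "\<not> u \<le> v"
      then obtain w where "v < w" "w < min u r" using \<open>v < r\<close> dense[of v "min u r"] by auto
      then show False using hi[of w] anti[OF _ \<open>P u\<close>, of w] by auto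
    qed
  qed
  show "ereal v \<le> Sup {ereal u |u. P u}"
    unfolding le_Sup_iff
  proof (intro allI impI)
    fix y assume "y < ereal v"
    then have "max y (ereal l) < ereal v" using \<open>l < v\<close> by simp
    then obtain u where u: "max y (ereal l) < ereal u" "ereal u < ereal v"
      using ereal_dense2 by blast
    then show "\<exists>a\<in>{ereal u |u. P u}. y < a" using lo[of u] by auto
  qed
qed

text \<open>The intervals from \<open>f k\<close> to \<open>f (Suc k)\<close> cover a half line even
  if \<open>f\<close> is not monotone: take the least index beyond \<open>K\<close> at which
  \<open>f\<close> exceeds \<open>H\<close>, and step back by one.\<close>

lemma eventually_between:
  fixes f :: "nat \<Rightarrow> real"
  assumes f: "filterlim f at_top sequentially"
    and P: "\<forall>\<^sub>F k in sequentially. \<forall>H. f k \<le> H \<longrightarrow> H < f (Suc k) \<longrightarrow> P H"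
  shows "\<forall>\<^sub>F H in at_top. P H"
proof -
  obtain K where K: "\<And>k H. k \<ge> K \<Longrightarrow> f k \<le> H \<Longrightarrow> H < f (Suc k) \<Longrightarrow> P H"
    using P unfolding eventually_sequentially by blast
  have "P H" if H: "H \<ge> f K" for H
  proof -
    have "\<forall>\<^sub>F k in sequentially. H < f k" using f by (simp add: filterlim_at_top_dense)
    then obtain n where n: "\<And>k. k \<ge> n \<Longrightarrow> H < f k" unfolding eventually_sequentially by blast
    have ex: "\<exists>k. K \<le> k \<and> H < f k" by (rule exI[of _ "max n K"]) (simp add: n)
    define m where "m = (LEAST k. K \<le> k \<and> H < f k)"
    have m: "K \<le> m" "H < f m" using LeastI_ex[OF ex] unfolding m_def by auto
    have "m \<noteq> K" using m H by auto
    then obtain k where k: "m = Suc k" "K \<le> k" using m by (cases m) auto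
    have "\<not> (K \<le> k \<and> H < f k)" using not_less_Least[of k "\<lambda>k. K \<le> k \<and> H < f k"] k unfolding m_def[symmetric] by auto
    then show ?thesis using K[of k H] k m by auto
  qed
  then show ?thesis unfolding eventually_at_top_linorder by blast
qed

lemma eventually_exp:
  fixes P :: "real \<Rightarrow> bool"
  assumes "\<forall>\<^sub>F H in at_top. P (exp H)"
  shows "\<forall>\<^sub>F X in at_top. P X"
proof -
  have "\<forall>\<^sub>F X in at_top. P (exp (ln X))"
    using assms ln_at_top by (rule eventually_compose_filterlim)
  then show ?thesis using eventually_gt_at_top[of 0]
    by eventually_elim simp
qed

lemma frequently_exp:
  fixes P :: "real \<Rightarrow> bool"
  assumes "\<exists>\<^sub>F k in sequentially. P (exp (f k))" and f: "filterlim f at_top sequentially"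
  shows "\<exists>\<^sub>F X in at_top. P X"
proof (rule ccontr)
  assume "\<not> (\<exists>\<^sub>F X in at_top. P X)"
  then have "\<forall>\<^sub>F X in at_top. \<not> P X" by (simp add: not_frequently)
  then have "\<forall>\<^sub>F k in sequentially. \<not> P (exp (f k))"
    using filterlim_compose[OF exp_at_top f] by (rule eventually_compose_filterlim)
  then show False using assms(1) by (simp add: frequently_def)
qed

lemma exp_le_small:
  fixes t :: real
  assumes "t \<le> - 3"
  shows "exp t \<le> 1 / 8"
proof -
  have "8 \<le> (2::real) ^ 3" by simp
  also have "\<dots> \<le> exp 1 ^ 3" using exp_ge_add_one_self[of 1] by (intro power_mono) auto
  also have "\<dots> = exp 3" by (simp flip: exp_of_nat_mult)
  finally have e: "8 \<le> exp (3::real)" .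
  have "exp t \<le> exp (- 3)" using assms by simp
  also have "\<dots> = 1 / exp 3" by (simp add: exp_minus field_simps)
  also have "\<dots> \<le> 1 / 8" using e by (simp add: field_simps)
  finally show ?thesis .
qed

text \<open>An additive 3 in a logarithmic estimate is worth a factor 8, enough to dominate the sums
  of a few terms that occur below.\<close>

lemma exp_add3_le:
  fixes s t :: real
  assumes "t + 3 \<le> s"
  shows "8 * exp t \<le> exp s"
proof -
  have "exp t = exp s * exp (t - s)" by (simp flip: exp_add)
  also have "\<dots> \<le> exp s * (1/8)" using assms by (intro mult_left_mono exp_le_small) auto
  finally show ?thesis by simp
qed

lemma omega_solvable_antimono:
  assumes "u \<le> v" "1 \<le> X" "omega_solvable \<xi> v X"
  shows "omega_solvable \<xi> u X"
proof -
  have "X powr (- v) \<le> X powr (- u)" using assms by (intro powr_mono) auto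
  then show ?thesis using assms(3) unfolding omega_solvable_def by (meson order_trans)
qed

lemma lambda_solvable_antimono:
  assumes "u \<le> v" "1 \<le> X" "lambda_solvable \<xi> v X"
  shows "lambda_solvable \<xi> u X"
proof -
  have "X powr (- v) \<le> X powr (- u)" using assms by (intro powr_mono) auto
  then show ?thesis using assms(3) unfolding lambda_solvable_def by (meson order_trans)
qed

lemma eventually_antimono:
  assumes "\<And>X. (1::real) \<le> X \<Longrightarrow> P X \<Longrightarrow> Q X" "\<forall>\<^sub>F X in at_top. P X"
  shows "\<forall>\<^sub>F X in at_top. Q X"
  using assms(2) eventually_ge_at_top[of 1] by eventually_elim (use assms(1) in blast)

lemma frequently_antimono:
  assumes "\<And>X. (1::real) \<le> X \<Longrightarrow> P X \<Longrightarrow> Q X" "\<exists>\<^sub>F X in at_top. P X"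
  shows "\<exists>\<^sub>F X in at_top. Q X"
proof (rule ccontr)
  assume "\<not> (\<exists>\<^sub>F X in at_top. Q X)"
  then have "\<forall>\<^sub>F X in at_top. \<not> Q X" by (simp add: not_frequently)
  then have "\<forall>\<^sub>F X in at_top. \<not> P X" by (rule eventually_antimono[rotated]) (use assms(1) in blast)
  then show False using assms(2) by (simp add: frequently_def)
qed

lemma omega_solvable_exp:
  fixes \<xi> :: real
  shows
  "omega_solvable \<xi> w (exp H) \<longleftrightarrow> (\<exists>(x0::int) (x1::int) (x2::int). (x0, x1, x2) \<noteq> (0, 0, 0) \<and>
        \<bar>x0 + x1 * \<xi> + x2 * \<xi>\<^sup>2\<bar> \<le> exp (- (w * H)) \<and> \<bar>real_of_int x1\<bar> \<le> exp H \<and> \<bar>real_of_int x2\<bar> \<le> exp H)"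
  unfolding omega_solvable_def by (simp add: exp_powr_real mult.commute)

lemma omega_solvable_expI:
  fixes \<xi> :: real and x0 x1 x2 :: int
  assumes "(x0, x1, x2) \<noteq> (0, 0, 0)" "\<bar>x0 + x1 * \<xi> + x2 * \<xi>\<^sup>2\<bar> \<le> exp (- (w * H))"
    "\<bar>real_of_int x1\<bar> \<le> exp H" "\<bar>real_of_int x2\<bar> \<le> exp H"
  shows "omega_solvable \<xi> w (exp H)"
  unfolding omega_solvable_exp by (intro exI conjI) (rule assms)+

lemma lambda_solvable_exp:
  fixes \<xi> :: real
  shows
  "lambda_solvable \<xi> w (exp H) \<longleftrightarrow> (\<exists>(x0::int) (x1::int) (x2::int). (x0, x1, x2) \<noteq> (0, 0, 0) \<and>
        \<bar>real_of_int x0\<bar> \<le> exp H \<and> \<bar>x0 * \<xi> - x1\<bar> \<le> exp (- (w * H)) \<and> \<bar>x0 * \<xi>\<^sup>2 - x2\<bar> \<le> exp (- (w * H)))"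
  unfolding lambda_solvable_def by (simp add: exp_powr_real mult.commute)

lemma lambda_solvable_expI:
  fixes \<xi> :: real and x0 x1 x2 :: int
  assumes "(x0, x1, x2) \<noteq> (0, 0, 0)" "\<bar>real_of_int x0\<bar> \<le> exp H"
    "\<bar>x0 * \<xi> - x1\<bar> \<le> exp (- (w * H))" "\<bar>x0 * \<xi>\<^sup>2 - x2\<bar> \<le> exp (- (w * H))"
  shows "lambda_solvable \<xi> w (exp H)"
  unfolding lambda_solvable_exp by (intro exI conjI) (rule assms)+

section \<open>Exponents of an abstract Sturmian system\<close>

text \<open>A Minkowski type bound for the rank two lattice spanned by \<open>p\<close> and
  \<open>u\<close>, seen through coordinates 0 and 2, where its determinant is \<open>D\<close>. It
  comes from Dirichlet's theorem for the quotient of the errors of \<open>u\<close> and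
  \<open>p\<close>. With \<open>0 < n\<close> the point is off the line of \<open>p\<close>, hence
  nonzero.\<close>

lemma plane_minkowski:
  fixes p0 p2 u0 u2 :: int and c t :: real
  defines "D \<equiv> real_of_int (p2 * u0 - p0 * u2)" and "ep \<equiv> p0 * c - p2"
  assumes t: "0 < t" "2 * \<bar>real_of_int p0\<bar> \<le> t" and D: "D \<noteq> 0" "2 * \<bar>D\<bar> \<le> t * \<bar>ep\<bar>"
  obtains m n :: int where "0 < n" "\<bar>real_of_int (m * p0 + n * u0)\<bar> \<le> t"
    "\<bar>real_of_int (m * p0 + n * u0) * c - real_of_int (m * p2 + n * u2)\<bar> \<le> 4 * \<bar>D\<bar> / t"
proof -
  have ep: "ep \<noteq> 0" using D by auto
  \<comment> \<open>A multiplier up to \<open>R\<close> lets the term \<open>k * D\<close>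
    contribute at most \<open>t / 2\<close> to the first coordinate, while an error
    \<open>\<bar>ep\<bar> / N\<close>, at most \<open>2 * \<bar>ep\<bar> / R\<close>, is at most
    \<open>4 * \<bar>D\<bar> / t\<close>.\<close>
  define R where "R = t * \<bar>ep\<bar> / (2 * \<bar>D\<bar>)"
  define N where "N = nat \<lfloor>R\<rfloor>"
  have R: "1 \<le> R" unfolding R_def using D by (simp add: field_simps)
  have "real N = real_of_int \<lfloor>R\<rfloor>" unfolding N_def using R by simp
  moreover have "1 \<le> \<lfloor>R\<rfloor>" using R by (simp add: le_floor_iff)
  ultimately have N: "1 \<le> real N" "real N \<le> R" "R \<le> 2 * real N"
    by linarith+
  define eu where "eu = u0 * c - u2"
  obtain h k where hk: "0 < k" "k \<le> int N" "\<bar>of_int k * (eu / ep) - of_int h\<bar> < 1 / N"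
  proof (rule Dirichlet_approx[of N "eu / ep"])
    show "0 < N" using N by simp
  qed
  define y0 where "y0 = real_of_int ((- h) * p0 + k * u0)"
  define ey where "ey = y0 * c - real_of_int ((- h) * p2 + k * u2)"
  have ey: "ey = ep * (of_int k * (eu / ep) - of_int h)"
    using ep unfolding ey_def y0_def ep_def eu_def by (simp add: field_simps)
  have "\<bar>ey\<bar> \<le> \<bar>ep\<bar> * (1 / N)" unfolding ey abs_mult using hk by (intro mult_left_mono) auto
  then have eyN: "\<bar>ey\<bar> * N \<le> \<bar>ep\<bar>" using N by (simp add: field_simps)
  have "\<bar>ey\<bar> * R \<le> \<bar>ey\<bar> * (2 * N)" using N by (intro mult_left_mono) auto
  then have "\<bar>ey\<bar> * R \<le> 2 * \<bar>ep\<bar>" using eyN by simp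
  then have "\<bar>ep\<bar> * (\<bar>ey\<bar> * t) \<le> \<bar>ep\<bar> * (4 * \<bar>D\<bar>)"
    unfolding R_def using D by (simp add: field_simps)
  then have ey_le: "\<bar>ey\<bar> \<le> 4 * \<bar>D\<bar> / t" using ep t by (simp add: field_simps)
  \<comment> \<open>The determinant of the new point and \<open>p\<close> is \<open>k * D\<close> up
    to sign; this bounds the first coordinate through the errors.\<close>
  have "y0 * ep = p0 * ey - k * D"
    unfolding y0_def ey_def ep_def D_def by (simp add: algebra_simps)
  then have "\<bar>y0 * ep\<bar> \<le> \<bar>p0 * ey\<bar> + \<bar>k * D\<bar>" by linarith
  also have "\<bar>p0 * ey\<bar> \<le> \<bar>real_of_int p0\<bar> * \<bar>ep\<bar>"
  proof -
    have "\<bar>ey\<bar> * 1 \<le> \<bar>ey\<bar> * N" using N by (intro mult_left_mono) auto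
    then have "\<bar>ey\<bar> \<le> \<bar>ep\<bar>" using eyN by linarith
    then show ?thesis unfolding abs_mult by (intro mult_left_mono) auto
  qed
  also have "\<bar>k * D\<bar> \<le> R * \<bar>D\<bar>"
  proof -
    have "\<bar>real_of_int k\<bar> \<le> R" using hk N by linarith
    then show ?thesis unfolding abs_mult by (intro mult_right_mono) auto
  qed
  also have "R * \<bar>D\<bar> = t / 2 * \<bar>ep\<bar>" unfolding R_def using D by simp
  also have "\<bar>real_of_int p0\<bar> * \<bar>ep\<bar> + t / 2 * \<bar>ep\<bar> \<le> t * \<bar>ep\<bar>"
  proof -
    have "(\<bar>real_of_int p0\<bar> + t / 2) * \<bar>ep\<bar> \<le> t * \<bar>ep\<bar>" using t by (intro mult_right_mono) auto
    then show ?thesis by (simp add: algebra_simps)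
  qed
  finally have "\<bar>y0\<bar> \<le> t" using ep by (simp add: abs_mult)
  then show thesis using that[of k "- h"] hk(1) ey_le unfolding y0_def ey_def by simp
qed

lemma small_number:
  fixes a b c :: real
  assumes "0 < a" "0 < b" "0 < c"
  obtains e where "0 < e" "e * a \<le> 1" "e * c \<le> b"
proof -
  have "min (1 / a) (b / c) * a \<le> 1"
    using assms by (subst pos_le_divide_eq[symmetric]) (auto intro: min.cobounded1)
  moreover have "min (1 / a) (b / c) * c \<le> b"
    using assms by (subst pos_le_divide_eq[symmetric]) (auto intro: min.cobounded2)
  ultimately show thesis using that[of "min (1 / a) (b / c)"] assms by simp
qed

text \<open>Logarithmic data: \<open>Z k\<close> is an integer form of height \<open>exp (W k)\<close>, and \<open>Q k j\<close> is a point of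
  height about \<open>exp (j W\<^sub>k\<^sub>+\<^sub>1 + W\<^sub>k)\<close> in the plane orthogonal to \<open>Z (k + 1)\<close>; \<open>Q k 1\<close> spans the
  intersection of the planes of \<open>Z k\<close> and \<open>Z (k + 1)\<close>. Here \<open>\<rho> = 1 / \<sigma>\<close> is the upper limit of
  \<open>W\<^sub>k\<^sub>+\<^sub>1 / W\<^sub>k\<close>.\<close>

locale sturmian_system =
  fixes \<xi> x \<rho> B :: real and s :: "nat \<Rightarrow> nat" and W :: "nat \<Rightarrow> real"
    and Z0 Z1 Z2 :: "nat \<Rightarrow> int" and Q0 Q1 Q2 :: "nat \<Rightarrow> nat \<Rightarrow> int"
  assumes B: "1 \<le> B" and rho: "1 \<le> \<rho>" "\<rho> \<le> B + 1" and x: "x < 1" "(1 - x) * (B + 3) \<le> 1 / 20"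
    and s: "1 \<le> s k" "s k \<le> B"
    and W_pos: "0 < W k" and W_mono: "W k \<le> W (Suc k)"
    and W_lim: "filterlim W at_top sequentially"
    and W_ge: "W k + W (Suc k) \<le> W (Suc (Suc k))"
    and W_le: "0 < e \<Longrightarrow> \<forall>\<^sub>F k in sequentially. W (Suc (Suc k)) \<le> s k * W (Suc k) + W k + e * W (Suc k)"
    and ratio_le: "0 < e \<Longrightarrow> \<forall>\<^sub>F k in sequentially. W (Suc k) \<le> (\<rho> + e) * W k"
    and ratio_ge: "0 < e \<Longrightarrow> \<exists>\<^sub>F k in sequentially. (\<rho> - e) * W k \<le> W (Suc k)"
    and orth: "Z0 (Suc k) * Q0 k j + Z1 (Suc k) * Q1 k j + Z2 (Suc k) * Q2 k j = 0"
    and orth1: "Z0 k * Q0 k 1 + Z1 k * Q1 k 1 + Z2 k * Q2 k 1 = 0"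
    and prim_Z: "primitive3 (Z0 k) (Z1 k) (Z2 k)"
    and prim_Q: "1 \<le> j \<Longrightarrow> primitive3 (Q0 k j) (Q1 k j) (Q2 k j)"
    and Z_le: "\<bar>real_of_int (Z1 k)\<bar> \<le> exp (W k)" "\<bar>real_of_int (Z2 k)\<bar> \<le> exp (W k)"
      "\<bar>Z2 k\<bar> \<le> 2 * \<bar>Z1 k\<bar>"
    and Z_ge: "0 < e \<Longrightarrow> \<forall>\<^sub>F k in sequentially. exp (W k - e * W k) \<le> \<bar>real_of_int (Z1 k)\<bar>"
    and val_le: "0 < e \<Longrightarrow> \<forall>\<^sub>F k in sequentially.
      \<bar>Z0 k + Z1 k * \<xi> + Z2 k * \<xi>\<^sup>2\<bar> \<le> exp (- (x * W k + (1 + x) * W (Suc k)) + e * W k)"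
    and val_ge: "0 < e \<Longrightarrow> \<forall>\<^sub>F k in sequentially.
      exp (- (x * W k + (1 + x) * W (Suc k)) - e * W k) \<le> \<bar>Z0 k + Z1 k * \<xi> + Z2 k * \<xi>\<^sup>2\<bar>"
    and Q0_le: "0 < e \<Longrightarrow> \<forall>\<^sub>F k in sequentially. \<forall>j. 1 \<le> j \<longrightarrow> j \<le> s k \<longrightarrow>
      \<bar>real_of_int (Q0 k j)\<bar> \<le> exp (j * W (Suc k) + W k + e * W (Suc k))"
    and Q0_ge: "0 < e \<Longrightarrow> \<forall>\<^sub>F k in sequentially. \<forall>j. 1 \<le> j \<longrightarrow> j \<le> s k \<longrightarrow>
      exp (j * W (Suc k) + W k - e * W (Suc k)) \<le> \<bar>real_of_int (Q0 k j)\<bar>"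
    and Q1_err: "0 < e \<Longrightarrow> \<forall>\<^sub>F k in sequentially. \<forall>j. 1 \<le> j \<longrightarrow> j \<le> s k \<longrightarrow>
      \<bar>Q0 k j * \<xi> - Q1 k j\<bar> \<le> exp (- (x * (j * W (Suc k) + W k)) + e * W (Suc k))"
    and Q2_err: "0 < e \<Longrightarrow> \<forall>\<^sub>F k in sequentially. \<forall>j. 1 \<le> j \<longrightarrow> j \<le> s k \<longrightarrow>
      \<bar>Q0 k j * \<xi>\<^sup>2 - Q2 k j\<bar> \<le> exp (- (x * (j * W (Suc k) + W k)) + e * W (Suc k))"
    and Q2_err_ge: "0 < e \<Longrightarrow> \<forall>\<^sub>F k in sequentially. \<forall>j. 1 \<le> j \<longrightarrow> j \<le> s k \<longrightarrow>
      exp (- (x * (j * W (Suc k) + W k)) - e * W (Suc k)) \<le> \<bar>Q0 k j * \<xi>\<^sup>2 - Q2 k j\<bar>"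
begin

section \<open>Estimates valid at all large indices\<close>

lemma x_ge: "79 / 80 \<le> x"
proof -
  have "(1 - x) * 4 \<le> (1 - x) * (B + 3)" using B x by (intro mult_left_mono) auto
  also note x(2)
  finally show ?thesis by simp
qed

lemma W_scaled_lim: "0 < c \<Longrightarrow> filterlim (\<lambda>k. c * W k) at_top sequentially"
  using filterlim_tendsto_pos_mult_at_top[OF tendsto_const _ W_lim] by blast

text \<open>All asymptotic hypotheses at one index with one tolerance, so that later arguments are
  inequalities between \<open>W k\<close>, \<open>W (Suc k)\<close> and
  \<open>W (Suc (Suc k))\<close>. The first clause absorbs the additive 3 of
  \<open>exp_add3_le\<close>.\<close>

definition near :: "real \<Rightarrow> nat \<Rightarrow> bool" where
  "near e k \<longleftrightarrow>
     3 \<le> e * W k \<and>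
     W (Suc k) \<le> (\<rho> + e) * W k \<and>
     W (Suc k) \<le> (B + 2) * W k \<and>
     exp (W k - e * W k) \<le> \<bar>real_of_int (Z1 k)\<bar> \<and>
     \<bar>Z0 k + Z1 k * \<xi> + Z2 k * \<xi>\<^sup>2\<bar> \<le> exp (- (x * W k + (1 + x) * W (Suc k)) + e * W k) \<and>
     exp (- (x * W k + (1 + x) * W (Suc k)) - e * W k) \<le> \<bar>Z0 k + Z1 k * \<xi> + Z2 k * \<xi>\<^sup>2\<bar> \<and>
     W (Suc (Suc k)) \<le> s k * W (Suc k) + W k + e * W (Suc k) \<and>
     (\<forall>j. 1 \<le> j \<longrightarrow> j \<le> s k \<longrightarrow>
        \<bar>real_of_int (Q0 k j)\<bar> \<le> exp (j * W (Suc k) + W k + e * W (Suc k)) \<and>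
        exp (j * W (Suc k) + W k - e * W (Suc k)) \<le> \<bar>real_of_int (Q0 k j)\<bar> \<and>
        \<bar>Q0 k j * \<xi> - Q1 k j\<bar> \<le> exp (- (x * (j * W (Suc k) + W k)) + e * W (Suc k)) \<and>
        \<bar>Q0 k j * \<xi>\<^sup>2 - Q2 k j\<bar> \<le> exp (- (x * (j * W (Suc k) + W k)) + e * W (Suc k)) \<and>
        exp (- (x * (j * W (Suc k) + W k)) - e * W (Suc k)) \<le> \<bar>Q0 k j * \<xi>\<^sup>2 - Q2 k j\<bar>)"

lemma eventually_near:
  assumes e: "0 < e"
  shows "\<forall>\<^sub>F k in sequentially. near e k"
proof -
  have 1: "\<forall>\<^sub>F k in sequentially. 3 / e \<le> W k" using W_lim by (simp add: filterlim_at_top)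
  have 2: "\<forall>\<^sub>F k in sequentially. W (Suc k) \<le> (\<rho> + 1) * W k" by (rule ratio_le) simp
  show ?thesis
    using 1 2 W_le[OF e] ratio_le[OF e] Z_ge[OF e] val_le[OF e] val_ge[OF e]
      Q0_le[OF e] Q0_ge[OF e] Q1_err[OF e] Q2_err[OF e] Q2_err_ge[OF e]
  proof eventually_elim
    case (elim k)
    have "(\<rho> + 1) * W k \<le> (B + 2) * W k" using rho W_pos[of k] by (intro mult_right_mono) auto
    moreover have "3 \<le> e * W k" using elim(1) e by (simp add: field_simps)
    ultimately show ?case unfolding near_def using elim by auto
  qed
qed

lemma eventually_near_Suc: "0 < e \<Longrightarrow> \<forall>\<^sub>F k in sequentially. near e (Suc k)"
  using eventually_near by (simp only: eventually_sequentially_Suc)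

text \<open>This is how the closeness of \<open>x\<close> to 1 is exploited: on quantities
  comparable to \<open>U\<close>, multiplication by \<open>x\<close> loses at most
  \<open>U / 20\<close>.\<close>

lemma x_defect:
  assumes "0 \<le> V" "V \<le> (B + 3) * U" "0 \<le> U"
  shows "V - U / 20 \<le> x * V"
proof -
  have "(1 - x) * V \<le> (1 - x) * ((B + 3) * U)" using x assms by (intro mult_left_mono) auto
  also have "\<dots> = ((1 - x) * (B + 3)) * U" by simp
  also have "\<dots> \<le> (1 / 20) * U" using x assms by (intro mult_right_mono) auto
  finally show ?thesis by (simp add: algebra_simps)
qed

section \<open>Linear forms and the exponents \<open>omega2\<close> and
  \<open>omega2_hat\<close>\<close>

text \<open>The form \<open>z\<close> is so small that its product with the point
  \<open>Q k 1\<close> vanishes. As \<open>Z k\<close> is orthogonal to the same point, the cross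
  product of \<open>z\<close> and \<open>Z k\<close> is a multiple of \<open>Q k 1\<close>, and it
  is too short to be a nonzero one. So \<open>z\<close> is a multiple of \<open>Z k\<close> and
  cannot have a smaller value.\<close>

lemma form_multiple:
  fixes z0 z1 z2 :: int
  assumes near: "near e k" and e: "0 < e" "e * (8 * (B + 2)) \<le> 1"
    and z: "(z0, z1, z2) \<noteq> (0, 0, 0)" "\<bar>real_of_int z1\<bar> \<le> exp H" "\<bar>real_of_int z2\<bar> \<le> exp H"
      "\<bar>z0 + z1 * \<xi> + z2 * \<xi>\<^sup>2\<bar> \<le> exp (- h)"
    and H: "H \<le> W (Suc k) - 4 * (e * W (Suc k))"
    and h: "W (Suc k) + W k + 4 * (e * W (Suc k)) \<le> h"
  shows "\<bar>Z0 k + Z1 k * \<xi> + Z2 k * \<xi>\<^sup>2\<bar> \<le> exp (- h)"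
proof -
  define U V where UV: "U = W k" "V = W (Suc k)"
  have U0: "0 < U" "U \<le> V" and eU: "3 \<le> e * U" and VU: "V \<le> (B + 2) * U"
    using near W_pos[of k] W_mono[of k] unfolding near_def UV by auto
  have eUV: "e * U \<le> e * V" using U0 e by simp
  have eV: "8 * (e * V) \<le> U"
  proof -
    have "e * V \<le> e * ((B + 2) * U)" using VU e by (intro mult_left_mono) auto
    moreover have "(e * (8 * (B + 2))) * U \<le> 1 * U" using e U0 by (intro mult_right_mono) auto
    ultimately show ?thesis by (simp add: algebra_simps)
  qed
  have xV: "V - U / 20 \<le> x * V" "U - U / 20 \<le> x * U"
    using x_defect[of V U] x_defect[of U U] VU U0 B by (auto simp: algebra_simps)
  have Q: "\<bar>real_of_int (Q0 k 1)\<bar> \<le> exp (V + U + e * V)"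
    "exp (V + U - e * V) \<le> \<bar>real_of_int (Q0 k 1)\<bar>"
    "\<bar>Q0 k 1 * \<xi> - Q1 k 1\<bar> \<le> exp (- (x * (V + U)) + e * V)"
    "\<bar>Q0 k 1 * \<xi>\<^sup>2 - Q2 k 1\<bar> \<le> exp (- (x * (V + U)) + e * V)"
    using near s(1)[of k] unfolding near_def UV by force+
  have a: "\<bar>real_of_int (Q0 k 1)\<bar> * \<bar>z0 + z1 * \<xi> + z2 * \<xi>\<^sup>2\<bar> \<le> 1 / 8"
  proof -
    have "\<bar>real_of_int (Q0 k 1)\<bar> * \<bar>z0 + z1 * \<xi> + z2 * \<xi>\<^sup>2\<bar> \<le> exp (V + U + e * V) * exp (- h)"
      using Q z by (intro mult_mono) auto
    also have "\<dots> = exp (V + U + e * V - h)" by (simp flip: exp_add)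
    also have "\<dots> \<le> 1 / 8" using h eU eUV by (intro exp_le_small) (simp add: UV[symmetric])
    finally show ?thesis .
  qed
  have b: "exp H * exp (- (x * (V + U)) + e * V) \<le> 1 / 8"
  proof -
    have "exp H * exp (- (x * (V + U)) + e * V) = exp (H - x * V - x * U + e * V)"
      by (simp add: algebra_simps flip: exp_add)
    also have "\<dots> \<le> 1 / 8"
    proof (rule exp_le_small)
      show "H - x * V - x * U + e * V \<le> - 3"
        using H eU eUV eV xV unfolding UV[symmetric] by argo
    qed
    finally show ?thesis .
  qed
  have "\<bar>real_of_int z1\<bar> * \<bar>Q0 k 1 * \<xi> - Q1 k 1\<bar> \<le> exp H * exp (- (x * (V + U)) + e * V)"
    "\<bar>real_of_int z2\<bar> * \<bar>Q0 k 1 * \<xi>\<^sup>2 - Q2 k 1\<bar> \<le> exp H * exp (- (x * (V + U)) + e * V)"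
    using Q z by (auto intro!: mult_mono)
  then have dot: "z0 * Q0 k 1 + z1 * Q1 k 1 + z2 * Q2 k 1 = 0"
    using a b by (intro dot_eq_0[where \<xi> = \<xi>]) linarith
  have dot': "Q0 k 1 * z0 + Q1 k 1 * z1 + Q2 k 1 * z2 = 0"
    "Q0 k 1 * Z0 k + Q1 k 1 * Z1 k + Q2 k 1 * Z2 k = 0"
    using dot orth1[of k] by (simp_all add: mult.commute)
  obtain c where c: "z1 * Z2 k - z2 * Z1 k = c * Q0 k 1" "z2 * Z0 k - z0 * Z2 k = c * Q1 k 1"
      "z0 * Z1 k - z1 * Z0 k = c * Q2 k 1"
    by (rule cross_proportional[OF prim_Q[OF order_refl] dot'])
  have "c = 0"
  proof (rule ccontr)
    assume "c \<noteq> 0"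
    then have "1 * \<bar>real_of_int (Q0 k 1)\<bar> \<le> \<bar>real_of_int c\<bar> * \<bar>real_of_int (Q0 k 1)\<bar>"
      by (intro mult_right_mono) auto
    also have "\<dots> = \<bar>real_of_int (z1 * Z2 k - z2 * Z1 k)\<bar>" unfolding c by (simp add: abs_mult)
    also have "\<dots> \<le> \<bar>real_of_int z1\<bar> * \<bar>real_of_int (Z2 k)\<bar> + \<bar>real_of_int z2\<bar> * \<bar>real_of_int (Z1 k)\<bar>"
      by (simp add: abs_mult[symmetric])
    also have "\<dots> \<le> exp H * exp U + exp H * exp U"
      using z Z_le[of k] unfolding UV by (intro add_mono mult_mono) auto
    also have "\<dots> = 2 * exp (H + U)" by (simp add: exp_add)
    also have "\<dots> < 8 * exp (H + U)" by simp
    also have "\<dots> \<le> exp (V + U - e * V)"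
      using H eU eUV by (intro exp_add3_le) (simp add: UV[symmetric])
    finally show False using Q by simp
  qed
  then have "z1 * Z2 k = z2 * Z1 k" "z2 * Z0 k = z0 * Z2 k" "z0 * Z1 k = z1 * Z0 k" using c by auto
  then obtain d where d: "z0 = d * Z0 k" "z1 = d * Z1 k" "z2 = d * Z2 k"
    by (rule parallel_multiple[OF prim_Z])
  have "d \<noteq> 0" using d z by auto
  then have "1 * \<bar>Z0 k + Z1 k * \<xi> + Z2 k * \<xi>\<^sup>2\<bar> \<le> \<bar>real_of_int d\<bar> * \<bar>Z0 k + Z1 k * \<xi> + Z2 k * \<xi>\<^sup>2\<bar>"
    by (intro mult_right_mono) auto
  also have "\<dots> = \<bar>z0 + z1 * \<xi> + z2 * \<xi>\<^sup>2\<bar>"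
    unfolding d abs_mult[symmetric] by (simp add: algebra_simps)
  finally show ?thesis using z by simp
qed

text \<open>For heights from about \<open>W k\<close> to about \<open>W (Suc k)\<close>, every
  candidate is a multiple of \<open>Z k\<close>, whose value has exponent
  \<open>x * W k + (1 + x) * W (Suc k)\<close>. Relative to the least such height this is at most
  about \<open>x + (1 + x) * \<rho>\<close>. The factor \<open>1 - 4 * e\<close> makes room for the
  height condition of \<open>form_multiple\<close>.\<close>

lemma omega_le:
  assumes w: "x + (1 + x) * \<rho> < w"
  shows "\<forall>\<^sub>F X in at_top. \<not> omega_solvable \<xi> w X"
proof -
  define Om where "Om = x + (1 + x) * \<rho>"
  have "0 \<le> (1 + x) * \<rho>" using x_ge rho by simp
  then have w0: "0 < w" using w x_ge by linarith
  have Om: "Om < w" using w unfolding Om_def .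
  \<comment> \<open>The last bound is what \<open>key\<close> needs: \<open>w\<close> beats
    \<open>Om\<close> even after the loss of the factor \<open>1 - 4 * e\<close>.\<close>
  obtain e where e: "0 < e" "e * (8 * (B + 2)) \<le> 1" "e * (2 * (3 + 4 * w)) \<le> w - Om"
    by (rule small_number[of "8 * (B + 2)" "w - Om" "2 * (3 + 4 * w)"]) (use Om w0 B in auto)
  have e24: "24 * e \<le> 1"
  proof -
    have "e * 24 \<le> e * (8 * (B + 2))" using e B by (intro mult_left_mono) auto
    then show ?thesis using e by linarith
  qed
  have key: "Om + 3 * e < w * (1 - 4 * e)"
    using e Om by (simp add: algebra_simps)
  have "\<forall>\<^sub>F H in at_top. \<not> omega_solvable \<xi> w (exp H)"
  proof (rule eventually_between)
    show "filterlim (\<lambda>k. (1 - 4 * e) * W k) at_top sequentially"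
      using e24 by (intro W_scaled_lim) simp
    show "\<forall>\<^sub>F k in sequentially. \<forall>H. (1 - 4 * e) * W k \<le> H \<longrightarrow> H < (1 - 4 * e) * W (Suc k) \<longrightarrow>
        \<not> omega_solvable \<xi> w (exp H)"
      using eventually_near[OF e(1)]
    proof (eventually_elim, intro allI impI notI)
      fix k H assume near: "near e k" and H: "(1 - 4 * e) * W k \<le> H" "H < (1 - 4 * e) * W (Suc k)"
        and "omega_solvable \<xi> w (exp H)"
      then obtain z0 z1 z2 :: int where z: "(z0, z1, z2) \<noteq> (0, 0, 0)"
        "\<bar>z0 + z1 * \<xi> + z2 * \<xi>\<^sup>2\<bar> \<le> exp (- (w * H))" "\<bar>real_of_int z1\<bar> \<le> exp H" "\<bar>real_of_int z2\<bar> \<le> exp H"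
        unfolding omega_solvable_exp by blast
      define U V where UV: "U = W k" "V = W (Suc k)"
      have U0: "0 < U" "U \<le> V" and VU: "V \<le> (\<rho> + e) * U"
        using near W_pos[of k] W_mono[of k] unfolding near_def UV by auto
      have "w * ((1 - 4 * e) * U) \<le> w * H" using H w0 unfolding UV by (intro mult_left_mono) auto
      moreover have "(Om + 3 * e) * U < (w * (1 - 4 * e)) * U" using key U0 by (intro mult_strict_right_mono) auto
      ultimately have wH: "(Om + 3 * e) * U < w * H" by (simp add: mult.assoc)
      have "(1 + x) * V \<le> (1 + x) * ((\<rho> + e) * U)" using VU x_ge by (intro mult_left_mono) auto
      moreover have "x * (e * U) \<le> 1 * (e * U)" using x e U0 by (intro mult_right_mono) auto
      ultimately have 1: "x * U + (1 + x) * V + e * U \<le> (Om + 3 * e) * U"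
        unfolding Om_def by (simp add: algebra_simps)
      have "V + U + 4 * (e * V) \<le> w * H"
      proof -
        have "V + U + 4 * (e * V) = (1 + 4 * e) * V + U" by (simp add: algebra_simps)
        also have "\<dots> \<le> (1 + 4 * e) * ((\<rho> + e) * U) + U" using VU e by (intro add_right_mono mult_left_mono) auto
        also have "\<dots> = ((1 + 4 * e) * (\<rho> + e) + 1) * U" by (simp add: algebra_simps)
        also have "\<dots> \<le> (Om + 3 * e) * U"
        proof (intro mult_right_mono)
          have "e * \<rho> \<le> 1 / 24 * \<rho>" "e * e \<le> 1 / 24 * e" "79 / 80 * \<rho> \<le> x * \<rho>"
            using e24 e rho x_ge by (auto intro!: mult_right_mono)
          moreover have "(1 + 4 * e) * (\<rho> + e) + 1 = 1 + \<rho> + e + 4 * (e * \<rho>) + 4 * (e * e)"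
            "Om = x + \<rho> + x * \<rho>"
            unfolding Om_def by (simp_all add: algebra_simps)
          ultimately show "(1 + 4 * e) * (\<rho> + e) + 1 \<le> Om + 3 * e"
            using rho e(1) e24 x_ge by linarith
        qed (use U0 in auto)
        finally show ?thesis using wH by linarith
      qed
      then have "\<bar>Z0 k + Z1 k * \<xi> + Z2 k * \<xi>\<^sup>2\<bar> \<le> exp (- (w * H))"
        using z H by (intro form_multiple[OF near e(1,2)]) (auto simp: UV algebra_simps)
      moreover have "exp (- (x * U + (1 + x) * V) - e * U) \<le> \<bar>Z0 k + Z1 k * \<xi> + Z2 k * \<xi>\<^sup>2\<bar>"
        using near unfolding near_def UV by auto
      ultimately have "exp (- (x * U + (1 + x) * V) - e * U) \<le> exp (- (w * H))" by linarith
      then show False using wH 1 by simp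
    qed
  qed
  then show ?thesis by (rule eventually_exp)
qed

text \<open>The bad heights lie just below \<open>W (Suc k)\<close>, where \<open>Z k\<close> is
  still the only candidate, for those \<open>k\<close> at which \<open>W (Suc k) / W k\<close> is
  close to its upper limit. There \<open>W k\<close> is about
  \<open>\<sigma> * W (Suc k)\<close>.\<close>

lemma omega_hat_le:
  assumes w: "x + 1 + x / \<rho> < w"
  shows "\<exists>\<^sub>F X in at_top. \<not> omega_solvable \<xi> w X"
proof -
  define \<sigma> where "\<sigma> = 1 / \<rho>"
  have sig: "0 < \<sigma>" "\<sigma> \<le> 1" "\<rho> * \<sigma> = 1" using rho unfolding \<sigma>_def by (auto simp: field_simps)
  define Om where "Om = x + 1 + x * \<sigma>"
  have Om: "Om < w" using w unfolding Om_def \<sigma>_def by simp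
  have "0 \<le> x * \<sigma>" using x_ge sig by simp
  then have w0: "0 < w" using Om x_ge unfolding Om_def by linarith
  obtain e where e: "0 < e" "e * (8 * (B + 2)) \<le> 1" "e * (2 * (6 + 4 * w)) \<le> w - Om"
    by (rule small_number[of "8 * (B + 2)" "w - Om" "2 * (6 + 4 * w)"]) (use Om w0 B in auto)
  have e24: "24 * e \<le> 1"
  proof -
    have "e * 24 \<le> e * (8 * (B + 2))" using e B by (intro mult_left_mono) auto
    then show ?thesis using e by linarith
  qed
  have key: "Om + 6 * e < w * (1 - 4 * e)"
    using e Om by (simp add: algebra_simps)
  have "\<exists>\<^sub>F k in sequentially. \<not> omega_solvable \<xi> w (exp ((1 - 4 * e) * W (Suc k)))"
  proof (rule frequently_rev_mp[OF ratio_ge[OF e(1)]])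
    show "\<forall>\<^sub>F k in sequentially. (\<rho> - e) * W k \<le> W (Suc k) \<longrightarrow>
        \<not> omega_solvable \<xi> w (exp ((1 - 4 * e) * W (Suc k)))"
      using eventually_near[OF e(1)]
    proof (eventually_elim, intro impI notI)
      fix k assume near: "near e k" and ratio: "(\<rho> - e) * W k \<le> W (Suc k)"
        and solv: "omega_solvable \<xi> w (exp ((1 - 4 * e) * W (Suc k)))"
      define H where "H = (1 - 4 * e) * W (Suc k)"
      obtain z0 z1 z2 :: int where z: "(z0, z1, z2) \<noteq> (0, 0, 0)"
        "\<bar>z0 + z1 * \<xi> + z2 * \<xi>\<^sup>2\<bar> \<le> exp (- (w * H))" "\<bar>real_of_int z1\<bar> \<le> exp H" "\<bar>real_of_int z2\<bar> \<le> exp H"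
        using solv[folded H_def] unfolding omega_solvable_exp by blast
      define U V where UV: "U = W k" "V = W (Suc k)"
      have U0: "0 < U" "U \<le> V" using W_pos[of k] W_mono[of k] unfolding UV by auto
      have UV': "U \<le> (\<sigma> + e) * V"
      proof -
        have "\<sigma> * ((\<rho> - e) * U) \<le> \<sigma> * V" using ratio sig unfolding UV by (intro mult_left_mono) auto
        moreover have "\<sigma> * ((\<rho> - e) * U) = (\<rho> * \<sigma>) * U - \<sigma> * (e * U)" by (simp add: algebra_simps)
        moreover have "\<sigma> * (e * U) \<le> 1 * (e * V)" using sig e U0 by (intro mult_mono) auto
        ultimately show ?thesis using sig by (simp add: algebra_simps)
      qed
      have V0: "0 < V" using U0 by linarith
      have "(Om + 6 * e) * V < (w * (1 - 4 * e)) * V" using key V0 by (intro mult_strict_right_mono) auto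
      then have wH: "(Om + 6 * e) * V < w * H" unfolding H_def UV by (simp add: mult.assoc)
      have eUV: "e * U \<le> e * V" "0 \<le> e * V" using U0 e by auto
      have "x * U \<le> x * ((\<sigma> + e) * V)" using UV' x_ge by (intro mult_left_mono) auto
      moreover have "x * (e * V) \<le> 1 * (e * V)" using x e V0 by (intro mult_right_mono) auto
      ultimately have 1: "x * U + (1 + x) * V + e * U \<le> (Om + 6 * e) * V"
        using eUV unfolding Om_def by (simp add: algebra_simps)
      have "V + U + 4 * (e * V) \<le> w * H"
      proof -
        have "79 / 80 * \<sigma> \<le> x * \<sigma>" using sig x_ge by (intro mult_right_mono) auto
        then have "1 + (\<sigma> + e) + 4 * e \<le> Om + 6 * e" unfolding Om_def using x_ge sig e(1) by linarith
        then have "(1 + (\<sigma> + e) + 4 * e) * V \<le> (Om + 6 * e) * V" using V0 by (intro mult_right_mono) auto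
        then show ?thesis using wH UV' by (simp add: algebra_simps)
      qed
      then have "\<bar>Z0 k + Z1 k * \<xi> + Z2 k * \<xi>\<^sup>2\<bar> \<le> exp (- (w * H))"
        using z by (intro form_multiple[OF near e(1,2)]) (auto simp: UV H_def algebra_simps)
      moreover have "exp (- (x * U + (1 + x) * V) - e * U) \<le> \<bar>Z0 k + Z1 k * \<xi> + Z2 k * \<xi>\<^sup>2\<bar>"
        using near unfolding near_def UV by auto
      ultimately have "exp (- (x * U + (1 + x) * V) - e * U) \<le> exp (- (w * H))" by linarith
      then show False using wH 1 by simp
    qed
  qed
  moreover have "filterlim (\<lambda>k. (1 - 4 * e) * W (Suc k)) at_top sequentially"
    using e24 by (intro filterlim_compose[OF W_scaled_lim filterlim_Suc]) simp
  ultimately show ?thesis by (rule frequently_exp)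
qed

lemma Z_nontrivial: "near e k \<Longrightarrow> (Z0 k, Z1 k, Z2 k) \<noteq> (0, 0, 0)"
  unfolding near_def by (auto simp: not_le)

lemma omega_ge:
  assumes w: "w < x + (1 + x) * \<rho>"
  shows "\<exists>\<^sub>F X in at_top. omega_solvable \<xi> w X"
proof -
  define e where "e = (x + (1 + x) * \<rho> - w) / 3"
  have e: "0 < e" using w unfolding e_def by simp
  have "\<exists>\<^sub>F k in sequentially. omega_solvable \<xi> w (exp (W k))"
  proof (rule frequently_rev_mp[OF ratio_ge[OF e]])
    show "\<forall>\<^sub>F k in sequentially. (\<rho> - e) * W k \<le> W (Suc k) \<longrightarrow> omega_solvable \<xi> w (exp (W k))"
      using eventually_near[OF e]
    proof (eventually_elim, intro impI)
      fix k assume near: "near e k" and ratio: "(\<rho> - e) * W k \<le> W (Suc k)"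
      have U0: "0 < W k" by (rule W_pos)
      have "(1 + x) * ((\<rho> - e) * W k) \<le> (1 + x) * W (Suc k)"
        using ratio x_ge by (intro mult_left_mono) auto
      moreover have "x * (e * W k) \<le> 1 * (e * W k)" using x e U0 by (intro mult_right_mono) auto
      moreover have "w * W k = (x + (1 + x) * \<rho>) * W k - 3 * (e * W k)"
        unfolding e_def by (simp add: field_simps)
      ultimately have "w * W k \<le> x * W k + (1 + x) * W (Suc k) - e * W k"
        by (simp add: algebra_simps)
      then have "exp (- (x * W k + (1 + x) * W (Suc k)) + e * W k) \<le> exp (- (w * W k))" by simp
      moreover have "\<bar>Z0 k + Z1 k * \<xi> + Z2 k * \<xi>\<^sup>2\<bar> \<le> exp (- (x * W k + (1 + x) * W (Suc k)) + e * W k)"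
        using near unfolding near_def by auto
      ultimately show "omega_solvable \<xi> w (exp (W k))"
        using Z_le(1,2)[of k]
        by (intro omega_solvable_expI[OF Z_nontrivial[OF near]]) linarith+
    qed
  qed
  then show ?thesis using W_lim by (rule frequently_exp)
qed

text \<open>From height \<open>W k\<close> to \<open>W (Suc k)\<close> the form \<open>Z k\<close>
  serves. The upper end is the worst height, and there \<open>W k\<close> is at least about
  \<open>W (Suc k) / \<rho>\<close>.\<close>

lemma omega_hat_ge:
  assumes w: "0 < w" "w < x + 1 + x / \<rho>"
  shows "\<forall>\<^sub>F X in at_top. omega_solvable \<xi> w X"
proof -
  define \<sigma> where "\<sigma> = 1 / \<rho>"
  have sig: "0 < \<sigma>" "\<sigma> \<le> 1" "\<rho> * \<sigma> = 1" using rho unfolding \<sigma>_def by (auto simp: field_simps)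
  define e where "e = (x + 1 + x / \<rho> - w) / 2"
  have e: "0 < e" using w unfolding e_def by simp
  have "\<forall>\<^sub>F H in at_top. omega_solvable \<xi> w (exp H)"
  proof (rule eventually_between[OF W_lim])
    show "\<forall>\<^sub>F k in sequentially. \<forall>H. W k \<le> H \<longrightarrow> H < W (Suc k) \<longrightarrow> omega_solvable \<xi> w (exp H)"
      using eventually_near[OF e]
    proof (eventually_elim, intro impI allI)
      fix k H assume near: "near e k" and H: "W k \<le> H" "H < W (Suc k)"
      define U V where UV: "U = W k" "V = W (Suc k)"
      have U0: "0 < U" "U \<le> V" and VU: "V \<le> (\<rho> + e) * U"
        using near W_pos[of k] W_mono[of k] unfolding near_def UV by auto
      have eUV: "e * U \<le> e * V" using U0 e by auto
      have "\<sigma> * V \<le> \<sigma> * ((\<rho> + e) * U)" using VU sig by (intro mult_left_mono) auto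
      also have "\<dots> = (\<rho> * \<sigma>) * U + \<sigma> * (e * U)" by (simp add: algebra_simps)
      also have "\<dots> \<le> U + 1 * (e * V)" using sig eUV e U0 by (intro add_mono mult_mono) auto
      finally have "\<sigma> * V - e * V \<le> U" by simp
      then have "x * (\<sigma> * V - e * V) \<le> x * U" using x_ge by (intro mult_left_mono) auto
      moreover have "x * (e * V) \<le> 1 * (e * V)" using x e U0 by (intro mult_right_mono) auto
      moreover have "w * V = (x + 1 + x * \<sigma>) * V - 2 * (e * V)"
        unfolding e_def \<sigma>_def by (simp add: field_simps)
      ultimately have "w * V \<le> x * U + (1 + x) * V - e * U"
        using eUV by (simp add: algebra_simps)
      moreover have "w * H \<le> w * V" using w H unfolding UV by (intro mult_left_mono) auto
      ultimately have "exp (- (x * U + (1 + x) * V) + e * U) \<le> exp (- (w * H))" by simp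
      moreover have "\<bar>Z0 k + Z1 k * \<xi> + Z2 k * \<xi>\<^sup>2\<bar> \<le> exp (- (x * U + (1 + x) * V) + e * U)"
        using near unfolding near_def UV by auto
      moreover have "exp (W k) \<le> exp H" using H by simp
      ultimately show "omega_solvable \<xi> w (exp H)"
        using Z_le(1,2)[of k]
        by (intro omega_solvable_expI[OF Z_nontrivial[OF near]]) linarith+
    qed
  qed
  then show ?thesis by (rule eventually_exp)
qed

section \<open>Simultaneous approximation and the exponents \<open>lambda2\<close> and
  \<open>lambda2_hat\<close>\<close>

lemma point_in_plane:
  fixes y0 y1 y2 :: int
  assumes near: "near e (Suc k)"
    and y: "\<bar>real_of_int y0\<bar> \<le> exp H" "\<bar>y0 * \<xi> - y1\<bar> \<le> exp (- h)" "\<bar>y0 * \<xi>\<^sup>2 - y2\<bar> \<le> exp (- h)"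
    and H: "H + 3 \<le> x * W (Suc k) + (1 + x) * W (Suc (Suc k)) - e * W (Suc k)"
    and h: "W (Suc k) + 3 \<le> h"
  shows "Z0 (Suc k) * y0 + Z1 (Suc k) * y1 + Z2 (Suc k) * y2 = 0"
proof -
  define V where "V = W (Suc k)"
  let ?v = "\<bar>Z0 (Suc k) + Z1 (Suc k) * \<xi> + Z2 (Suc k) * \<xi>\<^sup>2\<bar>"
  have v: "?v \<le> exp (- (x * V + (1 + x) * W (Suc (Suc k))) + e * V)"
    using near unfolding near_def V_def by blast
  have "\<bar>real_of_int y0\<bar> * ?v \<le> exp H * exp (- (x * V + (1 + x) * W (Suc (Suc k))) + e * V)"
    using y v by (intro mult_mono) auto
  also have "\<dots> = exp (H + (- (x * V + (1 + x) * W (Suc (Suc k))) + e * V))" by (simp only: exp_add)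
  also have "\<dots> \<le> 1 / 8" using H by (intro exp_le_small) (simp add: V_def)
  finally have a: "\<bar>real_of_int y0\<bar> * ?v \<le> 1 / 8" .
  have "exp V * exp (- h) = exp (V - h)" by (simp flip: exp_add)
  also have "\<dots> \<le> 1 / 8" using h by (intro exp_le_small) (simp add: V_def)
  finally have b: "exp V * exp (- h) \<le> 1 / 8" .
  have "\<bar>real_of_int (Z1 (Suc k))\<bar> * \<bar>y0 * \<xi> - y1\<bar> \<le> exp V * exp (- h)"
    "\<bar>real_of_int (Z2 (Suc k))\<bar> * \<bar>y0 * \<xi>\<^sup>2 - y2\<bar> \<le> exp V * exp (- h)"
    using y Z_le[of "Suc k"] unfolding V_def by (auto intro!: mult_mono)
  then show ?thesis using a b by (intro dot_eq_0[where \<xi> = \<xi>]) linarith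
qed

text \<open>Both \<open>y\<close> and \<open>Q k j\<close> lie in the plane of
  \<open>Z (Suc k)\<close>, so their cross product is an integer multiple of
  \<open>Z (Suc k)\<close>. Its middle coordinate, computed from the two approximation errors, is
  smaller than that of \<open>Z (Suc k)\<close>; so the multiple is zero and \<open>y\<close> is a
  multiple of \<open>Q k j\<close>.\<close>

lemma point_multiple:
  fixes y0 y1 y2 :: int and j k :: nat
  defines "Y \<equiv> j * W (Suc k) + W k"
  assumes near: "near e k" "near e (Suc k)" and j: "1 \<le> j" "j \<le> s k"
    and plane: "Z0 (Suc k) * y0 + Z1 (Suc k) * y1 + Z2 (Suc k) * y2 = 0"
    and y: "(y0, y1, y2) \<noteq> (0, 0, 0)" "\<bar>real_of_int y0\<bar> \<le> exp H" "\<bar>y0 * \<xi>\<^sup>2 - y2\<bar> \<le> exp (- h)"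
    and H: "H + 3 \<le> W (Suc k) + x * Y - 2 * (e * W (Suc k))"
    and h: "Y + 3 \<le> W (Suc k) + h - 2 * (e * W (Suc k))"
  shows "Y - e * W (Suc k) \<le> H" "h \<le> x * Y + e * W (Suc k)"
proof -
  define V where "V = W (Suc k)"
  have Q: "\<bar>real_of_int (Q0 k j)\<bar> \<le> exp (Y + e * V)"
    "exp (Y - e * V) \<le> \<bar>real_of_int (Q0 k j)\<bar>"
    "\<bar>Q0 k j * \<xi>\<^sup>2 - Q2 k j\<bar> \<le> exp (- (x * Y) + e * V)"
    "exp (- (x * Y) - e * V) \<le> \<bar>Q0 k j * \<xi>\<^sup>2 - Q2 k j\<bar>"
    using near(1) j unfolding near_def Y_def V_def by blast+
  have Z: "exp (V - e * V) \<le> \<bar>real_of_int (Z1 (Suc k))\<bar>"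
    using near(2) unfolding near_def V_def by blast
  obtain c where c: "y1 * Q2 k j - y2 * Q1 k j = c * Z0 (Suc k)" "y2 * Q0 k j - y0 * Q2 k j = c * Z1 (Suc k)"
      "y0 * Q1 k j - y1 * Q0 k j = c * Z2 (Suc k)"
    by (rule cross_proportional[OF prim_Z plane orth])
  have "c = 0"
  proof (rule ccontr)
    assume "c \<noteq> 0"
    then have "1 * \<bar>real_of_int (Z1 (Suc k))\<bar> \<le> \<bar>real_of_int c\<bar> * \<bar>real_of_int (Z1 (Suc k))\<bar>"
      by (intro mult_right_mono) auto
    also have "\<dots> = \<bar>real_of_int (y2 * Q0 k j - y0 * Q2 k j)\<bar>" unfolding c by (simp add: abs_mult)
    also have "real_of_int (y2 * Q0 k j - y0 * Q2 k j)
        = y0 * (Q0 k j * \<xi>\<^sup>2 - Q2 k j) - Q0 k j * (y0 * \<xi>\<^sup>2 - y2)" by (simp add: algebra_simps)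
    also have "\<bar>\<dots>\<bar> \<le> \<bar>real_of_int y0\<bar> * \<bar>Q0 k j * \<xi>\<^sup>2 - Q2 k j\<bar> + \<bar>real_of_int (Q0 k j)\<bar> * \<bar>y0 * \<xi>\<^sup>2 - y2\<bar>"
      unfolding abs_mult[symmetric] by (rule abs_triangle_ineq4)
    also have "\<dots> \<le> exp H * exp (- (x * Y) + e * V) + exp (Y + e * V) * exp (- h)"
      using y Q by (intro add_mono mult_mono) auto
    also have "\<dots> = exp (H - x * Y + e * V) + exp (Y + e * V - h)"
      by (simp add: algebra_simps flip: exp_add)
    finally have 1: "\<bar>real_of_int (Z1 (Suc k))\<bar> \<le> exp (H - x * Y + e * V) + exp (Y + e * V - h)" by simp
    have 2: "8 * exp (H - x * Y + e * V) \<le> exp (V - e * V)" "8 * exp (Y + e * V - h) \<le> exp (V - e * V)"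
      using H h by (auto intro!: exp_add3_le simp: V_def)
    have "0 < exp (V - e * V)" by simp
    then show False using 1 2 Z by linarith
  qed
  then have "y1 * Q2 k j = y2 * Q1 k j" "y2 * Q0 k j = y0 * Q2 k j" "y0 * Q1 k j = y1 * Q0 k j" using c by auto
  then obtain d where d: "y0 = d * Q0 k j" "y1 = d * Q1 k j" "y2 = d * Q2 k j"
    by (rule parallel_multiple[OF prim_Q[OF j(1)]])
  have d1: "1 \<le> \<bar>real_of_int d\<bar>" using d y by (cases "d = 0") auto
  have "1 * \<bar>real_of_int (Q0 k j)\<bar> \<le> \<bar>real_of_int d\<bar> * \<bar>real_of_int (Q0 k j)\<bar>"
    using d1 by (intro mult_right_mono) auto
  also have "\<dots> = \<bar>real_of_int y0\<bar>" unfolding d by (simp add: abs_mult)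
  finally have "exp (Y - e * V) \<le> exp H" using y Q by linarith
  then show "Y - e * W (Suc k) \<le> H" unfolding V_def by simp
  have "1 * \<bar>Q0 k j * \<xi>\<^sup>2 - Q2 k j\<bar> \<le> \<bar>real_of_int d\<bar> * \<bar>Q0 k j * \<xi>\<^sup>2 - Q2 k j\<bar>"
    using d1 by (intro mult_right_mono) auto
  also have "\<dots> = \<bar>y0 * \<xi>\<^sup>2 - y2\<bar>" unfolding d abs_mult[symmetric] by (simp add: algebra_simps)
  also note y(3)
  finally have "1 * \<bar>Q0 k j * \<xi>\<^sup>2 - Q2 k j\<bar> \<le> exp (- h)" .
  then have "exp (- (x * Y) - e * V) \<le> exp (- h)" using Q(4) by (metis mult_1 order_trans)
  then show "h \<le> x * Y + e * W (Suc k)" unfolding V_def by simp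
qed

lemma lambda_ge:
  assumes w: "0 < w" "w < x"
  shows "\<exists>\<^sub>F X in at_top. lambda_solvable \<xi> w X"
proof -
  define e where "e = (x - w) / 2"
  have e: "0 < e" using w unfolding e_def by simp
  define f where "f k = W (Suc k) + W k + e * W (Suc k)" for k
  have "\<forall>\<^sub>F k in sequentially. lambda_solvable \<xi> w (exp (f k))"
    using eventually_near[OF e]
  proof eventually_elim
    case (elim k)
    define U V where UV: "U = W k" "V = W (Suc k)"
    have U0: "0 < U" "U \<le> V" using W_pos[of k] W_mono[of k] unfolding UV by auto
    have Q: "\<bar>real_of_int (Q0 k 1)\<bar> \<le> exp (f k)" "exp (V + U - e * V) \<le> \<bar>real_of_int (Q0 k 1)\<bar>"
      "\<bar>Q0 k 1 * \<xi> - Q1 k 1\<bar> \<le> exp (- (x * (V + U)) + e * V)"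
      "\<bar>Q0 k 1 * \<xi>\<^sup>2 - Q2 k 1\<bar> \<le> exp (- (x * (V + U)) + e * V)"
      using elim s(1)[of k] unfolding near_def UV f_def by force+
    have Q0: "Q0 k 1 \<noteq> 0" using Q(2) by (auto simp: not_le)
    have "w * (e * V) \<le> 1 * (e * V)" using w x e U0 by (intro mult_right_mono) auto
    moreover have "w * (V + U) = x * (V + U) - 2 * (e * V) - 2 * (e * U)"
      unfolding e_def by (simp add: field_simps)
    moreover have "0 < e * U" using e U0 by simp
    moreover have "w * f k = w * (V + U) + w * (e * V)" unfolding f_def UV[symmetric] by (simp add: distrib_left)
    ultimately have "w * f k \<le> x * (V + U) - e * V" by linarith
    then have "exp (- (x * (V + U)) + e * V) \<le> exp (- (w * f k))" by simp
    then show ?case using Q0 Q(1)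
      by (intro lambda_solvable_expI[of "Q0 k 1" "Q1 k 1" "Q2 k 1"] order_trans[OF Q(3)] order_trans[OF Q(4)]) auto
  qed
  then have "\<exists>\<^sub>F k in sequentially. lambda_solvable \<xi> w (exp (f k))"
    by (rule eventually_frequently[rotated]) simp
  moreover have "filterlim f at_top sequentially"
  proof (rule filterlim_at_top_mono[OF W_lim], intro always_eventually allI)
    show "W k \<le> f k" for k unfolding f_def using W_pos[of "Suc k"] e by simp
  qed
  ultimately show ?thesis by (rule frequently_exp)
qed

text \<open>A better point would lie in the plane of some \<open>Z (Suc k)\<close> and be a multiple
  of some \<open>Q k j\<close>. Since \<open>Q k j\<close> has height about \<open>exp (Y j)\<close>
  and error about \<open>exp (- x * Y j)\<close>, this is impossible for
  \<open>w > x\<close>.\<close>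

lemma lambda_le:
  assumes w: "x < w" "w < 1"
  shows "\<forall>\<^sub>F X in at_top. \<not> lambda_solvable \<xi> w X"
proof -
  have w0: "79 / 80 < w" using w x_ge by linarith
  obtain e where e: "0 < e" "e * (100 * (B + 3)) \<le> 1" "e * 3 \<le> w - x"
    by (rule small_number[of "100 * (B + 3)" "w - x" "3"]) (use w B in auto)
  have e400: "400 * e \<le> 1"
  proof -
    have "e * 400 \<le> e * (100 * (B + 3))" using e B by (intro mult_left_mono) auto
    then show ?thesis using e by linarith
  qed
  \<comment> \<open>At this height the error bound \<open>exp (- w * H)\<close> begins to beat the
    coefficients of \<open>Z (Suc k)\<close>, so that the point is forced into its plane.\<close>
  define f where "f k = (1 + 4 * e) / w * W (Suc k)" for k
  have "\<forall>\<^sub>F H in at_top. \<not> lambda_solvable \<xi> w (exp H)"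
  proof (rule eventually_between)
    show "filterlim f at_top sequentially"
      unfolding f_def using e w0 by (intro filterlim_compose[OF W_scaled_lim filterlim_Suc]) simp
    show "\<forall>\<^sub>F k in sequentially. \<forall>H. f k \<le> H \<longrightarrow> H < f (Suc k) \<longrightarrow> \<not> lambda_solvable \<xi> w (exp H)"
      using eventually_near[OF e(1)] eventually_near_Suc[OF e(1)]
    proof (eventually_elim, intro allI impI notI)
      fix k H assume near: "near e k" "near e (Suc k)" and H: "f k \<le> H" "H < f (Suc k)"
        and "lambda_solvable \<xi> w (exp H)"
      then obtain y0 y1 y2 :: int where y: "(y0, y1, y2) \<noteq> (0, 0, 0)" "\<bar>real_of_int y0\<bar> \<le> exp H"
        "\<bar>y0 * \<xi> - y1\<bar> \<le> exp (- (w * H))" "\<bar>y0 * \<xi>\<^sup>2 - y2\<bar> \<le> exp (- (w * H))"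
        unfolding lambda_solvable_exp by blast
      define U V V2 where UV: "U = W k" "V = W (Suc k)" "V2 = W (Suc (Suc k))"
      define Y where "Y j = real j * V + U" for j :: nat
      have U0: "0 < U" "U \<le> V" "V \<le> V2" and eU: "3 \<le> e * U"
        using near W_pos[of k] W_mono[of k] W_mono[of "Suc k"] unfolding near_def UV by auto
      have eV: "3 \<le> e * V" "400 * (e * V) \<le> V" "400 * (e * V2) \<le> V2"
      proof -
        have "e * U \<le> e * V" using e U0 by simp
        then show "3 \<le> e * V" using eU by linarith
        have "(400 * e) * V \<le> 1 * V" "(400 * e) * V2 \<le> 1 * V2" using e400 U0 by (auto intro!: mult_right_mono)
        then show "400 * (e * V) \<le> V" "400 * (e * V2) \<le> V2" by simp_all
      qed
      have V2: "V2 \<le> Y (s k) + e * V" using near(1) unfolding near_def UV Y_def by simp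
      have wH: "V + 4 * (e * V) \<le> w * H" "w * H < V2 + 4 * (e * V2)"
      proof -
        have "w * f k \<le> w * H" "w * H < w * f (Suc k)" using H w0 by simp_all
        then show "V + 4 * (e * V) \<le> w * H" "w * H < V2 + 4 * (e * V2)"
          unfolding f_def UV using w0 by (simp_all add: distrib_right)
      qed
      have plane: "Z0 (Suc k) * y0 + Z1 (Suc k) * y1 + Z2 (Suc k) * y2 = 0"
      proof (rule point_in_plane[OF near(2) y(2-4)])
        show "W (Suc k) + 3 \<le> w * H" using wH eV unfolding UV by linarith
        have "0 \<le> H" using wH(1) eV(1) U0 w0 by (intro mult_left_le_imp_le[of w 0 H]) linarith+
        then have "79 / 80 * H \<le> w * H" using w0 by (intro mult_right_mono) auto
        moreover have "79 / 80 * V \<le> x * V" "79 / 80 * V2 \<le> x * V2"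
          using x_ge U0 by (auto intro!: mult_right_mono)
        ultimately have "H + 3 \<le> x * V + (V2 + x * V2) - e * V" using wH eV U0 by linarith
        then show "H + 3 \<le> x * W (Suc k) + (1 + x) * W (Suc (Suc k)) - e * W (Suc k)"
          unfolding UV by (simp add: algebra_simps)
      qed
      have Y_le: "Y j \<le> (B + 1) * V" if "j \<le> s k" for j
      proof -
        have "real j * V \<le> B * V" using that s(2)[of k] U0 by (intro mult_right_mono) auto
        then show ?thesis unfolding Y_def distrib_right using U0 by linarith
      qed
      \<comment> \<open>If the height is too large for a comparison with \<open>Q k j\<close>, then
        \<open>w * H\<close> has almost reached \<open>Y (Suc j)\<close>. The defect
        \<open>1 / 10\<close> is two applications of \<open>x_defect\<close>, each costing
        \<open>V / 20\<close>.\<close>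
      have far: "Y j + 9 / 10 * V - 3 * (e * V) \<le> w * H"
        if "j \<le> s k" "\<not> H + 3 \<le> V + x * Y j - 2 * (e * V)" for j
      proof -
        have Y0: "0 \<le> Y j" unfolding Y_def using U0 by simp
        define t where "t = V + x * Y j - 3 * (e * V)"
        have "t \<le> H" using that eV unfolding t_def by linarith
        have "x * Y j \<le> 1 * Y j" using x Y0 by (intro mult_right_mono) auto
        have Yx: "Y j - V / 20 \<le> x * Y j" using Y_le[OF that(1)] U0 Y0
          by (intro x_defect) (auto simp: distrib_right)
        have "t - V / 20 \<le> x * t"
        proof (rule x_defect)
          show "0 \<le> t" unfolding t_def using Yx Y0 eV by linarith
          show "t \<le> (B + 3) * V" unfolding t_def using \<open>x * Y j \<le> 1 * Y j\<close> Y_le[OF that(1)] U0 eV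
            by (simp add: distrib_right)
        qed (use U0 in auto)
        moreover have "x * t \<le> w * t" using w Yx Y0 eV unfolding t_def by (intro mult_right_mono) auto
        moreover have "w * t \<le> w * H" using \<open>t \<le> H\<close> w0 by simp
        ultimately show ?thesis using Yx unfolding t_def by linarith
      qed
      \<comment> \<open>The last index \<open>s k\<close> is always admissible: otherwise
        \<open>far\<close> pushes \<open>w * H\<close> past the upper end of the interval, because
        \<open>V2\<close> is at most about \<open>Y (s k)\<close>.\<close>
      have "H + 3 \<le> V + x * Y (s k) - 2 * (e * V)"
      proof (rule ccontr)
        assume "\<not> ?thesis"
        then have "Y (s k) + 9 / 10 * V - 3 * (e * V) \<le> w * H" by (intro far) auto
        also have "\<dots> < V2 + 4 * (e * V2)" by (rule wH)
        finally have 1: "Y (s k) + 9 / 10 * V - 3 * (e * V) < V2 + 4 * (e * V2)" .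
        have "V2 \<le> (B + 2) * V"
          using V2 Y_le[of "s k", OF order_refl] eV U0 unfolding distrib_right by linarith
        then have "e * V2 \<le> e * ((B + 2) * V)" using e by (intro mult_left_mono) auto
        also have "\<dots> \<le> 1 / 100 * V"
        proof -
          have "(e * (B + 2)) * V \<le> (1 / 100) * V"
            using e U0 by (intro mult_right_mono) (auto simp: algebra_simps)
          then show ?thesis by (simp add: mult.assoc)
        qed
        finally show False using 1 V2 eV by linarith
      qed
      then have ex: "\<exists>j. 1 \<le> j \<and> j \<le> s k \<and> H + 3 \<le> V + x * Y j - 2 * (e * V)" using s by blast
      define j where "j = (LEAST j. 1 \<le> j \<and> j \<le> s k \<and> H + 3 \<le> V + x * Y j - 2 * (e * V))"
      have j: "1 \<le> j" "j \<le> s k" "H + 3 \<le> V + x * Y j - 2 * (e * V)"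
        using LeastI_ex[OF ex] unfolding j_def by auto
      \<comment> \<open>The second condition of \<open>point_multiple\<close> comes from minimality:
        for \<open>j = 1\<close> from the lower end of the interval, otherwise from
        \<open>far\<close> at the preceding index.\<close>
      have "Y j + 3 \<le> V + w * H - 2 * (e * V)"
      proof (cases "j = 1")
        case True
        then show ?thesis unfolding Y_def using wH eV U0 by simp
      next
        case False
        then obtain i where i: "j = Suc i" "1 \<le> i" using j by (cases j) auto
        have "\<not> (1 \<le> i \<and> i \<le> s k \<and> H + 3 \<le> V + x * Y i - 2 * (e * V))"
          using not_less_Least[of i] i unfolding j_def by (metis lessI)
        then have "Y i + 9 / 10 * V - 3 * (e * V) \<le> w * H" using i j by (intro far) auto
        moreover have "Y j = Y i + V" unfolding Y_def i by (simp add: algebra_simps)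
        ultimately show ?thesis using eV by linarith
      qed
      then have "Y j - e * V \<le> H" "w * H \<le> x * Y j + e * V"
        using point_multiple[OF near j(1,2) plane y(1,2,4)] j(3) unfolding Y_def UV by blast+
      moreover have "w * (Y j - e * V) \<le> w * H" using calculation w0 by simp
      moreover have "w * (e * V) \<le> 1 * (e * V)" using w eV by (intro mult_right_mono) auto
      ultimately have "(w - x) * Y j \<le> 2 * (e * V)" by (simp add: algebra_simps)
      moreover have "V \<le> Y j"
      proof -
        have "1 * V \<le> real j * V" using j U0 by (intro mult_right_mono) auto
        then show ?thesis unfolding Y_def using U0 by linarith
      qed
      then have "(e * 3) * V \<le> (w - x) * Y j" using e w U0 by (intro mult_mono) auto
      ultimately show False using eV by simp
    qed
  qed
  then show ?thesis by (rule eventually_exp)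
qed

lemma near_bounds:
  assumes "near e k" "0 < e" "e * (8 * (B + 2)) \<le> 1"
  shows "0 < W k" "W k \<le> W (Suc k)" "3 \<le> e * W k" "e * W k \<le> e * W (Suc k)"
    "8 * (e * W (Suc k)) \<le> W k" "W (Suc k) + W k - W k / 20 \<le> x * (W (Suc k) + W k)"
proof -
  define U V where UV: "U = W k" "V = W (Suc k)"
  have U0: "0 < U" "U \<le> V" and eU: "3 \<le> e * U" and VU: "V \<le> (B + 2) * U"
    using assms W_pos[of k] W_mono[of k] unfolding near_def UV by auto
  show "0 < W k" "W k \<le> W (Suc k)" "3 \<le> e * W k" using U0 eU unfolding UV by auto
  show "e * W k \<le> e * W (Suc k)" using U0 assms(2) unfolding UV by simp
  have "e * V \<le> e * ((B + 2) * U)" using VU assms(2) by (intro mult_left_mono) auto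
  moreover have "(e * (8 * (B + 2))) * U \<le> 1 * U" using assms(3) U0 by (intro mult_right_mono) auto
  ultimately show "8 * (e * W (Suc k)) \<le> W k" unfolding UV by (simp add: algebra_simps)
  have "V + U - U / 20 \<le> x * (V + U)"
    using VU U0 by (intro x_defect) (auto simp: algebra_simps)
  then show "W (Suc k) + W k - W k / 20 \<le> x * (W (Suc k) + W k)" unfolding UV .
qed

text \<open>At the height \<open>f k\<close>, just before the plane of \<open>Z (Suc k)\<close>
  offers a point independent of \<open>Q k 1\<close>, only multiples of \<open>Q k 1\<close> can
  compete. At indices where the ratio is nearly \<open>\<rho>\<close>, their error is not small
  enough.\<close>

lemma lambda_hat_le:
  assumes w: "1 - 1 / (1 + (1 + 1 / \<rho>) * x) < w" "w < 1"
  shows "\<exists>\<^sub>F X in at_top. \<not> lambda_solvable \<xi> w X"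
proof -
  define \<sigma> where "\<sigma> = 1 / \<rho>"
  have sig: "0 < \<sigma>" "\<sigma> \<le> 1" "\<rho> * \<sigma> = 1" using rho unfolding \<sigma>_def by (auto simp: field_simps)
  \<comment> \<open>The claimed exponent is \<open>g / (1 + g)\<close>; \<open>key\<close> clears
    the denominator.\<close>
  define g where "g = (1 + \<sigma>) * x"
  have g: "0 < g" using sig x_ge unfolding g_def by simp
  have "g = (1 - 1 / (1 + g)) * (1 + g)" using g by (simp add: field_simps)
  also have "\<dots> < w * (1 + g)"
    using w g unfolding g_def \<sigma>_def by (intro mult_strict_right_mono) auto
  finally have key: "g < w * (1 + g)" .
  have w0: "0 < w"
  proof (rule ccontr)
    assume "\<not> 0 < w"
    then have "w * (1 + g) \<le> 0" using g by (simp add: mult_nonpos_nonneg)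
    then show False using key g by linarith
  qed
  obtain e where e: "0 < e" "e * (8 * (B + 2)) \<le> 1" "e * 6 \<le> w * (1 + g) - g"
    by (rule small_number[of "8 * (B + 2)" "w * (1 + g) - g" "6"]) (use key B in auto)
  define f where "f k = W (Suc k) + x * (W (Suc k) + W k) - 3 * (e * W (Suc k))" for k
  have "\<exists>\<^sub>F k in sequentially. \<not> lambda_solvable \<xi> w (exp (f k))"
  proof (rule frequently_rev_mp[OF ratio_ge[OF e(1)]])
    show "\<forall>\<^sub>F k in sequentially. (\<rho> - e) * W k \<le> W (Suc k) \<longrightarrow> \<not> lambda_solvable \<xi> w (exp (f k))"
      using eventually_near[OF e(1)] eventually_near_Suc[OF e(1)]
    proof (eventually_elim, intro impI notI)
      fix k assume near: "near e k" "near e (Suc k)" and ratio: "(\<rho> - e) * W k \<le> W (Suc k)"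
        and "lambda_solvable \<xi> w (exp (f k))"
      then obtain y0 y1 y2 :: int where y: "(y0, y1, y2) \<noteq> (0, 0, 0)" "\<bar>real_of_int y0\<bar> \<le> exp (f k)"
        "\<bar>y0 * \<xi> - y1\<bar> \<le> exp (- (w * f k))" "\<bar>y0 * \<xi>\<^sup>2 - y2\<bar> \<le> exp (- (w * f k))"
        unfolding lambda_solvable_exp by blast
      define U V V2 where UV: "U = W k" "V = W (Suc k)" "V2 = W (Suc (Suc k))"
      define Y where "Y = V + U"
      note nb = near_bounds[OF near(1) e(1,2), folded UV]
      have V2: "Y \<le> V2" using W_ge[of k] unfolding UV Y_def by simp
      have fk: "f k = V + x * Y - 3 * (e * V)" unfolding f_def UV Y_def ..
      have UV': "U \<le> (\<sigma> + e) * V"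
      proof -
        have "\<sigma> * ((\<rho> - e) * U) \<le> \<sigma> * V" using ratio sig unfolding UV by (intro mult_left_mono) auto
        moreover have "\<sigma> * ((\<rho> - e) * U) = (\<rho> * \<sigma>) * U - \<sigma> * (e * U)" by (simp add: algebra_simps)
        moreover have "\<sigma> * (e * U) \<le> 1 * (e * V)" by (rule mult_mono) (use sig nb in linarith)+
        ultimately show ?thesis using sig by (simp add: algebra_simps)
      qed
      have xY: "Y - U / 20 \<le> x * Y" using nb(6) unfolding Y_def .
      \<comment> \<open>Here \<open>Y\<close> is at most about \<open>(1 + \<sigma>) * V\<close>, so
        \<open>x * Y\<close> is at most about \<open>g * V\<close>, while \<open>f k\<close> is
        about \<open>V + x * Y\<close>. By \<open>key\<close>, \<open>w * f k\<close> exceeds the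
        exponent \<open>x * Y\<close> attained by \<open>Q k 1\<close>.\<close>
      have wf: "x * Y + 2 * (e * V) \<le> w * f k"
      proof -
        have xY': "x * Y \<le> (g + e) * V"
        proof -
          have "x * Y \<le> x * ((1 + \<sigma> + e) * V)" using UV' x_ge unfolding Y_def
            by (intro mult_left_mono) (auto simp: algebra_simps)
          also have "\<dots> = g * V + x * (e * V)" unfolding g_def by (simp add: algebra_simps)
          also have "x * (e * V) \<le> 1 * (e * V)" using x nb by (intro mult_right_mono) auto
          finally show ?thesis by (simp add: algebra_simps)
        qed
        have "(1 - w) * (x * Y) \<le> (1 - w) * ((g + e) * V)" using xY' w by (intro mult_left_mono) auto
        moreover have "w * (e * V) \<le> 1 * (e * V)" by (rule mult_right_mono) (use w nb in linarith)+
        moreover have "0 \<le> w * (e * V)" by (rule mult_nonneg_nonneg) (use w0 nb in linarith)+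
        moreover have "(e * 6) * V \<le> (w * (1 + g) - g) * V" by (rule mult_right_mono) (use e nb in linarith)+
        ultimately show ?thesis unfolding fk by (simp add: algebra_simps)
      qed
      have plane: "Z0 (Suc k) * y0 + Z1 (Suc k) * y1 + Z2 (Suc k) * y2 = 0"
      proof (rule point_in_plane[OF near(2) y(2-4)])
        show "W (Suc k) + 3 \<le> w * f k" using wf xY nb unfolding UV(2)[symmetric] Y_def by linarith
        have "(1 + x) * Y \<le> (1 + x) * V2" using V2 x_ge by (intro mult_left_mono) auto
        moreover have "(1 + x) * Y = Y + x * Y" by (simp add: algebra_simps)
        moreover have "0 \<le> x * V" using x_ge nb by simp
        ultimately show "f k + 3 \<le> x * W (Suc k) + (1 + x) * W (Suc (Suc k)) - e * W (Suc k)"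
          using nb unfolding fk UV[symmetric] unfolding Y_def by linarith
      qed
      have "w * f k \<le> x * (real 1 * W (Suc k) + W k) + e * W (Suc k)"
      proof (rule point_multiple(2)[OF near order_refl s(1) plane y(1,2,4)])
        have Y1: "real 1 * W (Suc k) + W k = Y" unfolding Y_def UV by simp
        show "f k + 3 \<le> W (Suc k) + x * (real 1 * W (Suc k) + W k) - 2 * (e * W (Suc k))"
          using nb unfolding Y1 fk unfolding UV(2)[symmetric] by linarith
        show "real 1 * W (Suc k) + W k + 3 \<le> W (Suc k) + w * f k - 2 * (e * W (Suc k))"
          using wf xY nb unfolding Y1 unfolding UV(2)[symmetric] by linarith
      qed
      then show False using wf nb unfolding UV[symmetric] Y_def by simp
    qed
  qed
  moreover have "filterlim f at_top sequentially"
  proof (rule filterlim_at_top_mono[OF W_lim])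
    show "\<forall>\<^sub>F k in sequentially. W k \<le> f k"
      using eventually_near[OF e(1)]
    proof eventually_elim
      case (elim k)
      show ?case using near_bounds[OF elim e(1,2)] unfolding f_def by linarith
    qed
  qed
  ultimately show ?thesis by (rule frequently_exp)
qed

text \<open>In each interval \<open>Q k 1\<close> serves first, and then a lattice point of the
  plane of \<open>Z (Suc k)\<close> given by \<open>plane_minkowski\<close>, until
  \<open>Q (Suc k) 1\<close> takes over.\<close>

lemma lambda_hat_ge:
  assumes w: "0 < w" "w < 1 - 1 / (1 + (1 + 1 / \<rho>) * x)"
  shows "\<forall>\<^sub>F X in at_top. lambda_solvable \<xi> w X"
proof -
  define \<sigma> where "\<sigma> = 1 / \<rho>"
  have sig: "0 < \<sigma>" "\<sigma> \<le> 1" "\<rho> * \<sigma> = 1" using rho unfolding \<sigma>_def by (auto simp: field_simps)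
  define g where "g = (1 + \<sigma>) * x"
  have g: "0 < g" "g \<le> 2"
  proof -
    show "0 < g" using sig x_ge unfolding g_def by simp
    have "(1 + \<sigma>) * x \<le> 2 * 1" using sig x_ge x by (intro mult_mono) auto
    then show "g \<le> 2" unfolding g_def by simp
  qed
  have "w * (1 + g) < (1 - 1 / (1 + g)) * (1 + g)"
    using w g unfolding g_def \<sigma>_def by (intro mult_strict_right_mono) auto
  also have "\<dots> = g" using g by (simp add: field_simps)
  finally have key: "w * (1 + g) < g" .
  \<comment> \<open>Since \<open>g\<close> is at most 2, \<open>g / (1 + g)\<close> is at most
    \<open>2 / 3\<close>. This keeps the value of \<open>Z (Suc k)\<close> negligible up to the end
    of the interval.\<close>
  have w23: "w \<le> 2 / 3"
  proof (rule ccontr)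
    assume "\<not> w \<le> 2 / 3"
    then have "2 / 3 * (1 + g) < w * (1 + g)" using g by (intro mult_strict_right_mono) auto
    then show False using key g by simp
  qed
  obtain e where e: "0 < e" "e * (8 * (B + 2)) \<le> 1" "e * 8 \<le> g - w * (1 + g)"
    by (rule small_number[of "8 * (B + 2)" "g - w * (1 + g)" "8"]) (use key B in auto)
  have e24: "24 * e \<le> 1"
  proof -
    have "e * 24 \<le> e * (8 * (B + 2))" using e B by (intro mult_left_mono) auto
    then show ?thesis using e by linarith
  qed
  define f where "f k = (1 + 2 * e) * (W (Suc k) + W k)" for k
  have "\<forall>\<^sub>F H in at_top. lambda_solvable \<xi> w (exp H)"
  proof (rule eventually_between)
    show "filterlim f at_top sequentially"
    proof (rule filterlim_at_top_mono[OF W_lim], intro always_eventually allI)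
      fix k
      have "W k \<le> 1 * (W (Suc k) + W k)" using W_pos[of "Suc k"] by simp
      also have "\<dots> \<le> f k" unfolding f_def using W_pos[of k] W_pos[of "Suc k"] e by (intro mult_right_mono) auto
      finally show "W k \<le> f k" .
    qed
    show "\<forall>\<^sub>F k in sequentially. \<forall>H. f k \<le> H \<longrightarrow> H < f (Suc k) \<longrightarrow> lambda_solvable \<xi> w (exp H)"
      using eventually_near[OF e(1)] eventually_near_Suc[OF e(1)]
    proof (eventually_elim, intro allI impI)
      fix k H assume near: "near e k" "near e (Suc k)" and H: "f k \<le> H" "H < f (Suc k)"
      define U V V2 where UV: "U = W k" "V = W (Suc k)" "V2 = W (Suc (Suc k))"
      define Y where "Y = V + U"
      note nb = near_bounds[OF near(1) e(1,2), folded UV]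
      have Q: "\<bar>real_of_int (Q0 k 1)\<bar> \<le> exp (Y + e * V)"
        "exp (Y - e * V) \<le> \<bar>real_of_int (Q0 k 1)\<bar>"
        "\<bar>Q0 k 1 * \<xi> - Q1 k 1\<bar> \<le> exp (- (x * Y) + e * V)"
        "\<bar>Q0 k 1 * \<xi>\<^sup>2 - Q2 k 1\<bar> \<le> exp (- (x * Y) + e * V)"
        "exp (- (x * Y) - e * V) \<le> \<bar>Q0 k 1 * \<xi>\<^sup>2 - Q2 k 1\<bar>"
        using near(1) s(1)[of k] unfolding near_def UV Y_def by force+
      have Qn: "Q0 k 1 \<noteq> 0" using Q(2) by (auto simp: not_le)
      have VU: "V \<le> (\<rho> + e) * U" using near(1) unfolding near_def UV by blast
      have fk: "Y + 2 * (e * V) + 2 * (e * U) \<le> H" using H(1) unfolding f_def UV[symmetric] Y_def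
        by (simp add: algebra_simps)
      have gain: "4 * (e * V) + 3 * (e * V) \<le> (1 - w) * (x * Y) - w * V"
      proof -
        have "\<sigma> * V \<le> \<sigma> * ((\<rho> + e) * U)" using VU sig by (intro mult_left_mono) auto
        also have "\<dots> = (\<rho> * \<sigma>) * U + \<sigma> * (e * U)" by (simp add: algebra_simps)
        also have "\<sigma> * (e * U) \<le> 1 * (e * V)" by (rule mult_mono) (use sig nb in linarith)+
        finally have "\<sigma> * V \<le> U + e * V" using sig(3) by simp
        then have "(1 + \<sigma>) * V - e * V \<le> Y" unfolding Y_def by (simp add: algebra_simps)
        then have "x * ((1 + \<sigma>) * V - e * V) \<le> x * Y" using x_ge by (intro mult_left_mono) auto
        moreover have "x * (e * V) \<le> 1 * (e * V)" using x nb by (intro mult_right_mono) auto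
        ultimately have "g * V - e * V \<le> x * Y" unfolding g_def by (simp add: algebra_simps)
        then have "(1 - w) * (g * V - e * V) \<le> (1 - w) * (x * Y)" using w23 by (intro mult_left_mono) auto
        moreover have "(e * 8) * V \<le> (g - w * (1 + g)) * V" by (rule mult_right_mono) (use e nb in linarith)+
        moreover have "0 \<le> w * (e * V)" using w nb by simp
        ultimately show ?thesis by (simp add: algebra_simps)
      qed
      show "lambda_solvable \<xi> w (exp H)"
      \<comment> \<open>The threshold is where the error \<open>exp (- x * Y)\<close> of
        \<open>Q k 1\<close> meets the error \<open>exp (V - H)\<close> available from the whole
        plane lattice.\<close>
      proof (cases "H \<le> V + x * Y + 3 * (e * V)")
        case True
        then have "w * H \<le> w * (V + x * Y + 3 * (e * V))" using w by (intro mult_left_mono) auto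
        moreover have "w * (e * V) \<le> 1 * (e * V)" using w23 nb by (intro mult_right_mono) auto
        moreover have "w * (V + x * Y + 3 * (e * V)) = w * V + w * (x * Y) + 3 * (w * (e * V))"
          "(1 - w) * (x * Y) = x * Y - w * (x * Y)" by (simp_all add: algebra_simps)
        ultimately have "w * H \<le> x * Y - e * V" using gain nb by linarith
        then have "exp (- (x * Y) + e * V) \<le> exp (- (w * H))" by simp
        moreover have "exp (Y + e * V) \<le> exp H" using fk nb by simp
        ultimately show ?thesis using Qn
          by (intro lambda_solvable_expI[of "Q0 k 1" "Q1 k 1" "Q2 k 1"] order_trans[OF Q(1)]
              order_trans[OF Q(3)] order_trans[OF Q(4)]) auto
      next
        case False
        let ?Z0 = "Z0 (Suc k)" and ?Z1 = "Z1 (Suc k)" and ?Z2 = "Z2 (Suc k)"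
        let ?v = "\<bar>?Z0 + ?Z1 * \<xi> + ?Z2 * \<xi>\<^sup>2\<bar>"
        have Zb: "exp (V - e * V) \<le> \<bar>real_of_int ?Z1\<bar>" "\<bar>real_of_int ?Z1\<bar> \<le> exp V"
          "?v \<le> exp (- (x * V + (1 + x) * V2) + e * V)"
          using near(2) Z_le(1)[of "Suc k"] unfolding near_def UV by blast+
        have Zpos: "0 < \<bar>real_of_int ?Z1\<bar>" using Zb(1) by (smt (verit) exp_gt_zero)
        obtain u0 u1 u2 where u: "?Z0 * u0 + ?Z1 * u1 + ?Z2 * u2 = 0"
          "Q1 k 1 * u2 - Q2 k 1 * u1 = ?Z0" "Q2 k 1 * u0 - Q0 k 1 * u2 = ?Z1" "Q0 k 1 * u1 - Q1 k 1 * u0 = ?Z2"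
          by (rule orthogonal_plane_basis[OF prim_Q[OF order_refl] orth])
        obtain m n :: int where mn: "0 < n" "\<bar>real_of_int (m * Q0 k 1 + n * u0)\<bar> \<le> exp H"
          "\<bar>real_of_int (m * Q0 k 1 + n * u0) * \<xi>\<^sup>2 - real_of_int (m * Q2 k 1 + n * u2)\<bar>
            \<le> 4 * \<bar>real_of_int (Q2 k 1 * u0 - Q0 k 1 * u2)\<bar> / exp H"
        proof (rule plane_minkowski[of "exp H" "Q0 k 1" "Q2 k 1" u0 u2 "\<xi>\<^sup>2"])
          show "0 < exp H" by simp
          have "8 * exp (Y + e * V) \<le> exp H" using fk nb by (intro exp_add3_le) linarith
          then show "2 * \<bar>real_of_int (Q0 k 1)\<bar> \<le> exp H" using Q(1) exp_gt_zero[of "Y + e * V"] by linarith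
          show "real_of_int (Q2 k 1 * u0 - Q0 k 1 * u2) \<noteq> 0" unfolding u(3) using Zpos by simp
          have "8 * exp V \<le> exp (H - x * Y - e * V)" using False nb by (intro exp_add3_le) linarith
          also have "\<dots> = exp H * exp (- (x * Y) - e * V)" by (simp add: algebra_simps flip: exp_add)
          also have "\<dots> \<le> exp H * \<bar>Q0 k 1 * \<xi>\<^sup>2 - Q2 k 1\<bar>" using Q(5) by (intro mult_left_mono) auto
          finally show "2 * \<bar>real_of_int (Q2 k 1 * u0 - Q0 k 1 * u2)\<bar> \<le> exp H * \<bar>Q0 k 1 * \<xi>\<^sup>2 - Q2 k 1\<bar>"
            unfolding u(3) using Zb(2) exp_gt_zero[of V] by linarith
        qed (rule that)
        define y0 y1 y2 where y: "y0 = m * Q0 k 1 + n * u0" "y1 = m * Q1 k 1 + n * u1" "y2 = m * Q2 k 1 + n * u2"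
        have plane: "?Z0 * y0 + ?Z1 * y1 + ?Z2 * y2 = 0"
        proof -
          have "?Z0 * y0 + ?Z1 * y1 + ?Z2 * y2 = m * (?Z0 * Q0 k 1 + ?Z1 * Q1 k 1 + ?Z2 * Q2 k 1)
              + n * (?Z0 * u0 + ?Z1 * u1 + ?Z2 * u2)" unfolding y by (simp add: algebra_simps)
          then show ?thesis using orth[of k 1] u(1) by simp
        qed
        have nz: "(y0, y1, y2) \<noteq> (0, 0, 0)"
        proof
          assume "(y0, y1, y2) = (0, 0, 0)"
          moreover have "Q2 k 1 * y0 - Q0 k 1 * y2 = n * ?Z1" unfolding y u(3)[symmetric] by (simp add: algebra_simps)
          ultimately show False using mn(1) Zpos by simp
        qed
        have "V + 6 + w * H \<le> H"
        proof -
          have "(1 - w) * (V + x * Y + 3 * (e * V)) \<le> (1 - w) * H" using False w23 by (intro mult_left_mono) auto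
          then have "V + x * Y + 3 * (e * V) - (w * V + w * (x * Y) + 3 * (w * (e * V))) \<le> H - w * H"
            unfolding left_diff_distrib distrib_left by (simp add: mult.left_commute)
          moreover have "w * (e * V) \<le> 1 * (e * V)" by (rule mult_right_mono) (use w23 nb in linarith)+
          moreover have "4 * (e * V) + 3 * (e * V) \<le> x * Y - w * (x * Y) - w * V"
            using gain unfolding left_diff_distrib by simp
          ultimately show ?thesis using nb by linarith
        qed
        then have exp_small: "8 * (8 * exp (V - H)) \<le> exp (- (w * H))"
        proof -
          have "8 * exp (V - H) \<le> exp (V - H + 3)" by (intro exp_add3_le) simp
          moreover have "8 * exp (V - H + 3) \<le> exp (- (w * H))"
            using \<open>V + 6 + w * H \<le> H\<close> by (intro exp_add3_le) simp
          ultimately show ?thesis by linarith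
        qed
        have e2: "\<bar>y0 * \<xi>\<^sup>2 - y2\<bar> \<le> 4 * exp (V - H)"
        proof -
          have "\<bar>y0 * \<xi>\<^sup>2 - y2\<bar> \<le> 4 * \<bar>real_of_int ?Z1\<bar> / exp H" using mn(3) unfolding y u(3) .
          also have "\<dots> \<le> 4 * exp V / exp H" using Zb(2) by (intro divide_right_mono) auto
          also have "\<dots> = 4 * exp (V - H)" by (simp add: exp_diff)
          finally show ?thesis .
        qed
        \<comment> \<open>The lattice argument controls coordinates 0 and 2 only. The equation of
          the plane yields coordinate 1, because \<open>Z2\<close> is at most twice
          \<open>Z1\<close> in absolute value and the form is tiny at \<xi>.\<close>
        have e1: "\<bar>y0 * \<xi> - y1\<bar> \<le> exp (- (w * H))"
        proof -
          have "real_of_int (?Z0 * y0 + ?Z1 * y1 + ?Z2 * y2) = 0" using plane by simp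
          then have "?Z1 * (y0 * \<xi> - y1) = y0 * (?Z0 + ?Z1 * \<xi> + ?Z2 * \<xi>\<^sup>2) - ?Z2 * (y0 * \<xi>\<^sup>2 - y2)"
            unfolding dot_expand[of _ _ _ _ _ _ \<xi>] by linarith
          then have "\<bar>?Z1 * (y0 * \<xi> - y1)\<bar> \<le> \<bar>y0 * (?Z0 + ?Z1 * \<xi> + ?Z2 * \<xi>\<^sup>2)\<bar> + \<bar>?Z2 * (y0 * \<xi>\<^sup>2 - y2)\<bar>"
            by linarith
          then have "\<bar>real_of_int ?Z1\<bar> * \<bar>y0 * \<xi> - y1\<bar> \<le> \<bar>real_of_int y0\<bar> * ?v + \<bar>real_of_int ?Z2\<bar> * \<bar>y0 * \<xi>\<^sup>2 - y2\<bar>"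
            unfolding abs_mult .
          also have "\<bar>real_of_int y0\<bar> * ?v \<le> \<bar>real_of_int ?Z1\<bar> * exp (H - x * V - (1 + x) * V2 - V + 2 * (e * V))"
          proof -
            have "\<bar>real_of_int y0\<bar> * ?v \<le> exp H * exp (- (x * V + (1 + x) * V2) + e * V)"
              using mn(2) Zb(3) unfolding y by (intro mult_mono) auto
            also have "\<dots> = exp (V - e * V) * exp (H - x * V - (1 + x) * V2 - V + 2 * (e * V))"
              by (simp add: algebra_simps flip: exp_add)
            also have "\<dots> \<le> \<bar>real_of_int ?Z1\<bar> * exp (H - x * V - (1 + x) * V2 - V + 2 * (e * V))"
              using Zb(1) by (intro mult_right_mono) auto
            finally show ?thesis .
          qed
          also have "\<bar>real_of_int ?Z2\<bar> * \<bar>y0 * \<xi>\<^sup>2 - y2\<bar> \<le> \<bar>real_of_int ?Z1\<bar> * (2 * (4 * exp (V - H)))"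
          proof -
            have "\<bar>real_of_int ?Z2\<bar> \<le> 2 * \<bar>real_of_int ?Z1\<bar>" using Z_le(3)[of "Suc k"] by linarith
            then have "\<bar>real_of_int ?Z2\<bar> * \<bar>y0 * \<xi>\<^sup>2 - y2\<bar> \<le> (2 * \<bar>real_of_int ?Z1\<bar>) * (4 * exp (V - H))"
              using e2 by (intro mult_mono) auto
            then show ?thesis by (simp add: ac_simps)
          qed
          finally have "\<bar>real_of_int ?Z1\<bar> * \<bar>y0 * \<xi> - y1\<bar> \<le> \<bar>real_of_int ?Z1\<bar> *
              (exp (H - x * V - (1 + x) * V2 - V + 2 * (e * V)) + 2 * (4 * exp (V - H)))"
            by (simp add: distrib_left)
          then have "\<bar>y0 * \<xi> - y1\<bar> \<le> exp (H - x * V - (1 + x) * V2 - V + 2 * (e * V)) + 2 * (4 * exp (V - H))"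
            using Zpos by (simp only: mult_le_cancel_left_pos)
          moreover have "8 * exp (H - x * V - (1 + x) * V2 - V + 2 * (e * V)) \<le> exp (- (w * H))"
          proof (rule exp_add3_le)
            have V2: "V \<le> V2" using W_mono[of "Suc k"] unfolding UV .
            have H0: "0 \<le> H" using fk nb unfolding Y_def by linarith
            have "w * H \<le> 2 / 3 * H" using w23 H0 by (intro mult_right_mono) auto
            moreover have "H < V2 + V + 2 * (e * V2) + 2 * (e * V)"
              using H(2) unfolding f_def UV[symmetric] by (simp add: algebra_simps)
            moreover have "(24 * e) * V2 \<le> 1 * V2" "(24 * e) * V \<le> 1 * V" using e24 nb V2 by (auto intro!: mult_right_mono)
            moreover have "79 / 80 * V \<le> x * V" "79 / 80 * V2 \<le> x * V2"
              using x_ge nb V2 by (auto intro!: mult_right_mono)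
            moreover have "(1 + x) * V2 = V2 + x * V2" by (simp add: distrib_right)
            ultimately show "H - x * V - (1 + x) * V2 - V + 2 * (e * V) + 3 \<le> - (w * H)"
              using nb V2 by linarith
          qed
          ultimately show ?thesis using exp_small exp_gt_zero[of "V - H"] by linarith
        qed
        have "\<bar>y0 * \<xi>\<^sup>2 - y2\<bar> \<le> exp (- (w * H))" using e2 exp_small exp_gt_zero[of "V - H"] by linarith
        then show ?thesis using nz mn(2) e1 by (intro lambda_solvable_expI[of y0 y1 y2]) (auto simp: y)
      qed
    qed
  qed
  then show ?thesis by (rule eventually_exp)
qed

section \<open>Nonalgebraicity and the values of the four exponents\<close>

text \<open>An integer polynomial of degree at most 2 vanishing at \<xi> would solve the inequality
  for every exponent at all large \<open>X\<close>, contrary to \<open>omega_le\<close>.\<close>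

lemma not_algebraic: "\<not> algebraic_of_degree_le 2 \<xi>"
proof
  assume "algebraic_of_degree_le 2 \<xi>"
  then obtain p :: "real poly" where p: "\<And>i. coeff p i \<in> \<int>" "p \<noteq> 0" "degree p \<le> 2" "poly p \<xi> = 0"
    unfolding algebraic_of_degree_le_def by blast
  obtain c :: "nat \<Rightarrow> int" where c: "\<And>i. coeff p i = of_int (c i)"
    by (rule that[of "\<lambda>i. \<lfloor>coeff p i\<rfloor>"]) (metis p(1) Ints_cases floor_of_int)
  have pe: "p = [:of_int (c 0), of_int (c 1), of_int (c 2):]"
  proof (rule poly_eqI)
    fix i :: nat
    consider "i = 0" | "i = 1" | "i = 2" | "2 < i" by linarith
    then show "coeff p i = coeff [:of_int (c 0), of_int (c 1), of_int (c 2):] i"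
    proof cases
      case 4
      then show ?thesis using p(3) by (simp add: coeff_eq_0 coeff_pCons split: nat.split)
    qed (auto simp: c numeral_2_eq_2)
  qed
  have val: "c 0 + c 1 * \<xi> + c 2 * \<xi>\<^sup>2 = 0"
    using p(4) by (subst (asm) pe) (simp add: algebra_simps power2_eq_square)
  have nz: "(c 0, c 1, c 2) \<noteq> (0, 0, 0)" using p(2) pe by auto
  have "\<forall>\<^sub>F X in at_top. omega_solvable \<xi> w X" for w
    using eventually_ge_at_top[of "max \<bar>real_of_int (c 1)\<bar> \<bar>real_of_int (c 2)\<bar>"]
  proof eventually_elim
    case (elim X)
    then show ?case unfolding omega_solvable_def using nz val
      by (intro exI[of _ "c 0"] exI[of _ "c 1"] exI[of _ "c 2"]) auto
  qed
  moreover have "\<forall>\<^sub>F X in at_top. \<not> omega_solvable \<xi> (x + (1 + x) * \<rho> + 1) X"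
    by (rule omega_le) simp
  ultimately have "\<forall>\<^sub>F X::real in at_top. omega_solvable \<xi> (x + (1 + x) * \<rho> + 1) X \<and> \<not> omega_solvable \<xi> (x + (1 + x) * \<rho> + 1) X"
    by (intro eventually_conj)
  then show False by simp
qed

lemma exponents:
  "lambda2 \<xi> = ereal x"
  "lambda2_hat \<xi> = ereal (1 - 1 / (1 + (1 + 1 / \<rho>) * x))"
  "omega2 \<xi> = ereal ((1 + (1 + 1 / \<rho>) * x) / (1 / \<rho>))"
  "omega2_hat \<xi> = ereal (1 + (1 + 1 / \<rho>) * x)"
proof -
  have x0: "0 < x" using x_ge by simp
  have r: "0 < \<rho>" using rho by simp
  show "lambda2 \<xi> = ereal x"
    unfolding lambda2_def
    using frequently_antimono[OF lambda_solvable_antimono] x0 x lambda_ge eventually_frequently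
    by (intro Sup_ereal_eq[of _ 0 x 1]) (auto simp: frequently_def dest: lambda_le)
  have pos: "0 < (1 + 1 / \<rho>) * x" using x0 r by (intro mult_pos_pos add_pos_pos) auto
  show "lambda2_hat \<xi> = ereal (1 - 1 / (1 + (1 + 1 / \<rho>) * x))"
    unfolding lambda2_hat_def
  proof (rule Sup_ereal_eq[of _ 0 _ 1])
    show "0 < 1 - 1 / (1 + (1 + 1 / \<rho>) * x)" "1 - 1 / (1 + (1 + 1 / \<rho>) * x) < 1"
      using pos by simp_all
  qed (use eventually_antimono[OF lambda_solvable_antimono] lambda_hat_ge lambda_hat_le in
      \<open>auto simp: frequently_def\<close>)
  have Om: "(1 + (1 + 1 / \<rho>) * x) / (1 / \<rho>) = x + (1 + x) * \<rho>" using r by (simp add: field_simps)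
  show "omega2 \<xi> = ereal ((1 + (1 + 1 / \<rho>) * x) / (1 / \<rho>))"
    unfolding omega2_def Om
  proof (rule Sup_ereal_eq[of _ "x + (1 + x) * \<rho> - 1" _ "x + (1 + x) * \<rho> + 1"])
  qed (use frequently_antimono[OF omega_solvable_antimono] omega_ge omega_le in
      \<open>auto simp: frequently_def\<close>)
  have Oh: "1 + (1 + 1 / \<rho>) * x = x + 1 + x / \<rho>" by (simp add: field_simps)
  show "omega2_hat \<xi> = ereal (1 + (1 + 1 / \<rho>) * x)"
    unfolding omega2_hat_def Oh
  proof (rule Sup_ereal_eq[of _ 0 _ "x + 1 + x / \<rho> + 1"])
    show "0 < x + 1 + x / \<rho>" using x0 r by (simp add: add_pos_pos)
  qed (use eventually_antimono[OF omega_solvable_antimono] omega_hat_ge omega_hat_le in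
      \<open>auto simp: frequently_def\<close>)
qed

end

section \<open>Two by two matrices\<close>

datatype mat2 = Mat2 (m11: int) (m12: int) (m21: int) (m22: int)

instantiation mat2 :: monoid_mult
begin

definition one_mat2 :: mat2 where "1 = Mat2 1 0 0 1"

definition times_mat2 :: "mat2 \<Rightarrow> mat2 \<Rightarrow> mat2" where
  "M * N = Mat2 (m11 M * m11 N + m12 M * m21 N) (m11 M * m12 N + m12 M * m22 N)
     (m21 M * m11 N + m22 M * m21 N) (m21 M * m12 N + m22 M * m22 N)"

instance
  by standard (simp_all add: times_mat2_def one_mat2_def algebra_simps)

end

lemma mult_mat2_sel [simp]:
  "m11 (M * N) = m11 M * m11 N + m12 M * m21 N" "m12 (M * N) = m11 M * m12 N + m12 M * m22 N"
  "m21 (M * N) = m21 M * m11 N + m22 M * m21 N" "m22 (M * N) = m21 M * m12 N + m22 M * m22 N"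
  by (simp_all add: times_mat2_def)

definition det2 :: "mat2 \<Rightarrow> int" where "det2 M = m11 M * m22 M - m12 M * m21 M"

definition transp2 :: "mat2 \<Rightarrow> mat2" where "transp2 M = Mat2 (m11 M) (m21 M) (m12 M) (m22 M)"

lemma det2_mult: "det2 (M * N) = det2 M * det2 N"
  by (simp add: det2_def algebra_simps)

lemma det2_power: "det2 (M ^ j) = det2 M ^ j"
  by (induction j) (simp_all add: det2_mult, simp add: det2_def one_mat2_def)

lemma transp2_mult: "transp2 (M * N) = transp2 N * transp2 M"
  by (simp add: transp2_def times_mat2_def algebra_simps)

lemma transp2_eq_iff: "transp2 M = M \<longleftrightarrow> m12 M = m21 M"
  by (cases M) (auto simp: transp2_def)

text \<open>The hypotheses say that \<open>C * transp2 R = R * C\<close>, so a transposed factor can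
  be carried across \<open>C\<close>.\<close>

lemma symmetric_power_mult:
  assumes "transp2 C = C" "transp2 (R * C) = R * C"
  shows "transp2 (R ^ j * C) = R ^ j * C"
proof (induction j)
  case (Suc j)
  have *: "C * transp2 R = R * C" using assms by (simp add: transp2_mult)
  have "transp2 (R ^ Suc j * C) = transp2 (R * (R ^ j * C))" by (simp add: mult.assoc)
  also have "\<dots> = R ^ j * C * transp2 R" using Suc by (simp add: transp2_mult)
  also have "\<dots> = R ^ j * (R * C)" by (simp add: * mult.assoc)
  also have "\<dots> = R ^ Suc j * C" by (simp only: power_Suc2 mult.assoc)
  finally show ?case .
qed (use assms in simp)

text \<open>The linear form \<open>m\<^sub>2\<^sub>1 + (m\<^sub>2\<^sub>2 - m\<^sub>1\<^sub>1) \<xi> - m\<^sub>1\<^sub>2 \<xi>\<^sup>2\<close>, evaluated at a symmetric \<open>Y\<close>,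
  is the skew part of \<open>M Y\<close>; so it vanishes exactly when \<open>M Y\<close> is symmetric.\<close>

definition skew :: "mat2 \<Rightarrow> mat2 \<Rightarrow> int" where
  "skew M Y = m21 M * m11 Y + (m22 M - m11 M) * m12 Y - m12 M * m22 Y"

lemma skew_eq:
  assumes "transp2 Y = Y"
  shows "skew M Y = m21 (M * Y) - m12 (M * Y)"
  using assms by (simp add: transp2_eq_iff skew_def algebra_simps)

lemma skew_eq_0:
  assumes "transp2 Y = Y" "transp2 (M * Y) = M * Y"
  shows "skew M Y = 0"
proof -
  have "m12 (M * Y) = m21 (M * Y)" using assms(2) unfolding transp2_eq_iff .
  then show ?thesis unfolding skew_eq[OF assms(1)] by linarith
qed

text \<open>For symmetric \<open>Y\<close> and a skew two by two matrix \<open>A\<close>, the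
  product \<open>Y * A * Y\<close> is \<open>det2 Y\<close> times \<open>A\<close>.\<close>

lemma skew_sandwich:
  assumes "transp2 Y = Y"
  shows "skew (Y * E) Y = det2 Y * (m21 E - m12 E)"
  using assms by (simp add: transp2_eq_iff skew_def det2_def algebra_simps)

text \<open>Cayley--Hamilton: \<open>N\<^sup>2 = tr N N - det N\<close>.\<close>

lemma skew_square:
  "skew M (N * (N * Y)) = (m11 N + m22 N) * skew M (N * Y) - det2 N * skew M Y"
  by (simp add: skew_def det2_def algebra_simps)

text \<open>These inequalities and congruences are preserved by products; they make the upper left entry
  multiplicative up to a factor 2 and prime to \<open>p\<close>.\<close>

definition good :: "int \<Rightarrow> mat2 \<Rightarrow> bool" where
  "good p M \<longleftrightarrow> 0 < m11 M \<and> 0 \<le> m22 M \<and> 2 * m22 M \<le> m12 M \<and> 2 * m22 M \<le> m21 M \<and>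
     2 * m12 M \<le> m11 M \<and> 2 * m21 M \<le> m11 M \<and>
     coprime (m11 M) p \<and> p dvd m12 M \<and> p dvd m21 M \<and> p dvd m22 M"

text \<open>Modulo \<open>p\<close> the corner of a product is the product of the corners, since
  \<open>p\<close> divides \<open>m12 M\<close>. The remaining inequalities follow by comparing rows
  of \<open>M\<close> and columns of \<open>N\<close>.\<close>

lemma good_mult:
  assumes "good p M" "good p N"
  shows "good p (M * N)" "m11 M * m11 N \<le> m11 (M * N)" "m11 (M * N) \<le> 2 * (m11 M * m11 N)"
proof -
  have M: "0 < m11 M" "0 \<le> m22 M" "2 * m22 M \<le> m12 M" "2 * m22 M \<le> m21 M"
     "2 * m12 M \<le> m11 M" "2 * m21 M \<le> m11 M" "0 \<le> m12 M" "0 \<le> m21 M"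
    and Mp: "coprime (m11 M) p" "p dvd m12 M" "p dvd m21 M" "p dvd m22 M"
    using assms(1) unfolding good_def by auto
  have N: "0 < m11 N" "0 \<le> m22 N" "2 * m22 N \<le> m12 N" "2 * m22 N \<le> m21 N"
     "2 * m12 N \<le> m11 N" "2 * m21 N \<le> m11 N" "0 \<le> m12 N" "0 \<le> m21 N"
    and Np: "coprime (m11 N) p" "p dvd m12 N" "p dvd m21 N" "p dvd m22 N"
    using assms(2) unfolding good_def by auto
  have pos: "0 < m11 M * m11 N" "0 \<le> m12 M * m21 N" "0 \<le> m21 M * m12 N" "0 \<le> m22 M * m22 N"
    using M N by simp_all
  show "m11 M * m11 N \<le> m11 (M * N)" using pos by simp
  have "m12 M * m21 N \<le> m11 M * m11 N" using M N by (intro mult_mono) auto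
  then show "m11 (M * N) \<le> 2 * (m11 M * m11 N)" by simp
  have row: "(2 * m22 M) * m12 N \<le> m12 M * m12 N" "(2 * m22 M) * m22 N \<le> m12 M * m22 N"
    "(2 * m21 M) * m12 N \<le> m11 M * m12 N" "(2 * m21 M) * m11 N \<le> m11 M * m11 N"
    "(2 * m22 M) * m21 N \<le> m12 M * m21 N"
    using M N by (auto intro!: mult_right_mono simp del: mult_le_cancel_left)
  have col: "m21 M * (2 * m12 N) \<le> m21 M * m11 N" "m22 M * (2 * m22 N) \<le> m22 M * m21 N"
    "m11 M * (2 * m12 N) \<le> m11 M * m11 N" "m12 M * (2 * m22 N) \<le> m12 M * m21 N"
    using M N by (auto intro!: mult_left_mono)
  have "coprime (m11 M * m11 N + m12 M * m21 N) p"
  proof -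
    obtain t where "m12 M * m21 N = p * t" using Mp(2) by (metis dvd_def mult.assoc)
    moreover have "coprime (m11 M * m11 N + p * t) p \<longleftrightarrow> coprime (m11 M * m11 N) p"
      by (metis add.commute coprime_iff_gcd_eq_1 gcd_add_mult gcd.commute mult.commute)
    ultimately show ?thesis using Mp(1) Np(1) by simp
  qed
  then show "good p (M * N)" unfolding good_def mult_mat2_sel
    using pos row col Mp Np by (auto simp: algebra_simps)
qed

lemma good_power_mult:
  assumes "good p M" "good p N"
  shows "good p (M ^ j * N)"
  using good_mult(1)[OF assms(1)] assms(2) by (induction j) (simp_all add: mult.assoc)

text \<open>The corner stands in for a norm: for good matrices its logarithm is additive up to
  \<open>ln 2\<close>.\<close>

definition lnm :: "mat2 \<Rightarrow> real" where "lnm M = ln (real_of_int (m11 M))"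

lemma lnm_nonneg: "good p M \<Longrightarrow> 0 \<le> lnm M"
  unfolding good_def lnm_def by simp

lemma exp_lnm: "good p M \<Longrightarrow> exp (lnm M) = real_of_int (m11 M)"
  unfolding good_def lnm_def by simp

lemma lnm_mult:
  assumes "good p M" "good p N"
  shows "lnm M + lnm N \<le> lnm (M * N)" "lnm (M * N) \<le> lnm M + lnm N + ln 2"
proof -
  have pos: "0 < real_of_int (m11 M)" "0 < real_of_int (m11 N)" using assms unfolding good_def by auto
  have "real_of_int (m11 M * m11 N) \<le> real_of_int (m11 (M * N))" "real_of_int (m11 (M * N)) \<le> real_of_int (2 * (m11 M * m11 N))"
    using good_mult(2,3)[OF assms] by linarith+
  then have *: "m11 M * real_of_int (m11 N) \<le> m11 (M * N)" "m11 (M * N) \<le> 2 * (m11 M * real_of_int (m11 N))"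
    by (simp_all only: of_int_mult of_int_numeral)
  have "0 < m11 (M * N)" using good_mult(1)[OF assms] unfolding good_def by blast
  then have "0 < real_of_int (m11 (M * N))" by (simp only: of_int_0_less_iff)
  then have "ln (m11 M * real_of_int (m11 N)) \<le> ln (real_of_int (m11 (M * N)))"
    "ln (real_of_int (m11 (M * N))) \<le> ln (2 * (m11 M * real_of_int (m11 N)))"
    using * pos by (simp_all only: ln_le_cancel_iff mult_pos_pos zero_less_numeral)
  then show "lnm M + lnm N \<le> lnm (M * N)" "lnm (M * N) \<le> lnm M + lnm N + ln 2"
    unfolding lnm_def using pos by (simp_all add: ln_mult)
qed

lemma lnm_power_mult:
  assumes "good p M" "good p N"
  shows "j * lnm M + lnm N \<le> lnm (M ^ j * N)" "lnm (M ^ j * N) \<le> j * lnm M + lnm N + j * ln 2"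
proof (induction j)
  case (Suc j)
  {
    case 1
    show ?case using lnm_mult[OF assms(1) good_power_mult[OF assms], of j] Suc by (simp add: algebra_simps)
  next
    case 2
    show ?case using lnm_mult[OF assms(1) good_power_mult[OF assms], of j] Suc by (simp add: algebra_simps)
  }
qed simp_all

text \<open>The Moebius action of \<open>Y\<close> on \<open>t = n\<^sub>2\<^sub>1 / n\<^sub>1\<^sub>1\<close>; the numerators below are multiples of \<open>det Y\<close>.\<close>

lemma moebius_error:
  fixes q :: real
  assumes Y: "good p Y" and N: "good p N" and q_def: "q = m21 (Y * N) / real_of_int (m11 (Y * N))"
  shows "0 \<le> q" "q \<le> 1 / 2" "\<bar>m11 Y * q - m21 Y\<bar> \<le> \<bar>real_of_int (det2 Y)\<bar> / m11 Y"
    "transp2 Y = Y \<Longrightarrow> \<bar>m11 Y * q\<^sup>2 - m22 Y\<bar> \<le> \<bar>real_of_int (det2 Y)\<bar> / m11 Y"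
    "transp2 Y = Y \<Longrightarrow> \<bar>real_of_int (det2 Y)\<bar> / (2 * m11 Y) \<le> \<bar>m11 Y * q\<^sup>2 - m22 Y\<bar>"
proof -
  define t where "t = m21 N / real_of_int (m11 N)"
  have Nr: "0 < real_of_int (m11 N)" "0 \<le> real_of_int (m21 N)" "2 * real_of_int (m21 N) \<le> real_of_int (m11 N)"
    using N unfolding good_def by linarith+
  have Yr: "0 < real_of_int (m11 Y)" "0 \<le> real_of_int (m12 Y)" "2 * real_of_int (m12 Y) \<le> real_of_int (m11 Y)"
    using Y unfolding good_def by linarith+
  have t: "0 \<le> t" "t \<le> 1 / 2" using Nr unfolding t_def by (simp_all add: field_simps)
  have YN: "0 < real_of_int (m11 (Y * N))" "0 \<le> real_of_int (m21 (Y * N))" "2 * real_of_int (m21 (Y * N)) \<le> real_of_int (m11 (Y * N))"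
    using good_mult(1)[OF Y N] unfolding good_def by linarith+
  show q: "0 \<le> q" "q \<le> 1 / 2" using YN unfolding q_def by (simp_all add: divide_simps del: mult_mat2_sel)
  \<comment> \<open>The denominator of the Moebius image of \<open>t\<close>; the constant
    \<open>5 / 4\<close> comes from \<open>t\<close> and \<open>m12 Y / m11 Y\<close> both being at
    most \<open>1 / 2\<close>.\<close>
  define w where "w = m11 Y + m12 Y * t"
  have w: "m11 Y \<le> w" "w \<le> 5 / 4 * m11 Y" "0 < w"
  proof -
    have "m12 Y * t \<le> (m11 Y / 2) * (1 / 2)" by (rule mult_mono) (use Yr t in linarith)+
    moreover have "0 \<le> m12 Y * t" using Yr t by simp
    ultimately show "m11 Y \<le> w" "w \<le> 5 / 4 * m11 Y" "0 < w" using Yr unfolding w_def by linarith+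
  qed
  have qw: "q * w = m21 Y + m22 Y * t"
  proof -
    have "real_of_int (m11 (Y * N)) = w * m11 N" "real_of_int (m21 (Y * N)) = (m21 Y + m22 Y * t) * m11 N"
      unfolding w_def t_def using Nr by (simp_all add: field_simps)
    then show ?thesis unfolding q_def using Nr w by (simp add: field_simps)
  qed
  have e1: "(m11 Y * q - m21 Y) * w = det2 Y * t"
    using qw unfolding w_def det2_def of_int_diff of_int_mult by algebra
  have "\<bar>m11 Y * q - m21 Y\<bar> = \<bar>real_of_int (det2 Y)\<bar> * t / w"
  proof -
    have "\<bar>(m11 Y * q - m21 Y) * w\<bar> = \<bar>real_of_int (det2 Y)\<bar> * t" unfolding e1 using t by (simp add: abs_mult)
    then show ?thesis using w(3) unfolding abs_mult[of _ w] by (simp add: eq_divide_eq)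
  qed
  also have "\<dots> \<le> \<bar>real_of_int (det2 Y)\<bar> * 1 / m11 Y"
    using t w Yr by (intro frac_le mult_left_mono mult_nonneg_nonneg) auto
  finally show "\<bar>m11 Y * q - m21 Y\<bar> \<le> \<bar>real_of_int (det2 Y)\<bar> / m11 Y" by simp
  assume "transp2 Y = Y"
  then have s: "m12 Y = m21 Y" by (simp add: transp2_eq_iff)
  have e2: "(m11 Y * q\<^sup>2 - m22 Y) * w = det2 Y * (q * t - 1)"
  proof -
    have "(m12 Y * q - m22 Y) * w = m12 Y * (q * w) - m22 Y * w" by (simp add: algebra_simps)
    also have "\<dots> = - det2 Y" unfolding qw unfolding w_def det2_def by (simp add: algebra_simps)
    finally have "(m12 Y * q - m22 Y) * w = - real_of_int (det2 Y)" by simp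
    moreover have "(m11 Y * q\<^sup>2 - m22 Y) * w = q * ((m11 Y * q - m21 Y) * w) + (m12 Y * q - m22 Y) * w"
      by (simp add: s power2_eq_square algebra_simps)
    ultimately show ?thesis unfolding e1 by (simp add: algebra_simps)
  qed
  have qt: "0 \<le> q * t" "q * t \<le> 1 / 4"
  proof -
    have "q * t \<le> 1 / 2 * (1 / 2)" using q t by (intro mult_mono) auto
    then show "0 \<le> q * t" "q * t \<le> 1 / 4" using q t by auto
  qed
  have eq: "\<bar>m11 Y * q\<^sup>2 - m22 Y\<bar> = \<bar>real_of_int (det2 Y)\<bar> * (1 - q * t) / w"
  proof -
    have "\<bar>(m11 Y * q\<^sup>2 - m22 Y) * w\<bar> = \<bar>real_of_int (det2 Y)\<bar> * (1 - q * t)" unfolding e2 using qt by (simp add: abs_mult)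
    then show ?thesis using w(3) unfolding abs_mult[of _ w] by (simp add: eq_divide_eq)
  qed
  have "\<bar>real_of_int (det2 Y)\<bar> * (1 - q * t) / w \<le> \<bar>real_of_int (det2 Y)\<bar> * 1 / m11 Y"
    using qt w Yr by (intro frac_le mult_left_mono mult_nonneg_nonneg) auto
  then show "\<bar>m11 Y * q\<^sup>2 - m22 Y\<bar> \<le> \<bar>real_of_int (det2 Y)\<bar> / m11 Y" unfolding eq by simp
  have "\<bar>real_of_int (det2 Y)\<bar> * (3 / 4) / (5 / 4 * m11 Y) \<le> \<bar>real_of_int (det2 Y)\<bar> * (1 - q * t) / w"
    using qt w Yr by (intro frac_le mult_left_mono mult_nonneg_nonneg) auto
  moreover have "\<bar>real_of_int (det2 Y)\<bar> / (2 * m11 Y) \<le> \<bar>real_of_int (det2 Y)\<bar> * (3 / 4) / (5 / 4 * m11 Y)"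
    using Yr by (simp add: field_simps)
  ultimately show "\<bar>real_of_int (det2 Y)\<bar> / (2 * m11 Y) \<le> \<bar>m11 Y * q\<^sup>2 - m22 Y\<bar>" unfolding eq by linarith
qed

section \<open>Palindromic products and the number they define\<close>

lemma coprime_dvd_bezout:
  fixes x y d :: int
  assumes "coprime x y" "d dvd y"
  obtains u v where "u * x + v * d = 1"
proof -
  have "coprime x d" using coprime_divisors[OF dvd_refl assms(2,1)] .
  then have "gcd x d = 1" by (simp only: coprime_iff_gcd_eq_1)
  then show thesis using bezout_int[of x d] that by metis
qed

lemma abs_dominated:
  fixes x y z t m :: real
  assumes "u = x - y - z" "\<bar>u\<bar> = m" "\<bar>y\<bar> \<le> t" "\<bar>z\<bar> \<le> t" "8 * t \<le> m"
  shows "\<bar>x\<bar> \<le> 2 * m" "m \<le> 2 * \<bar>x\<bar>"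
  using assms by linarith+

text \<open>The condition \<open>2 * p \<le> a\<close> and the coprimality make both letters
  \<open>good\<close>, a property that then passes to all words.\<close>

locale sturmian_matrices =
  fixes a p :: int and s :: "nat \<Rightarrow> nat" and B :: nat
  assumes p: "2 \<le> p" and a: "2 * p \<le> a" and coprime: "coprime a p"
    and s: "1 \<le> s k" "s k \<le> B"
begin

definition A1 :: mat2 where "A1 = Mat2 a p p 0"
definition A2 :: mat2 where "A2 = Mat2 (a + p) p p 0"

text \<open>Standard words end alternately in the two orders of the letters; the two values of
  \<open>E\<close> are transposes of each other.\<close>

definition E :: "nat \<Rightarrow> mat2" where "E k = (if even k then A1 * A2 else A2 * A1)"

text \<open>\<open>P k\<close> is a palindrome in the symmetric letters \<open>A1\<close>, \<open>A2\<close>, and \<open>P k * E k\<close> is the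
  matrix of the \<open>k\<close>-th standard word; \<open>s k\<close> is the exponent written \<open>s\<^sub>k\<^sub>+\<^sub>2\<close> in the paper.\<close>

fun P :: "nat \<Rightarrow> mat2" where
  "P 0 = A1"
| "P (Suc 0) = A1 * A1"
| "P (Suc (Suc k)) = (P (Suc k) * E (Suc k)) ^ s k * P k"

definition M :: "nat \<Rightarrow> mat2" where "M k = P k * E k"

definition Q :: "nat \<Rightarrow> nat \<Rightarrow> mat2" where "Q k j = M (Suc k) ^ j * P k"

section \<open>Palindromes, symmetry and orthogonality\<close>

lemma E_Suc_Suc [simp]: "E (Suc (Suc k)) = E k"
  by (simp add: E_def)

lemma M_rec: "M (Suc (Suc k)) = M (Suc k) ^ s k * M k"
  by (simp add: M_def mult.assoc)

lemma P_rec: "P (Suc (Suc k)) = Q k (s k)"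
  by (simp add: Q_def M_def)

lemma transp_A: "transp2 A1 = A1" "transp2 A2 = A2"
  by (simp_all add: A1_def A2_def transp2_def)

lemma transp_E: "transp2 (E k) = E (Suc k)"
  by (simp add: E_def transp2_mult transp_A)

text \<open>The third conjunct carries the induction: by \<open>symmetric_power_mult\<close> it
  makes every \<open>M (Suc k) ^ j * P k\<close> symmetric, and both \<open>P (Suc (Suc k))\<close>
  and \<open>M (Suc (Suc k)) * P (Suc k)\<close> are of this form.\<close>

lemma symmetric: "transp2 (P k) = P k \<and> transp2 (P (Suc k)) = P (Suc k) \<and> transp2 (M (Suc k) * P k) = M (Suc k) * P k"
proof (induction k)
  case 0
  show ?case by (simp add: M_def E_def transp2_mult transp_A mult.assoc)
next
  case (Suc k)
  have *: "transp2 (M (Suc k) ^ j * P k) = M (Suc k) ^ j * P k" for j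
    using Suc by (intro symmetric_power_mult) auto
  have "M (Suc k) * P k = transp2 (M (Suc k) * P k)" using Suc by simp
  also have "\<dots> = P k * E k * P (Suc k)"
    using Suc by (simp add: M_def transp2_mult transp_E mult.assoc)
  finally have "M (Suc (Suc k)) * P (Suc k) = M (Suc k) ^ s k * (M (Suc k) * P k)"
    by (simp add: M_rec mult.assoc) (simp add: M_def mult.assoc)
  also have "\<dots> = M (Suc k) ^ Suc (s k) * P k" by (simp only: power_Suc2 mult.assoc)
  finally show ?case using Suc * by (metis P_rec Q_def)
qed

lemma P_sym: "transp2 (P k) = P k"
  using symmetric by blast

lemma Q_sym: "transp2 (Q k j) = Q k j"
  unfolding Q_def using symmetric by (intro symmetric_power_mult) auto

text \<open>The word of \<open>M (Suc k) * P k\<close> is a palindrome; reading it backwards gives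
  that of \<open>P k * E k * P (Suc k)\<close>.\<close>

lemma M_P_swap: "M k * P (Suc k) = M (Suc k) * P k"
proof -
  have "M (Suc k) * P k = transp2 (M (Suc k) * P k)" using symmetric by simp
  also have "\<dots> = P k * E k * P (Suc k)"
    by (simp add: M_def transp2_mult transp_E P_sym mult.assoc)
  finally show ?thesis by (simp add: M_def)
qed

text \<open>The first point of the next family continues the current one. This gives access to
  \<open>Q k 2\<close> when \<open>s k = 1\<close>.\<close>

lemma Q_1_eq: "Q (Suc k) 1 = Q k (Suc (s k))"
proof -
  have "Q (Suc k) 1 = M (Suc k) ^ s k * (M k * P (Suc k))"
    by (simp add: Q_def M_rec mult.assoc)
  also have "\<dots> = Q k (Suc (s k))"
    unfolding M_P_swap Q_def by (simp only: power_Suc2 mult.assoc)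
  finally show ?thesis .
qed

lemma skew_Q: "skew (M (Suc k)) (Q k j) = 0"
proof (rule skew_eq_0[OF Q_sym])
  have "M (Suc k) * Q k j = Q k (Suc j)" by (simp add: Q_def mult.assoc)
  then show "transp2 (M (Suc k) * Q k j) = M (Suc k) * Q k j" by (simp add: Q_sym)
qed

text \<open>The product \<open>M k * Q k 1\<close> is again a palindrome, as two uses of
  \<open>M_P_swap\<close> show; hence \<open>Q k 1\<close> lies in the planes of both
  \<open>M k\<close> and \<open>M (Suc k)\<close>.\<close>

lemma skew_Q_1: "skew (M k) (Q k 1) = 0"
proof (rule skew_eq_0[OF Q_sym])
  have "M k * Q k 1 = (M k * P (Suc k)) * E (Suc k) * P k"
    by (simp add: Q_def M_def mult.assoc)
  also have "\<dots> = P (Suc k) * E (Suc k) * P k * E (Suc k) * P k"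
    unfolding M_P_swap by (simp add: M_def mult.assoc)
  finally have 1: "M k * Q k 1 = P (Suc k) * E (Suc k) * P k * E (Suc k) * P k" .
  have "P (Suc k) * E (Suc k) * P k = P k * E k * P (Suc k)"
    using M_P_swap[of k] by (simp add: M_def)
  then show "transp2 (M k * Q k 1) = M k * Q k 1"
    unfolding 1 by (simp add: transp2_mult transp_E P_sym) (metis mult.assoc)
qed

section \<open>Determinants and word lengths\<close>

lemma det_A: "det2 A1 = - (p\<^sup>2)" "det2 A2 = - (p\<^sup>2)"
  by (simp_all add: A1_def A2_def det2_def power2_eq_square)

lemma det_E: "det2 (E k) = p ^ 4"
  by (simp add: E_def det2_mult det_A power4_eq_xxxx power2_eq_square)

lemma skew_E: "\<bar>m21 (E k) - m12 (E k)\<bar> = p\<^sup>2"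
  by (simp add: E_def A1_def A2_def power2_eq_square algebra_simps)

fun len :: "nat \<Rightarrow> nat" where
  "len 0 = 3"
| "len (Suc 0) = 4"
| "len (Suc (Suc k)) = s k * len (Suc k) + len k"

lemma det_M: "\<bar>det2 (M k)\<bar> = p ^ (2 * len k)"
proof (induction k rule: len.induct)
  case (3 k)
  then show ?case
    by (simp add: M_rec det2_mult det2_power abs_mult power_abs power_add power_mult[symmetric] algebra_simps)
qed (use p in \<open>simp_all add: M_def det2_mult det_E det_A abs_mult power_abs power_add[symmetric] power_mult[symmetric]\<close>)

lemma det_M_P: "det2 (M k) = det2 (P k) * p ^ 4"
  by (simp add: M_def det2_mult det_E)

section \<open>Positivity and prefixes\<close>

lemma good_A: "good p A1" "good p A2"
proof -
  have "coprime (a + p) p" using coprime by (simp add: coprime_iff_gcd_eq_1)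
  then show "good p A1" "good p A2" unfolding good_def A1_def A2_def using a p coprime by simp_all
qed

lemma good_E: "good p (E k)"
  unfolding E_def using good_A good_mult(1) by simp

lemma good_P: "good p (P k)"
  by (induction k rule: P.induct) (auto intro!: good_mult(1) good_power_mult good_A good_E)

lemma good_M: "good p (M k)"
  unfolding M_def using good_P good_E by (rule good_mult(1))

lemma good_Q: "good p (Q k j)"
  unfolding Q_def using good_M good_P by (rule good_power_mult)

text \<open>The inequality is strict because the remaining factor has to be \<open>good\<close>,
  which the identity is not.\<close>

lemma prefix_M:
  assumes "Suc k < l"
  shows "\<exists>N. good p N \<and> M l = M (Suc k) * N"
proof -
  have step: "\<exists>N. good p N \<and> M (Suc (Suc i)) = M (Suc i) * N" for i
  proof -
    obtain r where r: "s i = Suc r" using s(1)[of i] by (cases "s i") auto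
    then have "M (Suc (Suc i)) = M (Suc i) * (M (Suc i) ^ r * M i)" by (simp add: M_rec mult.assoc)
    then show ?thesis using good_power_mult[OF good_M good_M] by blast
  qed
  have "\<exists>N. good p N \<and> M (Suc (Suc k) + d) = M (Suc k) * N" for d
  proof (induction d)
    case 0
    then show ?case using step by simp
  next
    case (Suc d)
    then obtain N where N: "good p N" "M (Suc (Suc k) + d) = M (Suc k) * N" by blast
    obtain N' where "good p N'" "M (Suc (Suc (Suc k + d))) = M (Suc (Suc k + d)) * N'" using step by blast
    then show ?case using N good_mult(1)[of p N N'] by (auto simp: mult.assoc)
  qed
  moreover have "Suc (Suc k) + (l - Suc (Suc k)) = l" using assms by simp
  ultimately show ?thesis by metis
qed

lemma prefix_Q:
  assumes k: "k = Suc i" and j: "j \<le> s k" and l: "Suc (Suc k) < l"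
  shows "\<exists>N. good p N \<and> M l = Q k j * N"
proof -
  obtain N1 where N1: "good p N1" "M (Suc k) = M k * N1" using prefix_M[of i "Suc k"] k by auto
  obtain N2 where N2: "good p N2" "M l = M (Suc (Suc k)) * N2" using prefix_M[of "Suc k" l] l by auto
  have Mk: "M k = P k * E k" by (simp add: M_def)
  show ?thesis
  proof (cases "j = s k")
    case True
    then have "M l = Q k j * (E k * N2)" by (simp add: N2 M_rec Q_def Mk mult.assoc)
    then show ?thesis using good_mult(1)[OF good_E N2(1)] by blast
  next
    case False
    \<comment> \<open>A full factor \<open>M (Suc k)\<close> remains after the \<open>j\<close>-th
      power; it begins with \<open>M k\<close>, which begins with \<open>P k\<close>.\<close>
    then obtain r where r: "s k = j + Suc r" using j by (metis less_imp_Suc_add le_neq_implies_less add_Suc_right)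
    have "M l = M (Suc k) ^ j * M (Suc k) * (M (Suc k) ^ r * M k * N2)"
      by (simp only: N2 M_rec r power_add power_Suc mult.assoc)
    also have "\<dots> = M (Suc k) ^ j * (P k * E k * N1) * (M (Suc k) ^ r * M k * N2)"
      using N1(2) Mk by metis
    also have "\<dots> = Q k j * (E k * (N1 * ((M (Suc k) ^ r * M k) * N2)))" by (simp add: Q_def mult.assoc)
    finally show ?thesis
      using good_mult(1)[OF good_E good_mult(1)[OF N1(1) good_mult(1)[OF good_power_mult[OF good_M good_M] N2(1)]]]
      by blast
  qed
qed

section \<open>Size of the matrices in terms of word length\<close>

lemma len_ge: "Suc k \<le> len k"
proof (induction k rule: len.induct)
  case (3 k)
  have "len (Suc k) \<le> s k * len (Suc k)" using s(1)[of k] by simp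
  then show ?case using 3 unfolding len.simps by linarith
qed auto

lemma m11_M_ge: "a ^ len k \<le> m11 (M k)"
proof -
  have mult: "a ^ (i + j) \<le> m11 (X * Y)"
    if "a ^ i \<le> m11 X" "a ^ j \<le> m11 Y" "good p X" "good p Y" for i j X Y
  proof -
    have "a ^ i * a ^ j \<le> m11 X * m11 Y" using that a p by (intro mult_mono) (auto simp: good_def)
    then show ?thesis using good_mult(2)[OF that(3,4)] by (simp add: power_add)
  qed
  have pow: "a ^ (n * i + j) \<le> m11 (X ^ n * Y)"
    if "a ^ i \<le> m11 X" "a ^ j \<le> m11 Y" "good p X" "good p Y" for i j n X Y
  proof (induction n)
    case (Suc n)
    have "a ^ (i + (n * i + j)) \<le> m11 (X * (X ^ n * Y))"
      by (rule mult[OF that(1) Suc that(3) good_power_mult[OF that(3,4)]])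
    then show ?case by (simp add: mult.assoc add.assoc)
  qed (use that in simp)
  have A: "a ^ 1 \<le> m11 A1" "a ^ 1 \<le> m11 A2" using p by (simp_all add: A1_def A2_def)
  have E: "a ^ 2 \<le> m11 (E k)" for k
    using mult[OF A good_A] mult[OF A(2,1) good_A(2,1)] by (simp add: E_def numeral_2_eq_2)
  show ?thesis
  proof (induction k rule: len.induct)
    case 1
    show ?case using mult[OF A(1) E good_A(1) good_E, of 0] by (simp add: M_def power3_eq_cube mult.assoc)
  next
    case 2
    have "a ^ (1 + 1) \<le> m11 (A1 * A1)" by (rule mult[OF A(1) A(1) good_A(1) good_A(1)])
    then have "a ^ (1 + 1 + 2) \<le> m11 (A1 * A1 * E 1)"
      by (rule mult[OF _ E _ good_E]) (rule good_mult(1)[OF good_A(1) good_A(1)])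
    then show ?case by (simp add: M_def power4_eq_xxxx mult.assoc)
  next
    case (3 k)
    show ?case using pow[OF 3 good_M good_M] by (simp add: M_rec)
  qed
qed

text \<open>The factor 2 is built into the bound because \<open>2 * m11\<close> is submultiplicative
  on good matrices, while \<open>m11\<close> itself is so only up to 2.\<close>

lemma m11_M_le: "2 * m11 (M k) \<le> (2 * (a + p)) ^ len k"
proof -
  let ?b = "2 * (a + p)"
  have b: "0 < ?b" using a p by simp
  have mult: "2 * m11 (X * Y) \<le> ?b ^ (i + j)"
    if "2 * m11 X \<le> ?b ^ i" "2 * m11 Y \<le> ?b ^ j" "good p X" "good p Y" for i j X Y
  proof -
    have "(2 * m11 X) * (2 * m11 Y) \<le> ?b ^ i * ?b ^ j" using that b by (intro mult_mono) (auto simp: good_def)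
    then show ?thesis using good_mult(3)[OF that(3,4)] unfolding power_add by linarith
  qed
  have pow: "2 * m11 (X ^ n * Y) \<le> ?b ^ (n * i + j)"
    if "2 * m11 X \<le> ?b ^ i" "2 * m11 Y \<le> ?b ^ j" "good p X" "good p Y" for i j n X Y
  proof (induction n)
    case (Suc n)
    have "2 * m11 (X * (X ^ n * Y)) \<le> ?b ^ (i + (n * i + j))"
      by (rule mult[OF that(1) Suc that(3) good_power_mult[OF that(3,4)]])
    then show ?case by (simp only: power_Suc mult.assoc mult_Suc add.assoc)
  qed (use that in simp)
  have A: "2 * m11 A1 \<le> ?b ^ 1" "2 * m11 A2 \<le> ?b ^ 1" using p by (simp_all add: A1_def A2_def)
  have E: "2 * m11 (E k) \<le> ?b ^ 2" for k
    using mult[OF A good_A] mult[OF A(2,1) good_A(2,1)] by (cases "even k") (simp_all only: E_def one_add_one if_True if_False)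
  show ?thesis
  proof (induction k rule: len.induct)
    case 1
    have "2 * m11 (A1 * E 0) \<le> ?b ^ (1 + 2)" by (rule mult[OF A(1) E good_A(1) good_E])
    then show ?case by (simp add: M_def power3_eq_cube mult.assoc)
  next
    case 2
    have "2 * m11 (A1 * A1) \<le> ?b ^ (1 + 1)" by (rule mult[OF A(1) A(1) good_A(1) good_A(1)])
    then have "2 * m11 (A1 * A1 * E (Suc 0)) \<le> ?b ^ (1 + 1 + 2)"
      by (rule mult[OF _ E _ good_E]) (rule good_mult(1)[OF good_A(1) good_A(1)])
    then show ?case by (simp add: M_def power4_eq_xxxx mult.assoc)
  next
    case (3 k)
    show ?case using pow[OF 3 good_M good_M] by (simp only: M_rec len.simps)
  qed
qed

definition W :: "nat \<Rightarrow> real" where "W k = lnm (M k)"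

text \<open>The logarithm of the absolute determinant of \<open>M k\<close>, each letter
  contributing \<open>p\<^sup>2\<close>.\<close>

definition D :: "nat \<Rightarrow> real" where "D k = 2 * len k * ln p"

lemma W_ge: "len k * ln a \<le> W k"
proof -
  have pos: "0 < m11 (M k)" using good_M unfolding good_def by blast
  have "real_of_int (a ^ len k) \<le> m11 (M k)" using m11_M_ge by (simp only: of_int_le_iff)
  then have "ln (real_of_int a ^ len k) \<le> ln (real_of_int (m11 (M k)))"
    using a p pos by (subst ln_le_cancel_iff) auto
  then show ?thesis unfolding W_def lnm_def using a p by (simp add: ln_realpow)
qed

lemma W_le: "W k \<le> len k * ln (2 * (a + p))"
proof -
  have pos: "0 < m11 (M k)" using good_M unfolding good_def by blast
  have "m11 (M k) \<le> (2 * (a + p)) ^ len k" using m11_M_le[of k] pos by linarith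
  then have "real_of_int (m11 (M k)) \<le> real_of_int ((2 * (a + p)) ^ len k)" by (simp only: of_int_le_iff)
  then have "ln (real_of_int (m11 (M k))) \<le> ln (real_of_int (2 * (a + p)) ^ len k)"
    using pos a p by (subst ln_le_cancel_iff) (auto simp del: of_int_mult of_int_add)
  then show ?thesis unfolding W_def lnm_def using a p by (simp add: ln_realpow)
qed

lemma ln_a: "ln 2 + ln p \<le> ln a" "0 < ln (real_of_int p)" "1 / 2 \<le> ln (real_of_int a)"
proof -
  have "ln (2 * real_of_int p) \<le> ln a" using a p by (subst ln_le_cancel_iff) auto
  then show 1: "ln 2 + ln p \<le> ln a" using p by (simp add: ln_mult)
  show 2: "0 < ln (real_of_int p)" using p by simp
  show "1 / 2 \<le> ln (real_of_int a)" using 1 2 ln2_ge_two_thirds by linarith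
qed

lemma W_lim: "filterlim W at_top sequentially"
proof (rule filterlim_at_top_mono)
  show "filterlim (\<lambda>k. 1 / 2 * real k) at_top sequentially" by real_asymp
  show "\<forall>\<^sub>F k in sequentially. 1 / 2 * real k \<le> W k"
  proof (intro always_eventually allI)
    fix k
    have "real k * (1 / 2) \<le> len k * ln a" using len_ge[of k] ln_a by (intro mult_mono) auto
    then show "1 / 2 * real k \<le> W k" using W_ge[of k] by linarith
  qed
qed

lemma W_rec: "s k * W (Suc k) + W k \<le> W (Suc (Suc k))" "W (Suc (Suc k)) \<le> s k * W (Suc k) + W k + s k * ln 2"
  unfolding W_def M_rec using lnm_power_mult[OF good_M good_M] by simp_all

lemma abs_det_M: "\<bar>real_of_int (det2 (M k))\<bar> = exp (D k)"
proof -
  have "\<bar>real_of_int (det2 (M k))\<bar> = real_of_int p ^ (2 * len k)"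
    using det_M[of k] by (metis of_int_abs of_int_power)
  also have "\<dots> = exp (D k)" unfolding D_def using p by (simp add: exp_of_nat_mult flip: of_nat_mult)
  finally show ?thesis .
qed

lemma abs_det_P: "\<bar>real_of_int (det2 (P k))\<bar> = exp (D k - 4 * ln p)"
proof -
  have "exp (D k) = \<bar>real_of_int (det2 (P k))\<bar> * real_of_int p ^ 4"
    unfolding abs_det_M[symmetric] det_M_P using p by (simp add: abs_mult)
  moreover have "exp (4 * ln (real_of_int p)) = real_of_int p ^ 4"
    using p exp_of_nat_mult[of 4 "ln (real_of_int p)"] by simp
  ultimately show ?thesis using p by (simp add: exp_diff field_simps)
qed

text \<open>Each letter contributes at most \<open>2 * (ln p - ln a)\<close>, which is at most
  \<open>-1\<close> by \<open>2 * p \<le> a\<close>. So the determinant is negligible against the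
  square of the corner.\<close>

lemma D_W: "D k - 2 * W k \<le> - real k"
proof -
  have "len k * (ln a - ln p) \<ge> len k * (1 / 2)" using ln_a ln2_ge_two_thirds by (intro mult_left_mono) auto
  then show ?thesis using W_ge[of k] len_ge[of k] unfolding D_def by (simp add: algebra_simps)
qed

lemma det_ratio: "\<bar>real_of_int (det2 (M k))\<bar> / (real_of_int (m11 (M k)))\<^sup>2 \<le> exp (- real k)"
proof -
  have "exp (D k - 2 * W k) \<le> exp (- real k)" using D_W by simp
  moreover have "exp (D k - 2 * W k) = exp (D k) / (exp (W k))\<^sup>2"
    by (simp add: exp_diff power2_eq_square flip: exp_add)
  moreover have "real_of_int (m11 (M k)) = exp (W k)" unfolding W_def exp_lnm[OF good_M] ..
  ultimately show ?thesis unfolding abs_det_M by simp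
qed

section \<open>The limit number and its approximation by prefixes\<close>

definition q :: "nat \<Rightarrow> real" where "q k = m21 (M k) / real_of_int (m11 (M k))"

definition \<xi> :: real where "\<xi> = lim q"

lemma q_lim: "q \<longlonglongrightarrow> \<xi>"
proof -
  have diff: "\<bar>q l - q (Suc k)\<bar> \<le> exp (- real k)" if l: "Suc k \<le> l" for k l
  proof (cases "l = Suc k")
    case False
    then obtain N where N: "good p N" "M l = M (Suc k) * N" using l prefix_M[of k l] by auto
    have pos: "0 < real_of_int (m11 (M (Suc k)))" using good_M unfolding good_def by simp
    have "\<bar>m11 (M (Suc k)) * q l - m21 (M (Suc k))\<bar> \<le> \<bar>real_of_int (det2 (M (Suc k)))\<bar> / m11 (M (Suc k))"
      by (rule moebius_error(3)[OF good_M N(1)]) (simp only: q_def N)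
    moreover have "m11 (M (Suc k)) * q l - m21 (M (Suc k)) = m11 (M (Suc k)) * (q l - q (Suc k))"
      unfolding q_def[of "Suc k"] using pos by (simp add: field_simps)
    ultimately have "\<bar>q l - q (Suc k)\<bar> \<le> \<bar>real_of_int (det2 (M (Suc k)))\<bar> / (real_of_int (m11 (M (Suc k))))\<^sup>2"
      using pos by (simp add: abs_mult power2_eq_square pos_le_divide_eq ac_simps)
    also have "\<dots> \<le> exp (- real (Suc k))" by (rule det_ratio)
    also have "\<dots> \<le> exp (- real k)" by simp
    finally show ?thesis .
  qed simp
  have "Cauchy q"
  proof (rule metric_CauchyI)
    fix e :: real assume e: "0 < e"
    have "(\<lambda>k. exp (- real k)) \<longlonglongrightarrow> 0" by real_asymp
    then have "\<forall>\<^sub>F k in sequentially. exp (- real k) < e / 2" using e by (intro order_tendstoD) auto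
    then obtain k where k: "exp (- real k) < e / 2" by (auto simp: eventually_sequentially)
    have "dist (q m) (q n) < e" if "m \<ge> Suc k" "n \<ge> Suc k" for m n
      using diff[OF that(1)] diff[OF that(2)] k unfolding dist_real_def by linarith
    then show "\<exists>K. \<forall>m\<ge>K. \<forall>n\<ge>K. dist (q m) (q n) < e" by blast
  qed
  then show ?thesis unfolding \<xi>_def by (simp add: Cauchy_convergent convergent_LIMSEQ_iff[symmetric])
qed

text \<open>For all large \<open>l\<close>, \<open>q l\<close> is the Moebius image under
  \<open>Y\<close> of a number in a fixed interval, so the bounds of \<open>moebius_error\<close>
  pass to the limit.\<close>

lemma prefix_error:
  assumes Y: "good p Y" "transp2 Y = Y" and N: "\<And>l. K \<le> l \<Longrightarrow> \<exists>N. good p N \<and> M l = Y * N"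
  shows "\<bar>m11 Y * \<xi> - m12 Y\<bar> \<le> \<bar>real_of_int (det2 Y)\<bar> / m11 Y"
    "\<bar>m11 Y * \<xi>\<^sup>2 - m22 Y\<bar> \<le> \<bar>real_of_int (det2 Y)\<bar> / m11 Y"
    "\<bar>real_of_int (det2 Y)\<bar> / (2 * m11 Y) \<le> \<bar>m11 Y * \<xi>\<^sup>2 - m22 Y\<bar>"
proof -
  have b: "\<bar>m11 Y * q l - m12 Y\<bar> \<le> \<bar>real_of_int (det2 Y)\<bar> / m11 Y \<and>
    \<bar>m11 Y * (q l)\<^sup>2 - m22 Y\<bar> \<le> \<bar>real_of_int (det2 Y)\<bar> / m11 Y \<and>
    \<bar>real_of_int (det2 Y)\<bar> / (2 * m11 Y) \<le> \<bar>m11 Y * (q l)\<^sup>2 - m22 Y\<bar>" if l: "K \<le> l" for l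
  proof -
    obtain N where N: "good p N" "M l = Y * N" using assms(3)[OF l] by blast
    have "q l = m21 (Y * N) / real_of_int (m11 (Y * N))" unfolding q_def N ..
    from moebius_error(3-5)[OF Y(1) N(1) this] Y(2) show ?thesis by (simp add: transp2_eq_iff)
  qed
  have ev: "\<forall>\<^sub>F l in sequentially. K \<le> l" by (rule eventually_ge_at_top)
  have t1: "(\<lambda>l. \<bar>m11 Y * q l - m12 Y\<bar>) \<longlonglongrightarrow> \<bar>m11 Y * \<xi> - m12 Y\<bar>"
    and t2: "(\<lambda>l. \<bar>m11 Y * (q l)\<^sup>2 - m22 Y\<bar>) \<longlonglongrightarrow> \<bar>m11 Y * \<xi>\<^sup>2 - m22 Y\<bar>"
    using q_lim by (auto intro!: tendsto_intros)
  show "\<bar>m11 Y * \<xi> - m12 Y\<bar> \<le> \<bar>real_of_int (det2 Y)\<bar> / m11 Y"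
    by (rule tendsto_upperbound[OF t1 eventually_mono[OF ev]]) (simp_all add: b)
  show "\<bar>m11 Y * \<xi>\<^sup>2 - m22 Y\<bar> \<le> \<bar>real_of_int (det2 Y)\<bar> / m11 Y"
    by (rule tendsto_upperbound[OF t2 eventually_mono[OF ev]]) (simp_all add: b)
  show "\<bar>real_of_int (det2 Y)\<bar> / (2 * m11 Y) \<le> \<bar>m11 Y * \<xi>\<^sup>2 - m22 Y\<bar>"
    by (rule tendsto_lowerbound[OF t2 eventually_mono[OF ev]]) (use b in blast, simp)
qed


text \<open>The case \<open>j = 2\<close> is included also when \<open>s k = 1\<close>, because
  \<open>val_bounds\<close> evaluates the form at \<open>Q k 2\<close>; there \<open>Q_1_eq\<close>
  identifies it with \<open>Q (Suc k) 1\<close>, again a prefix.\<close>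

lemma Q_error:
  assumes "k = Suc i" "j \<le> s k \<or> k = Suc (Suc i') \<and> j = 2"
  defines "Y \<equiv> Q k j"
  shows "\<bar>m11 Y * \<xi> - m12 Y\<bar> \<le> \<bar>real_of_int (det2 Y)\<bar> / m11 Y"
    "\<bar>m11 Y * \<xi>\<^sup>2 - m22 Y\<bar> \<le> \<bar>real_of_int (det2 Y)\<bar> / m11 Y"
    "\<bar>real_of_int (det2 Y)\<bar> / (2 * m11 Y) \<le> \<bar>m11 Y * \<xi>\<^sup>2 - m22 Y\<bar>"
proof -
  have "\<exists>N. good p N \<and> M l = Y * N" if l: "Suc (Suc (Suc (Suc k))) \<le> l" for l
  proof (cases "j \<le> s k")
    case True
    then show ?thesis unfolding Y_def using prefix_Q[OF assms(1) True, of l] l by simp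
  next
    case False
    then have "s k = 1" "j = 2" using assms(2) s(1)[of k] by auto
    then have "Y = Q (Suc k) 1" unfolding Y_def Q_1_eq by (simp add: numeral_2_eq_2)
    then show ?thesis using prefix_Q[of "Suc k" k 1 l] s(1) l by simp
  qed
  from prefix_error[OF _ _ this] good_Q Q_sym show "\<bar>m11 Y * \<xi> - m12 Y\<bar> \<le> \<bar>real_of_int (det2 Y)\<bar> / m11 Y"
    "\<bar>m11 Y * \<xi>\<^sup>2 - m22 Y\<bar> \<le> \<bar>real_of_int (det2 Y)\<bar> / m11 Y"
    "\<bar>real_of_int (det2 Y)\<bar> / (2 * m11 Y) \<le> \<bar>m11 Y * \<xi>\<^sup>2 - m22 Y\<bar>"
    unfolding Y_def by blast+
qed

section \<open>Logarithmic sizes of points and forms\<close>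

lemma abs_det_Q: "\<bar>real_of_int (det2 (Q k j))\<bar> = exp (j * D (Suc k) + D k - 4 * ln p)"
  unfolding Q_def det2_mult det2_power of_int_mult abs_mult of_int_power power_abs abs_det_M abs_det_P
  by (simp add: exp_of_nat_mult[symmetric] algebra_simps flip: exp_add)

definition C\<^sub>E :: real where "C\<^sub>E = lnm (E 0)"

text \<open>Both orders of the letters have the same corner, so passing between \<open>P k\<close>
  and \<open>M k\<close> costs only a constant.\<close>

lemma lnm_E: "lnm (E k) = C\<^sub>E" "0 \<le> C\<^sub>E"
  using lnm_nonneg[OF good_E, of 0] by (simp_all add: C\<^sub>E_def E_def lnm_def A1_def A2_def algebra_simps)

lemma lnm_P: "W k - C\<^sub>E - ln 2 \<le> lnm (P k)" "lnm (P k) \<le> W k"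
  using lnm_mult[OF good_P good_E, of k k] lnm_E unfolding W_def M_def by simp_all

lemma lnm_Q: "j * W (Suc k) + W k - C\<^sub>E - ln 2 \<le> lnm (Q k j)" "lnm (Q k j) \<le> j * W (Suc k) + W k + j * ln 2"
  using lnm_power_mult[OF good_M[of "Suc k"] good_P[of k], where j = j] lnm_P[of k]
  unfolding Q_def W_def by linarith+

lemma m11_Q: "real_of_int (m11 (Q k j)) = exp (lnm (Q k j))"
  by (rule exp_lnm[OF good_Q, symmetric])

abbreviation Z1 :: "nat \<Rightarrow> int" where "Z1 k \<equiv> m22 (M k) - m11 (M k)"

abbreviation val :: "nat \<Rightarrow> real" where "val k \<equiv> m21 (M k) + Z1 k * \<xi> + (- m12 (M k)) * \<xi>\<^sup>2"

lemma Z_bounds: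
  "\<bar>real_of_int (Z1 k)\<bar> \<le> exp (W k)" "\<bar>real_of_int (- m12 (M k))\<bar> \<le> exp (W k)"
  "\<bar>- m12 (M k)\<bar> \<le> 2 * \<bar>Z1 k\<bar>" "exp (W k - ln 2) \<le> \<bar>real_of_int (Z1 k)\<bar>"
proof -
  have g: "0 < m11 (M k)" "0 \<le> m22 (M k)" "2 * m22 (M k) \<le> m12 (M k)" "2 * m12 (M k) \<le> m11 (M k)"
    using good_M[of k] unfolding good_def by auto
  have e: "exp (W k) = real_of_int (m11 (M k))" unfolding W_def by (rule exp_lnm[OF good_M])
  show "\<bar>real_of_int (Z1 k)\<bar> \<le> exp (W k)" "\<bar>real_of_int (- m12 (M k))\<bar> \<le> exp (W k)"
    unfolding e using g by linarith+
  show "\<bar>- m12 (M k)\<bar> \<le> 2 * \<bar>Z1 k\<bar>" using g by simp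
  show "exp (W k - ln 2) \<le> \<bar>real_of_int (Z1 k)\<bar>" unfolding exp_diff e using g by simp
qed

text \<open>The value at \<open>\<xi>\<close> is read off from the integer \<open>skew (M k) (Q k 2)\<close>, which is known exactly.\<close>

lemma val_bounds:
  assumes k: "k = Suc (Suc i)" and small: "C\<^sub>E + 4 \<le> real k"
  shows "\<bar>val k\<bar> \<le> 2 * exp (D k + D (Suc k) - 2 * ln p - lnm (Q k 2))"
    "exp (D k + D (Suc k) - 2 * ln p - lnm (Q k 2)) \<le> 2 * \<bar>val k\<bar>"
proof -
  define m where "m = exp (D k + D (Suc k) - 2 * ln (real_of_int p))"
  let ?Y = "Q k 2"
  \<comment> \<open>The trace term of \<open>skew_square\<close> disappears because it contains
    \<open>skew (M k) (Q k 1)\<close>.\<close>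
  have "skew (M k) ?Y = - det2 (M (Suc k)) * skew (M k) (P k)"
    using skew_square[of "M k" "M (Suc k)" "P k"] skew_Q_1[of k]
    by (simp add: Q_def numeral_2_eq_2 mult.assoc)
  then have "\<bar>real_of_int (skew (M k) ?Y)\<bar> = \<bar>real_of_int (det2 (M (Suc k)))\<bar> * \<bar>real_of_int (skew (M k) (P k))\<bar>"
    by (simp add: abs_mult)
  also have "\<bar>real_of_int (skew (M k) (P k))\<bar> = \<bar>real_of_int (det2 (P k))\<bar> * real_of_int \<bar>m21 (E k) - m12 (E k)\<bar>"
    unfolding M_def skew_sandwich[OF P_sym] by (simp only: of_int_mult abs_mult of_int_abs)
  also have "real_of_int \<bar>m21 (E k) - m12 (E k)\<bar> = exp (2 * ln (real_of_int p))"
    unfolding skew_E using p exp_of_nat_mult[of 2 "ln (real_of_int p)"] by simp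
  also have "\<bar>real_of_int (det2 (M (Suc k)))\<bar> * (\<bar>real_of_int (det2 (P k))\<bar> * exp (2 * ln (real_of_int p))) = m"
    unfolding abs_det_M abs_det_P m_def by (simp flip: exp_add)
  finally have skew: "\<bar>real_of_int (skew (M k) ?Y)\<bar> = m" .
  have expand: "real_of_int (skew (M k) ?Y)
      = m11 ?Y * val k - Z1 k * (m11 ?Y * \<xi> - m12 ?Y) - (- m12 (M k)) * (m11 ?Y * \<xi>\<^sup>2 - m22 ?Y)"
    unfolding skew_def by (simp add: algebra_simps)
  define r where "r = \<bar>real_of_int (det2 ?Y)\<bar> / m11 ?Y"
  have err: "\<bar>m11 ?Y * \<xi> - m12 ?Y\<bar> \<le> r" "\<bar>m11 ?Y * \<xi>\<^sup>2 - m22 ?Y\<bar> \<le> r"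
    unfolding r_def using Q_error(1,2)[of k "Suc i" 2 i] k by auto
  have "\<bar>Z1 k * (m11 ?Y * \<xi> - m12 ?Y)\<bar> \<le> exp (W k) * r" "\<bar>(- m12 (M k)) * (m11 ?Y * \<xi>\<^sup>2 - m22 ?Y)\<bar> \<le> exp (W k) * r"
    unfolding abs_mult using err Z_bounds(1,2)[of k] by (auto intro!: mult_mono simp del: of_int_diff of_int_minus)
  \<comment> \<open>The errors are smaller than the main term by about
    \<open>exp (D (Suc k) - 2 * W (Suc k))\<close>, which \<open>D_W\<close> makes small for large
    \<open>k\<close>.\<close>
  moreover have "8 * (exp (W k) * r) \<le> m"
  proof -
    have r: "r = exp (2 * D (Suc k) + D k - 4 * ln p - lnm ?Y)"
      unfolding r_def abs_det_Q m11_Q by (simp add: exp_diff)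
    have "W k + (2 * D (Suc k) + D k - 4 * ln p - lnm ?Y) + 3 \<le> D k + D (Suc k) - 2 * ln p"
    proof -
      have "2 * W (Suc k) + W k - C\<^sub>E - ln 2 \<le> lnm ?Y" using lnm_Q(1)[where j = 2 and k = k] by simp
      moreover have "D (Suc k) - 2 * W (Suc k) \<le> - real (Suc k)" by (rule D_W)
      ultimately show ?thesis using small ln_a(2) ln_2_less_1 by simp
    qed
    then have "8 * exp (W k + (2 * D (Suc k) + D k - 4 * ln p - lnm ?Y)) \<le> m"
      unfolding m_def by (intro exp_add3_le) simp
    then show ?thesis unfolding r by (simp add: exp_add)
  qed
  ultimately have "\<bar>m11 ?Y * val k\<bar> \<le> 2 * m" "m \<le> 2 * \<bar>m11 ?Y * val k\<bar>"
    using abs_dominated[OF expand skew] by blast+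
  moreover have "\<bar>m11 ?Y * val k\<bar> = exp (lnm ?Y) * \<bar>val k\<bar>" by (simp add: abs_mult m11_Q)
  moreover have "exp (D k + D (Suc k) - 2 * ln p - lnm ?Y) * exp (lnm ?Y) = m" unfolding m_def by (simp flip: exp_add)
  ultimately have "exp (lnm ?Y) * \<bar>val k\<bar> \<le> exp (lnm ?Y) * (2 * exp (D k + D (Suc k) - 2 * ln p - lnm ?Y))"
    "exp (lnm ?Y) * exp (D k + D (Suc k) - 2 * ln p - lnm ?Y) \<le> exp (lnm ?Y) * (2 * \<bar>val k\<bar>)"
    by (simp_all add: ac_simps)
  then show "\<bar>val k\<bar> \<le> 2 * exp (D k + D (Suc k) - 2 * ln p - lnm ?Y)"
    "exp (D k + D (Suc k) - 2 * ln p - lnm ?Y) \<le> 2 * \<bar>val k\<bar>"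
    by (simp_all only: mult_le_cancel_left_pos exp_gt_zero)
qed

section \<open>Primitivity\<close>

lemma det_P_dvd: "det2 (P k) dvd p ^ (2 * len k)"
  using det_M[of k] det_M_P[of k] by (metis dvd_abs_iff dvd_triv_left)

text \<open>The middle coefficient is prime to \<open>p\<close>, while the value of the form at
  \<open>P k\<close> is, by \<open>skew_sandwich\<close>, a divisor of a power of \<open>p\<close>.
  A common divisor of the coefficients divides both.\<close>

lemma primitive_Z: "primitive3 (m21 (M k)) (Z1 k) (- m12 (M k))"
proof -
  have "coprime (m11 (M k)) p" "p dvd m22 (M k)" using good_M[of k] unfolding good_def by auto
  have "coprime (Z1 k) p"
  proof (rule coprimeI)
    fix c assume c: "c dvd Z1 k" "c dvd p"
    then have "c dvd m22 (M k)" using \<open>p dvd m22 (M k)\<close> dvd_trans by blast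
    then have "c dvd m11 (M k)" using dvd_diff[of c "m22 (M k)" "Z1 k"] c(1) by simp
    then show "is_unit c" using c \<open>coprime (m11 (M k)) p\<close> coprime_common_divisor by force
  qed
  have "m21 (E k) - m12 (E k) dvd p\<^sup>2" unfolding skew_E[of k, symmetric] by simp
  then have "det2 (P k) * (m21 (E k) - m12 (E k)) dvd p ^ (2 * len k) * p\<^sup>2"
    using det_P_dvd by (intro mult_dvd_mono)
  moreover have "coprime (Z1 k) (p ^ (2 * len k) * p\<^sup>2)" using \<open>coprime (Z1 k) p\<close> by simp
  ultimately obtain u v where uv: "u * Z1 k + v * (det2 (P k) * (m21 (E k) - m12 (E k))) = 1"
    using coprime_dvd_bezout by metis
  have "det2 (P k) * (m21 (E k) - m12 (E k))
      = m21 (M k) * m11 (P k) + Z1 k * m12 (P k) + (- m12 (M k)) * m22 (P k)"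
    using skew_sandwich[OF P_sym, of k "E k"] unfolding M_def[symmetric] skew_def by simp
  then have "(v * m11 (P k)) * m21 (M k) + (u + v * m12 (P k)) * Z1 k + (v * m22 (P k)) * (- m12 (M k)) = 1"
    using uv by algebra
  then show ?thesis unfolding primitive3_def by blast
qed

text \<open>A common divisor divides the corner, which is prime to \<open>p\<close>, and the
  determinant, which divides a power of \<open>p\<close>.\<close>

lemma primitive_Q: "primitive3 (m11 (Q k j)) (m12 (Q k j)) (m22 (Q k j))"
proof -
  have "coprime (m11 (Q k j)) p" using good_Q unfolding good_def by blast
  then have "coprime (m11 (Q k j)) ((p ^ (2 * len (Suc k))) ^ j * p ^ (2 * len k))" by simp
  moreover have "det2 (Q k j) dvd (p ^ (2 * len (Suc k))) ^ j * p ^ (2 * len k)"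
  proof -
    have "det2 (M (Suc k)) dvd p ^ (2 * len (Suc k))" unfolding det_M[of "Suc k", symmetric] by simp
    then show ?thesis unfolding Q_def det2_mult det2_power
      using det_P_dvd by (intro mult_dvd_mono dvd_power_same)
  qed
  ultimately obtain u v where uv: "u * m11 (Q k j) + v * det2 (Q k j) = 1"
    using coprime_dvd_bezout by metis
  have "m21 (Q k j) = m12 (Q k j)" using Q_sym[of k j] by (simp add: transp2_eq_iff)
  then have "(u + v * m22 (Q k j)) * m11 (Q k j) + (- v * m12 (Q k j)) * m12 (Q k j) + 0 * m22 (Q k j) = 1"
    using uv unfolding det2_def by (simp add: algebra_simps)
  then show ?thesis unfolding primitive3_def by blast
qed

end

section \<open>Growth rates\<close>

text \<open>Once \<open>e k\<close> is below \<open>r / 2 * (1 - c)\<close>, iteration leaves a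
  geometric term plus the fixed point \<open>r / 2\<close>.\<close>

lemma contraction_tendsto_0:
  fixes d e :: "nat \<Rightarrow> real"
  assumes d: "\<And>k. 0 \<le> d k" and rec: "\<forall>\<^sub>F k in sequentially. d (Suc k) \<le> c * d k + e k"
    and c: "0 \<le> c" "c < 1" and e: "e \<longlonglongrightarrow> 0"
  shows "d \<longlonglongrightarrow> 0"
proof (rule tendsto_sandwich[OF _ _ tendsto_const])
  show "\<forall>\<^sub>F k in sequentially. 0 \<le> d k" using d by simp
  show "\<forall>\<^sub>F k in sequentially. d k \<le> d k" by simp
  show "d \<longlonglongrightarrow> 0"
  proof (rule order_tendstoI)
    fix r :: real assume "r < 0"
    then show "\<forall>\<^sub>F k in sequentially. r < d k" using d by (intro always_eventually allI) (rule less_le_trans)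
  next
    fix r :: real assume r: "0 < r"
    have "\<forall>\<^sub>F k in sequentially. e k < r / 2 * (1 - c)"
      using e r c by (intro order_tendstoD) auto
    with rec have "\<forall>\<^sub>F k in sequentially. d (Suc k) \<le> c * d k + r / 2 * (1 - c)"
      by eventually_elim simp
    then obtain K where K: "\<And>k. K \<le> k \<Longrightarrow> d (Suc k) \<le> c * d k + r / 2 * (1 - c)"
      by (auto simp: eventually_sequentially)
    have bound: "d (K + n) \<le> c ^ n * d K + r / 2" for n
    proof (induction n)
      case (Suc n)
      have "d (K + Suc n) \<le> c * d (K + n) + r / 2 * (1 - c)" using K[of "K + n"] by simp
      also have "\<dots> \<le> c * (c ^ n * d K + r / 2) + r / 2 * (1 - c)"
        using Suc c by (intro add_right_mono mult_left_mono) auto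
      also have "\<dots> = c ^ Suc n * d K + r / 2" by (simp add: field_simps)
      finally show ?case .
    qed (use r in simp)
    have "(\<lambda>n. c ^ n * d K) \<longlonglongrightarrow> 0"
      using c LIMSEQ_realpow_zero[of c] by (intro tendsto_mult_left_zero) auto
    then have "\<forall>\<^sub>F n in sequentially. c ^ n * d K < r / 2" using r by (intro order_tendstoD) auto
    then obtain N where N: "\<And>n. N \<le> n \<Longrightarrow> c ^ n * d K < r / 2" by (auto simp: eventually_sequentially)
    have "d k < r" if k: "K + N \<le> k" for k
    proof -
      have "c ^ (k - K) * d K < r / 2" using k by (intro N) simp
      then show ?thesis using bound[of "k - K"] k by simp
    qed
    then show "\<forall>\<^sub>F k in sequentially. d k < r" by (auto simp: eventually_sequentially)
  qed
qed

context sturmian_matrices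
begin

lemma B_ge: "1 \<le> B"
  using s[of 0] by simp

lemma len_mono: "len k \<le> len (Suc k)"
proof (cases k)
  case (Suc i)
  have "len (Suc i) \<le> s i * len (Suc i)" using s(1)[of i] by simp
  then show ?thesis unfolding Suc len.simps by linarith
qed simp

lemma len_le: "len (Suc k) \<le> (B + 1) * len k"
proof (cases k)
  case 0
  then show ?thesis using B_ge by simp
next
  case (Suc i)
  have "s i * len (Suc i) \<le> B * len (Suc i)" using s(2) by (intro mult_right_mono) auto
  then show ?thesis using len_mono[of i] unfolding Suc len.simps add_mult_distrib by linarith
qed

lemma len_growth: "(3 / 2) ^ k \<le> real (len k)"
proof (induction k rule: len.induct)
  case (3 k)
  have "real (len (Suc k)) \<le> s k * len (Suc k)" using s(1)[of k] by (simp flip: of_nat_mult)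
  moreover have "(3 / 2) ^ Suc (Suc k) \<le> (3 / 2) ^ Suc k + (3 / 2 :: real) ^ k" by simp
  ultimately show ?case using 3 by simp
qed simp_all

lemma W_pos: "0 < W k"
proof -
  have "0 < len k * ln (real_of_int a)" using len_ge[of k] ln_a by (intro mult_pos_pos) auto
  then show ?thesis using W_ge[of k] by linarith
qed

lemma W_ge_sum: "W k + W (Suc k) \<le> W (Suc (Suc k))"
proof -
  have "1 * W (Suc k) \<le> s k * W (Suc k)" using s(1)[of k] W_pos[of "Suc k"] by (intro mult_right_mono) auto
  then show ?thesis using W_rec(1)[of k] by linarith
qed

lemma W_mono: "W k \<le> W (Suc k)"
proof (cases k)
  case 0
  have e: "0 < a" "0 < p" using a p by auto
  \<comment> \<open>The recursion does not reach \<open>M 1\<close>, so the first comparison is made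
    on the explicit entries.\<close>
  have "1 * m11 (M 0) \<le> a * m11 (M 0)" using e good_M[of 0] unfolding good_def by (intro mult_right_mono) auto
  also have "a * m11 (M 0) \<le> m11 (M 1)"
  proof -
    have "m11 (M 1) - a * m11 (M 0) = p * p * a * a + p * p * p * p"
      by (simp add: M_def E_def A1_def A2_def algebra_simps)
    moreover have "0 \<le> p * p * a * a" "0 \<le> p * p * p * p" using e by simp_all
    ultimately show ?thesis by linarith
  qed
  finally have "m11 (M 0) \<le> m11 (M 1)" by simp
  then have "lnm (M 0) \<le> lnm (M 1)" using good_M[of 0] unfolding lnm_def good_def
    by (subst ln_le_cancel_iff) linarith+
  then show ?thesis unfolding W_def 0 by simp
next
  case (Suc i)
  then show ?thesis using W_ge_sum[of i] W_pos[of i] by simp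
qed

lemma W_rec_const: "W (Suc (Suc k)) \<le> s k * W (Suc k) + W k + B"
proof -
  have "s k * ln 2 \<le> real B * 1" using s(2)[of k] ln_2_less_1 by (intro mult_mono) auto
  then show ?thesis using W_rec(2)[of k] by simp
qed

text \<open>\<open>W\<close> satisfies the recursion of \<open>len\<close> up to a bounded error.
  The cross determinant \<open>c\<close> therefore grows at most like \<open>len (Suc k)\<close>, so
  consecutive quotients differ by at most \<open>K / len k\<close>, which is summable.\<close>

lemma W_rate_convergent: "convergent (\<lambda>k. W k / len k)"
proof -
  define c where "c k = W (Suc k) * len k - W k * len (Suc k)" for k
  define K where "K = max \<bar>c 0\<bar> (real B * (real B + 1))"
  have lpos: "0 < real (len k)" for k using len_ge[of k] by simp
  have cK: "\<bar>c k\<bar> \<le> K * len (Suc k)" for k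
  proof (induction k)
    case 0
    have "\<bar>c 0\<bar> * 1 \<le> K * len (Suc 0)" unfolding K_def by (intro mult_mono) auto
    then show ?case by simp
  next
    case (Suc k)
    define th where "th = W (Suc (Suc k)) - (s k * W (Suc k) + W k)"
    have th: "0 \<le> th" "th \<le> B" using W_rec(1)[of k] W_rec_const[of k] unfolding th_def by linarith+
    have "W (Suc (Suc k)) = th + s k * W (Suc k) + W k" unfolding th_def by simp
    then have "c (Suc k) = th * len (Suc k) - c k" unfolding c_def by (simp add: algebra_simps)
    then have "\<bar>c (Suc k)\<bar> \<le> th * len (Suc k) + \<bar>c k\<bar>"
      using mult_nonneg_nonneg[OF th(1) less_imp_le[OF lpos[of "Suc k"]]] by linarith
    also have "th * len (Suc k) \<le> real B * ((real B + 1) * real (len k))"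
      using th of_nat_mono[OF len_le[of k], where 'a = real] by (intro mult_mono) (auto simp: algebra_simps)
    also have "\<dots> \<le> K * len k"
    proof -
      have "real B * (real B + 1) * len k \<le> K * len k" unfolding K_def by (intro mult_right_mono) auto
      then show ?thesis by (simp only: mult.assoc)
    qed
    also have "K * len k + \<bar>c k\<bar> \<le> K * len k + K * len (Suc k)" using Suc by simp
    also have "\<dots> \<le> K * len (Suc (Suc k))"
    proof -
      have "len (Suc k) \<le> s k * len (Suc k)" using s(1)[of k] by simp
      then have "real (len k) + len (Suc k) \<le> len (Suc (Suc k))" unfolding len.simps by linarith
      then have "K * (real (len k) + len (Suc k)) \<le> K * len (Suc (Suc k))"
        unfolding K_def by (intro mult_left_mono) auto
      then show ?thesis by (simp add: distrib_left)
    qed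
    finally show ?case by simp
  qed
  define r where "r k = W k / len k" for k
  have r: "norm (r (Suc k) - r k) \<le> K * (2 / 3) ^ k" for k
  proof -
    have "r (Suc k) - r k = c k / (real (len k) * len (Suc k))"
      unfolding r_def c_def using lpos[of k] lpos[of "Suc k"] by (simp add: field_simps)
    then have "norm (r (Suc k) - r k) = \<bar>c k\<bar> / (real (len k) * len (Suc k))" by (simp add: abs_divide abs_mult)
    also have "\<dots> \<le> K * len (Suc k) / (real (len k) * len (Suc k))"
      using cK lpos by (intro divide_right_mono) auto
    also have "\<dots> = K / len k" using lpos[of "Suc k"] by simp
    also have "\<dots> \<le> K / (3 / 2) ^ k"
      using len_growth[of k] lpos unfolding K_def by (intro divide_left_mono mult_pos_pos) auto
    also have "\<dots> = K * (2 / 3) ^ k" by (simp add: power_divide field_simps)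
    finally show ?thesis .
  qed
  have "summable (\<lambda>k. r (Suc k) - r k)"
    by (rule summable_comparison_test[OF _ summable_mult[OF summable_geometric]]) (use r in auto)
  then have "(\<lambda>n. \<Sum>k<n. r (Suc k) - r k) \<longlonglongrightarrow> (\<Sum>k. r (Suc k) - r k)" by (rule summable_LIMSEQ)
  then have "(\<lambda>n. (r n - r 0) + r 0) \<longlonglongrightarrow> (\<Sum>k. r (Suc k) - r k) + r 0"
    unfolding sum_lessThan_telescope by (intro tendsto_add tendsto_const)
  then show ?thesis unfolding r_def convergent_def by auto
qed

definition rate :: real where "rate = lim (\<lambda>k. W k / len k)"

lemma rate_lim: "(\<lambda>k. W k / len k) \<longlonglongrightarrow> rate"
  using W_rate_convergent unfolding rate_def by (simp add: convergent_LIMSEQ_iff)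

lemma rate_bounds: "ln (real_of_int a) \<le> rate" "rate \<le> ln (real_of_int (2 * (a + p)))"
proof -
  have lpos: "0 < real (len k)" for k using len_ge[of k] by simp
  show "ln (real_of_int a) \<le> rate"
    by (rule tendsto_lowerbound[OF rate_lim always_eventually])
      (use W_ge lpos in \<open>simp_all add: pos_le_divide_eq mult.commute\<close>)
  show "rate \<le> ln (real_of_int (2 * (a + p)))"
    by (rule tendsto_upperbound[OF rate_lim always_eventually])
      (use W_le lpos in \<open>simp_all add: pos_divide_le_eq mult.commute\<close>)
qed

text \<open>By \<open>D_asymp\<close>, \<open>1 - x\<close> is the limit of
  \<open>D k / W k\<close>, the relative size of the determinant.\<close>

definition x :: real where "x = 1 - 2 * ln p / rate"

lemma rate_pos: "0 < rate"
  using rate_bounds(1) ln_a by linarith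

lemma D_asymp:
  assumes e: "0 < e"
  shows "\<forall>\<^sub>F k in sequentially. \<bar>D k - (1 - x) * W k\<bar> \<le> e * W k"
proof -
  have lim: "(\<lambda>k. 2 * ln p / (W k / len k)) \<longlonglongrightarrow> 2 * ln p / rate"
    using rate_lim rate_pos by (intro tendsto_intros) auto
  have eq: "(\<lambda>k. 2 * ln p / (W k / len k)) = (\<lambda>k. D k / W k)" by (simp add: D_def ac_simps)
  have "(\<lambda>k. D k / W k) \<longlonglongrightarrow> 1 - x" using lim unfolding eq x_def by simp
  then have "\<forall>\<^sub>F k in sequentially. dist (D k / W k) (1 - x) < e" using e by (rule tendstoD)
  then show ?thesis
  proof eventually_elim
    case (elim k)
    have "\<bar>D k - (1 - x) * W k\<bar> = \<bar>D k / W k - (1 - x)\<bar> * W k"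
    proof -
      have "D k - (1 - x) * W k = (D k / W k - (1 - x)) * W k" using W_pos[of k] by (simp add: field_simps)
      then show ?thesis using W_pos[of k] by (simp add: abs_mult)
    qed
    also have "\<dots> \<le> e * W k" using elim W_pos[of k] unfolding dist_real_def by (intro mult_right_mono) auto
    finally show ?case .
  qed
qed

lemma eventually_const_le:
  assumes "0 < e"
  shows "\<forall>\<^sub>F k in sequentially. C \<le> e * W k"
proof -
  have "\<forall>\<^sub>F k in sequentially. C / e \<le> W k" using W_lim by (simp add: filterlim_at_top)
  then show ?thesis by eventually_elim (use assms in \<open>simp add: pos_divide_le_eq mult.commute\<close>)
qed

lemma eventually_const_le_Suc: "0 < e \<Longrightarrow> \<forall>\<^sub>F k in sequentially. C \<le> e * W (Suc k)"
  by (rule eventually_const_le[THEN eventually_sequentially_Suc[THEN iffD2]])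

lemma D_asymp_Suc: "0 < e \<Longrightarrow> \<forall>\<^sub>F k in sequentially. \<bar>D (Suc k) - (1 - x) * W (Suc k)\<bar> \<le> e * W (Suc k)"
  by (rule D_asymp[THEN eventually_sequentially_Suc[THEN iffD2]])

section \<open>Comparison with continued fractions and verification of the abstract system\<close>

text \<open>Both \<open>W (Suc k) / W k\<close> and \<open>cf k\<close> follow the map sending
  \<open>r\<close> to \<open>s k + 1 / r\<close>, the former up to an error tending to 0. The map
  contracts their distance by the factor \<open>1 / (r k * cf k)\<close>.\<close>

lemma ratio_asymp:
  fixes cf :: "nat \<Rightarrow> real"
  assumes cf: "\<And>k. 1 \<le> cf k" "\<And>k. cf k \<le> real B + 1" "\<And>k. cf (Suc k) = s k + 1 / cf k"
  shows "(\<lambda>k. W (Suc k) / W k - cf k) \<longlonglongrightarrow> 0"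
proof -
  define r where "r k = W (Suc k) / W k" for k
  have r1: "1 \<le> r k" for k using W_mono[of k] W_pos[of k] unfolding r_def by simp
  have rS: "\<bar>r (Suc k) - (s k + 1 / r k)\<bar> \<le> B / W (Suc k)" for k
  proof -
    have "r (Suc k) - (s k + 1 / r k) = (W (Suc (Suc k)) - (s k * W (Suc k) + W k)) / W (Suc k)"
      unfolding r_def using W_pos[of k] W_pos[of "Suc k"] by (simp add: field_simps)
    moreover have "0 \<le> W (Suc (Suc k)) - (s k * W (Suc k) + W k)" "W (Suc (Suc k)) - (s k * W (Suc k) + W k) \<le> B"
      using W_rec(1)[of k] W_rec_const[of k] by linarith+
    ultimately show ?thesis using W_pos[of "Suc k"] by (simp add: abs_divide divide_right_mono)
  qed
  \<comment> \<open>For \<open>k > 0\<close> the recursion gives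
    \<open>cf k \<ge> 1 + 1 / (real B + 1)\<close>, which is \<open>1 / c\<close>.\<close>
  define c where "c = (real B + 1) / (real B + 2)"
  have "(\<lambda>k. \<bar>r k - cf k\<bar>) \<longlonglongrightarrow> 0"
  proof (rule contraction_tendsto_0)
    show "0 \<le> c" "c < 1" unfolding c_def by simp_all
    show "(\<lambda>k. B / W (Suc k)) \<longlonglongrightarrow> 0"
      by (rule tendsto_divide_0[OF tendsto_const filterlim_at_top_imp_at_infinity])
        (rule filterlim_compose[OF W_lim filterlim_Suc])
    have step: "\<bar>r (Suc k) - cf (Suc k)\<bar> \<le> c * \<bar>r k - cf k\<bar> + B / W (Suc k)" if "k = Suc i" for k i
    proof -
      have ck: "1 / c \<le> cf k"
      proof -
        have "1 / (real B + 1) \<le> 1 / cf i" using cf(1,2)[of i] by (intro divide_left_mono) auto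
        moreover have "1 \<le> real (s i)" using s(1)[of i] by simp
        moreover have "1 / c = 1 + 1 / (real B + 1)" unfolding c_def by (simp add: field_simps)
        ultimately show ?thesis unfolding that cf(3) by linarith
      qed
      have "1 / r k - 1 / cf k = (cf k - r k) * (1 / (r k * cf k))"
        using r1[of k] cf(1)[of k] by (simp add: field_simps)
      then have "\<bar>1 / r k - 1 / cf k\<bar> = \<bar>r k - cf k\<bar> * (1 / (r k * cf k))"
        using r1[of k] cf(1)[of k] by (simp add: abs_mult abs_minus_commute)
      also have "\<dots> \<le> \<bar>r k - cf k\<bar> * c"
      proof (rule mult_left_mono)
        have "1 * (1 / c) \<le> r k * cf k" using r1[of k] ck cf(1)[of k] by (intro mult_mono) (auto simp: c_def)
        then show "1 / (r k * cf k) \<le> c" using r1[of k] cf(1)[of k] unfolding c_def by (simp add: field_simps)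
      qed simp
      finally have "\<bar>1 / r k - 1 / cf k\<bar> \<le> c * \<bar>r k - cf k\<bar>" by (simp add: mult.commute)
      moreover have "r (Suc k) - cf (Suc k) = (r (Suc k) - (s k + 1 / r k)) + (1 / r k - 1 / cf k)"
        unfolding cf(3) by simp
      ultimately show ?thesis using rS[of k] by linarith
    qed
    show "\<forall>\<^sub>F k in sequentially. \<bar>r (Suc k) - cf (Suc k)\<bar> \<le> c * \<bar>r k - cf k\<bar> + B / W (Suc k)"
      using eventually_gt_at_top[of 0] by eventually_elim (metis step gr0_conv_Suc)
  qed simp
  then show ?thesis unfolding r_def by (rule tendsto_rabs_zero_cancel)
qed

theorem system:
  fixes cf :: "nat \<Rightarrow> real"
  assumes cf: "\<And>k. 1 \<le> cf k" "\<And>k. cf k \<le> real B + 1" "\<And>k. cf (Suc k) = s k + 1 / cf k"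
    and rho: "1 \<le> \<rho>" "\<rho> \<le> real B + 1"
    and up: "\<And>e. 0 < e \<Longrightarrow> \<forall>\<^sub>F k in sequentially. cf k < \<rho> + e"
    and low: "\<And>e. 0 < e \<Longrightarrow> \<exists>\<^sub>F k in sequentially. \<rho> - e < cf k"
    and x: "(1 - x) * (real B + 3) \<le> 1 / 20"
  shows "sturmian_system \<xi> x \<rho> (real B) s W (\<lambda>k. m21 (M k)) Z1 (\<lambda>k. - m12 (M k))
    (\<lambda>k j. m11 (Q k j)) (\<lambda>k j. m12 (Q k j)) (\<lambda>k j. m22 (Q k j))"
proof -
  have ratio: "\<forall>\<^sub>F k in sequentially. \<bar>W (Suc k) - cf k * W k\<bar> \<le> e * W k" if e: "0 < e" for e
    using tendstoD[OF ratio_asymp[OF cf] e]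
  proof eventually_elim
    case (elim k)
    have "W (Suc k) - cf k * W k = (W (Suc k) / W k - cf k) * W k" using W_pos[of k] by (simp add: field_simps)
    then have "\<bar>W (Suc k) - cf k * W k\<bar> = \<bar>W (Suc k) / W k - cf k\<bar> * W k" using W_pos[of k] by (simp add: abs_mult)
    also have "\<dots> \<le> e * W k" using elim W_pos[of k] by (intro mult_right_mono) auto
    finally show ?case .
  qed
  have ratio_le: "\<forall>\<^sub>F k in sequentially. W (Suc k) \<le> (\<rho> + e) * W k" if e: "0 < e" for e
    using ratio[OF half_gt_zero[OF e]] up[OF half_gt_zero[OF e]]
  proof eventually_elim
    case (elim k)
    have "cf k * W k \<le> (\<rho> + e / 2) * W k" using elim W_pos[of k] by (intro mult_right_mono) auto
    then show ?case using elim unfolding distrib_right by linarith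
  qed
  have V_le: "\<forall>\<^sub>F k in sequentially. W (Suc k) \<le> (real B + 2) * W k"
    using ratio_le[OF zero_less_one]
  proof eventually_elim
    case (elim k)
    have "(\<rho> + 1) * W k \<le> (real B + 2) * W k" using rho W_pos[of k] by (intro mult_right_mono) auto
    then show ?case using elim by linarith
  qed
  have x1: "x < 1" unfolding x_def using rate_pos ln_a(2) by simp
  have jW: "j * W (Suc k) + W k \<le> (real B + 1) * W (Suc k)" "0 \<le> j * W (Suc k) + W k"
    "real j * ln 2 \<le> B" if "j \<le> s k" for j k
  proof -
    have "real j \<le> B" using that s(2)[of k] by linarith
    then have "j * W (Suc k) \<le> real B * W (Suc k)" using W_pos[of "Suc k"] by (intro mult_right_mono) auto
    then show "j * W (Suc k) + W k \<le> (real B + 1) * W (Suc k)"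
      using W_mono[of k] by (simp add: distrib_right)
    show "0 \<le> j * W (Suc k) + W k" using W_pos[of k] W_pos[of "Suc k"] by simp
    have "real j * ln 2 \<le> real B * 1" using \<open>real j \<le> B\<close> ln_2_less_1 by (intro mult_mono) auto
    then show "real j * ln 2 \<le> B" by simp
  qed
  \<comment> \<open>The logarithm of determinant over corner, hence of the approximation error of
    \<open>Q k j\<close>; it is about \<open>- x * (j * W (Suc k) + W k)\<close>.\<close>
  define R where "R k j = j * D (Suc k) + D k - 4 * ln p - lnm (Q k j)" for k j
  have R: "\<forall>\<^sub>F k in sequentially. \<forall>j. 1 \<le> j \<longrightarrow> j \<le> s k \<longrightarrow>
      \<bar>R k j + x * (j * W (Suc k) + W k)\<bar> + ln 2 \<le> e * W (Suc k)" if e: "0 < e" for e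
  proof -
    \<comment> \<open>As \<open>j * W (Suc k) + W k\<close> is at most
      \<open>(real B + 1) * W (Suc k)\<close>, the determinants use up half of \<open>e\<close>; the
      constants get the other half.\<close>
    define e' where "e' = e / (2 * (real B + 1))"
    have e': "0 < e'" "e' * (real B + 1) = e / 2" unfolding e'_def using e by (simp_all add: field_simps)
    show ?thesis using D_asymp[OF e'(1)] D_asymp_Suc[OF e'(1)]
      eventually_const_le_Suc[OF half_gt_zero[OF e], of "4 * ln p + C\<^sub>E + B + 2"]
    proof (eventually_elim, intro allI impI)
      fix k j assume d: "\<bar>D k - (1 - x) * W k\<bar> \<le> e' * W k" "\<bar>D (Suc k) - (1 - x) * W (Suc k)\<bar> \<le> e' * W (Suc k)"
        and c: "4 * ln p + C\<^sub>E + B + 2 \<le> e / 2 * W (Suc k)" and j: "1 \<le> j" "j \<le> s k"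
      have "\<bar>j * (D (Suc k) - (1 - x) * W (Suc k))\<bar> \<le> j * (e' * W (Suc k))"
        unfolding abs_mult using d by (simp add: mult_left_mono)
      moreover have "j * (e' * W (Suc k)) + e' * W k \<le> e / 2 * W (Suc k)"
      proof -
        have "e' * (j * W (Suc k) + W k) \<le> e' * ((real B + 1) * W (Suc k))"
          using jW(1)[OF j(2)] e' by (intro mult_left_mono) auto
        also have "\<dots> = e / 2 * W (Suc k)" unfolding mult.assoc[symmetric] e' ..
        finally show ?thesis by (simp add: algebra_simps)
      qed
      moreover have "R k j + x * (j * W (Suc k) + W k) = j * (D (Suc k) - (1 - x) * W (Suc k))
          + (D k - (1 - x) * W k) - 4 * ln p + ((j * W (Suc k) + W k) - lnm (Q k j))"
        unfolding R_def by (simp add: algebra_simps)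
      ultimately show "\<bar>R k j + x * (j * W (Suc k) + W k)\<bar> + ln 2 \<le> e * W (Suc k)"
        using d(1) c lnm_Q[where j = j and k = k] jW(3)[OF j(2)] ln_2_less_1 lnm_E(2) ln_a(2) by linarith
    qed
  qed
  have Rexp: "\<bar>real_of_int (det2 (Q k j))\<bar> / m11 (Q k j) = exp (R k j)"
    "\<bar>real_of_int (det2 (Q k j))\<bar> / (2 * m11 (Q k j)) = exp (R k j - ln 2)" for k j
    unfolding R_def abs_det_Q by (simp_all add: exp_diff m11_Q)
  \<comment> \<open>With \<open>D\<close> about \<open>(1 - x) * W\<close> and
    \<open>lnm (Q k 2)\<close> about \<open>2 * W (Suc k) + W k\<close>, the exponent becomes
    \<open>- x * W k - (1 + x) * W (Suc k)\<close>.\<close>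
  have val: "\<forall>\<^sub>F k in sequentially. \<bar>D k + D (Suc k) - 2 * ln p - lnm (Q k 2) + (x * W k + (1 + x) * W (Suc k))\<bar> + ln 2
      \<le> e * W k" if e: "0 < e" for e
  proof -
    define e' where "e' = e / (2 * (real B + 3))"
    have e': "0 < e'" "e' * (real B + 3) = e / 2" unfolding e'_def using e by (simp_all add: field_simps)
    show ?thesis using D_asymp[OF e'(1)] D_asymp_Suc[OF e'(1)] V_le
      eventually_const_le[OF half_gt_zero[OF e], of "2 * ln p + C\<^sub>E + 3"]
    proof eventually_elim
      case (elim k)
      have "e' * (W k + W (Suc k)) \<le> e' * ((real B + 3) * W k)"
        using elim e' by (intro mult_left_mono) (auto simp: algebra_simps)
      also have "\<dots> = e / 2 * W k" unfolding mult.assoc[symmetric] e' ..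
      finally have "e' * W k + e' * W (Suc k) \<le> e / 2 * W k" by (simp add: algebra_simps)
      moreover have "D k + D (Suc k) - 2 * ln p - lnm (Q k 2) + (x * W k + (1 + x) * W (Suc k))
          = (D k - (1 - x) * W k) + (D (Suc k) - (1 - x) * W (Suc k)) - 2 * ln p + ((2 * W (Suc k) + W k) - lnm (Q k 2))"
        by (simp add: algebra_simps)
      ultimately show ?case
        using elim lnm_Q[where j = 2 and k = k] ln_2_less_1 lnm_E(2) ln_a(2) by simp
    qed
  qed
  have val_range: "\<forall>\<^sub>F k in sequentially. (\<exists>i. k = Suc (Suc i)) \<and> C\<^sub>E + 4 \<le> real k"
  proof -
    have "\<forall>\<^sub>F k in sequentially. C\<^sub>E + 4 \<le> real k" by real_asymp
    then show ?thesis using eventually_ge_at_top[of 2]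
      by eventually_elim (auto simp: numeral_2_eq_2 dest!: le_Suc_ex)
  qed
  have Suc_range: "\<forall>\<^sub>F k in sequentially. \<exists>i. k = Suc i"
    using eventually_gt_at_top[of 0] by eventually_elim (simp add: gr0_conv_Suc)
  show ?thesis
  proof
    show "1 \<le> real B" using B_ge by simp
    show "1 \<le> \<rho>" "\<rho> \<le> real B + 1" "x < 1" "(1 - x) * (real B + 3) \<le> 1 / 20" by fact+
    fix k
    show "1 \<le> s k" "real (s k) \<le> real B" "0 < W k" "W k \<le> W (Suc k)" "W k + W (Suc k) \<le> W (Suc (Suc k))"
      using s W_pos W_mono W_ge_sum by simp_all
    show "primitive3 (m21 (M k)) (Z1 k) (- m12 (M k))" by (rule primitive_Z)
    show "m21 (M k) * m11 (Q k 1) + Z1 k * m12 (Q k 1) + - m12 (M k) * m22 (Q k 1) = 0"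
      using skew_Q_1[of k] unfolding skew_def by simp
    show "\<bar>real_of_int (Z1 k)\<bar> \<le> exp (W k)" "\<bar>real_of_int (- m12 (M k))\<bar> \<le> exp (W k)"
      "\<bar>- m12 (M k)\<bar> \<le> 2 * \<bar>Z1 k\<bar>" by (rule Z_bounds)+
    fix j
    show "m21 (M (Suc k)) * m11 (Q k j) + Z1 (Suc k) * m12 (Q k j) + - m12 (M (Suc k)) * m22 (Q k j) = 0"
      using skew_Q[of k j] unfolding skew_def by simp
    show "primitive3 (m11 (Q k j)) (m12 (Q k j)) (m22 (Q k j))" by (rule primitive_Q)
  next
    show "filterlim W at_top sequentially" by (rule W_lim)
    fix e :: real assume e: "0 < e"
    show "\<forall>\<^sub>F k in sequentially. W (Suc (Suc k)) \<le> s k * W (Suc k) + W k + e * W (Suc k)"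
      using eventually_const_le_Suc[OF e, of B]
    proof eventually_elim
      case (elim k)
      then show ?case using W_rec_const[of k] by linarith
    qed
    show "\<forall>\<^sub>F k in sequentially. W (Suc k) \<le> (\<rho> + e) * W k" by (rule ratio_le[OF e])
    show "\<exists>\<^sub>F k in sequentially. (\<rho> - e) * W k \<le> W (Suc k)"
    proof (rule frequently_rev_mp[OF low[of "e / 2"]])
      show "0 < e / 2" using e by simp
      have "\<forall>\<^sub>F k in sequentially. \<bar>W (Suc k) - cf k * W k\<bar> \<le> e / 2 * W k"
        by (rule ratio) (use e in simp)
      then show "\<forall>\<^sub>F k in sequentially. \<rho> - e / 2 < cf k \<longrightarrow> (\<rho> - e) * W k \<le> W (Suc k)"
      proof (eventually_elim, intro impI)
        fix k assume w: "\<bar>W (Suc k) - cf k * W k\<bar> \<le> e / 2 * W k" and "\<rho> - e / 2 < cf k"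
        then have "(\<rho> - e / 2) * W k \<le> cf k * W k" using W_pos[of k] by (intro mult_right_mono) auto
        then show "(\<rho> - e) * W k \<le> W (Suc k)" using w unfolding left_diff_distrib by linarith
      qed
    qed
    show "\<forall>\<^sub>F k in sequentially. exp (W k - e * W k) \<le> \<bar>real_of_int (Z1 k)\<bar>"
      using eventually_const_le[OF e, of "ln 2"]
    proof eventually_elim
      case (elim k)
      then have "exp (W k - e * W k) \<le> exp (W k - ln 2)" by simp
      then show ?case using Z_bounds(4)[of k] by linarith
    qed
    show "\<forall>\<^sub>F k in sequentially. \<bar>m21 (M k) + Z1 k * \<xi> + (- m12 (M k)) * \<xi>\<^sup>2\<bar>
        \<le> exp (- (x * W k + (1 + x) * W (Suc k)) + e * W k)"
      using val[OF e] val_range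
    proof eventually_elim
      case (elim k)
      then obtain i where i: "k = Suc (Suc i)" "C\<^sub>E + 4 \<le> real k" by blast
      have "\<bar>val k\<bar> \<le> 2 * exp (D k + D (Suc k) - 2 * ln p - lnm (Q k 2))" by (rule val_bounds(1)[OF i])
      also have "\<dots> = exp (D k + D (Suc k) - 2 * ln p - lnm (Q k 2) + ln 2)" by (simp add: exp_add)
      also have "\<dots> \<le> exp (- (x * W k + (1 + x) * W (Suc k)) + e * W k)"
        using elim(1) by (subst exp_le_cancel_iff) linarith
      finally show ?case .
    qed
    show "\<forall>\<^sub>F k in sequentially. exp (- (x * W k + (1 + x) * W (Suc k)) - e * W k)
        \<le> \<bar>m21 (M k) + Z1 k * \<xi> + (- m12 (M k)) * \<xi>\<^sup>2\<bar>"
      using val[OF e] val_range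
    proof eventually_elim
      case (elim k)
      then obtain i where i: "k = Suc (Suc i)" "C\<^sub>E + 4 \<le> real k" by blast
      have "exp (- (x * W k + (1 + x) * W (Suc k)) - e * W k) \<le> exp (D k + D (Suc k) - 2 * ln p - lnm (Q k 2) - ln 2)"
        using elim(1) by (subst exp_le_cancel_iff) linarith
      also have "\<dots> = exp (D k + D (Suc k) - 2 * ln p - lnm (Q k 2)) / 2" by (simp add: exp_diff)
      also have "\<dots> \<le> \<bar>val k\<bar>" using val_bounds(2)[OF i] by simp
      finally show ?case .
    qed
    have cQ: "\<forall>\<^sub>F k in sequentially. B + C\<^sub>E + 1 \<le> e * W (Suc k)" by (rule eventually_const_le_Suc[OF e])
    show "\<forall>\<^sub>F k in sequentially. \<forall>j. 1 \<le> j \<longrightarrow> j \<le> s k \<longrightarrow>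
        \<bar>real_of_int (m11 (Q k j))\<bar> \<le> exp (j * W (Suc k) + W k + e * W (Suc k))"
      using cQ
    proof (eventually_elim, intro allI impI)
      fix k j assume c: "B + C\<^sub>E + 1 \<le> e * W (Suc k)" and j: "j \<le> s k"
      have "lnm (Q k j) \<le> j * W (Suc k) + W k + e * W (Suc k)"
        using c lnm_Q(2)[where j = j and k = k] jW(3)[OF j] lnm_E(2) by linarith
      then show "\<bar>real_of_int (m11 (Q k j))\<bar> \<le> exp (j * W (Suc k) + W k + e * W (Suc k))" unfolding m11_Q by simp
    qed
    show "\<forall>\<^sub>F k in sequentially. \<forall>j. 1 \<le> j \<longrightarrow> j \<le> s k \<longrightarrow>
        exp (j * W (Suc k) + W k - e * W (Suc k)) \<le> \<bar>real_of_int (m11 (Q k j))\<bar>"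
      using cQ
    proof (eventually_elim, intro allI impI)
      fix k j assume c: "B + C\<^sub>E + 1 \<le> e * W (Suc k)" and j: "j \<le> s k"
      have "j * W (Suc k) + W k - e * W (Suc k) \<le> lnm (Q k j)"
        using c lnm_Q(1)[where j = j and k = k] ln_2_less_1 by linarith
      then show "exp (j * W (Suc k) + W k - e * W (Suc k)) \<le> \<bar>real_of_int (m11 (Q k j))\<bar>" unfolding m11_Q by simp
    qed
    show "\<forall>\<^sub>F k in sequentially. \<forall>j. 1 \<le> j \<longrightarrow> j \<le> s k \<longrightarrow>
        \<bar>m11 (Q k j) * \<xi> - m12 (Q k j)\<bar> \<le> exp (- (x * (j * W (Suc k) + W k)) + e * W (Suc k))"
      using R[OF e] Suc_range
    proof (eventually_elim, intro allI impI)
      fix k j assume r: "\<forall>j. 1 \<le> j \<longrightarrow> j \<le> s k \<longrightarrow> \<bar>R k j + x * (j * W (Suc k) + W k)\<bar> + ln 2 \<le> e * W (Suc k)"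
        and "\<exists>i. k = Suc i" and j: "1 \<le> j" "j \<le> s k"
      then obtain i where i: "k = Suc i" by blast
      have "\<bar>R k j + x * (j * W (Suc k) + W k)\<bar> + ln 2 \<le> e * W (Suc k)" using r j by blast
      then have "R k j \<le> - (x * (j * W (Suc k) + W k)) + e * W (Suc k)" using ln2_ge_two_thirds by linarith
      then show "\<bar>m11 (Q k j) * \<xi> - m12 (Q k j)\<bar> \<le> exp (- (x * (j * W (Suc k) + W k)) + e * W (Suc k))"
        using Q_error(1)[OF i, of j] j(2) unfolding Rexp by (meson exp_le_cancel_iff order_trans)
    qed
    show "\<forall>\<^sub>F k in sequentially. \<forall>j. 1 \<le> j \<longrightarrow> j \<le> s k \<longrightarrow>
        \<bar>m11 (Q k j) * \<xi>\<^sup>2 - m22 (Q k j)\<bar> \<le> exp (- (x * (j * W (Suc k) + W k)) + e * W (Suc k))"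
      using R[OF e] Suc_range
    proof (eventually_elim, intro allI impI)
      fix k j assume r: "\<forall>j. 1 \<le> j \<longrightarrow> j \<le> s k \<longrightarrow> \<bar>R k j + x * (j * W (Suc k) + W k)\<bar> + ln 2 \<le> e * W (Suc k)"
        and "\<exists>i. k = Suc i" and j: "1 \<le> j" "j \<le> s k"
      then obtain i where i: "k = Suc i" by blast
      have "\<bar>R k j + x * (j * W (Suc k) + W k)\<bar> + ln 2 \<le> e * W (Suc k)" using r j by blast
      then have "R k j \<le> - (x * (j * W (Suc k) + W k)) + e * W (Suc k)" using ln2_ge_two_thirds by linarith
      then show "\<bar>m11 (Q k j) * \<xi>\<^sup>2 - m22 (Q k j)\<bar> \<le> exp (- (x * (j * W (Suc k) + W k)) + e * W (Suc k))"
        using Q_error(2)[OF i, of j] j(2) unfolding Rexp by (meson exp_le_cancel_iff order_trans)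
    qed
    show "\<forall>\<^sub>F k in sequentially. \<forall>j. 1 \<le> j \<longrightarrow> j \<le> s k \<longrightarrow>
        exp (- (x * (j * W (Suc k) + W k)) - e * W (Suc k)) \<le> \<bar>m11 (Q k j) * \<xi>\<^sup>2 - m22 (Q k j)\<bar>"
      using R[OF e] Suc_range
    proof (eventually_elim, intro allI impI)
      fix k j assume r: "\<forall>j. 1 \<le> j \<longrightarrow> j \<le> s k \<longrightarrow> \<bar>R k j + x * (j * W (Suc k) + W k)\<bar> + ln 2 \<le> e * W (Suc k)"
        and "\<exists>i. k = Suc i" and j: "1 \<le> j" "j \<le> s k"
      then obtain i where i: "k = Suc i" by blast
      have "\<bar>R k j + x * (j * W (Suc k) + W k)\<bar> + ln 2 \<le> e * W (Suc k)" using r j by blast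
      then have "- (x * (j * W (Suc k) + W k)) - e * W (Suc k) \<le> R k j - ln 2" by linarith
      then show "exp (- (x * (j * W (Suc k) + W k)) - e * W (Suc k)) \<le> \<bar>m11 (Q k j) * \<xi>\<^sup>2 - m22 (Q k j)\<bar>"
        using Q_error(3)[OF i, of j] j(2) unfolding Rexp by (meson exp_le_cancel_iff order_trans)
    qed
  qed
qed

end

section \<open>Density\<close>

lemma contfrac_rev_Suc:
  "contfrac (map t (rev [1..<Suc k + 2])) = t (Suc (Suc k)) + 1 / contfrac (map t (rev [1..<k + 2]))"
proof -
  have "[1..<k + 2] = [1..<Suc k] @ [Suc k]" "[1..<Suc k + 2] = [1..<k + 2] @ [Suc (Suc k)]"
    by (simp_all add: numeral_2_eq_2)
  then show ?thesis by simp
qed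

lemma contfrac_rev_bounds:
  fixes t :: "nat \<Rightarrow> nat"
  assumes "\<And>i. 0 < t i" "\<And>i. t i \<le> B"
  shows "1 \<le> contfrac (map t (rev [1..<k + 2]))" "contfrac (map t (rev [1..<k + 2])) \<le> real B + 1"
proof -
  have t: "1 \<le> real (t i)" "real (t i) \<le> real B" for i using assms[of i] by simp_all
  have "1 \<le> contfrac (map t (rev [1..<k + 2])) \<and> contfrac (map t (rev [1..<k + 2])) \<le> real B + 1"
  proof (induction k)
    case 0
    show ?case using t[of 1] by (simp add: numeral_2_eq_2)
  next
    case (Suc k)
    then have "0 \<le> 1 / contfrac (map t (rev [1..<k + 2]))" "1 / contfrac (map t (rev [1..<k + 2])) \<le> 1"
      by (auto simp: divide_le_eq_1)
    then show ?case unfolding contfrac_rev_Suc using t[of "Suc (Suc k)"] by linarith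
  qed
  then show "1 \<le> contfrac (map t (rev [1..<k + 2]))" "contfrac (map t (rev [1..<k + 2])) \<le> real B + 1" by auto
qed

text \<open>The bounds make the extended upper limit finite, so \<open>real_of_ereal\<close> does
  not return its default.\<close>

lemma limsup_real:
  fixes f :: "nat \<Rightarrow> real"
  assumes "\<And>k. m \<le> f k" "\<And>k. f k \<le> n"
  defines "\<rho> \<equiv> real_of_ereal (limsup (\<lambda>k. ereal (f k)))"
  shows "m \<le> \<rho>" "\<rho> \<le> n" "0 < e \<Longrightarrow> \<forall>\<^sub>F k in sequentially. f k < \<rho> + e"
    "0 < e \<Longrightarrow> \<exists>\<^sub>F k in sequentially. \<rho> - e < f k"
proof -
  let ?L = "limsup (\<lambda>k. ereal (f k))"
  have up: "?L \<le> ereal n" using assms(2) by (intro Limsup_bounded) simp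
  have lo: "ereal m \<le> ?L"
  proof -
    have "ereal m \<le> liminf (\<lambda>k. ereal (f k))" using assms(1) by (intro Liminf_bounded) simp
    then show ?thesis using Liminf_le_Limsup[of sequentially "\<lambda>k. ereal (f k)"] by (auto intro: order_trans)
  qed
  have L: "?L = ereal \<rho>" unfolding \<rho>_def using up lo by (cases ?L) auto
  show "m \<le> \<rho>" "\<rho> \<le> n" using up lo unfolding L by simp_all
  show "\<forall>\<^sub>F k in sequentially. f k < \<rho> + e" if "0 < e"
  proof -
    have "?L < ereal (\<rho> + e)" unfolding L using that by simp
    then have "\<forall>\<^sub>F k in sequentially. ereal (f k) < ereal (\<rho> + e)" by (rule Limsup_lessD)
    then show ?thesis by simp
  qed
  show "\<exists>\<^sub>F k in sequentially. \<rho> - e < f k" if "0 < e"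
  proof (rule ccontr)
    assume "\<not> ?thesis"
    then have "\<forall>\<^sub>F k in sequentially. ereal (f k) \<le> ereal (\<rho> - e)" by (simp add: not_frequently not_less)
    then have "?L \<le> ereal (\<rho> - e)" by (rule Limsup_bounded)
    then show False unfolding L using that by simp
  qed
qed

text \<open>With \<open>p \<rightarrow> \<infinity>\<close> and both letters of size about \<open>p\<^sup>T\<close>, the growth rate is about
  \<open>T log p\<close>, while each letter has determinant \<open>- p\<^sup>2\<close>; the exponent tends to \<open>1 - 2 / T\<close>.\<close>

lemma parameters:
  fixes l u :: real
  assumes "0 < l" "l < u" "u \<le> 1"
  obtains a p :: int where "2 \<le> p" "2 * p \<le> a" "coprime a p"
    "\<And>r. ln (real_of_int a) \<le> r \<Longrightarrow> r \<le> ln (real_of_int (2 * (a + p))) \<Longrightarrow> l < 1 - 2 * ln p / r \<and> 1 - 2 * ln p / r < u"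
proof -
  \<comment> \<open>Chosen so that the limiting exponent \<open>1 - 2 / T\<close> is the midpoint of
    \<open>l\<close> and \<open>u\<close>.\<close>
  define T where "T = 2 / (1 - (l + u) / 2)"
  have T: "2 < T" "1 - 2 / T = (l + u) / 2"
    using assms unfolding T_def by (simp_all add: field_simps)
  have inv: "1 - 2 * inverse T = (l + u) / 2" using T(2) by (simp only: divide_inverse[of 2 T])
  have "((\<lambda>n::nat. 1 - 2 * ln n / (T * ln n + ln 4)) \<longlongrightarrow> 1 - 2 * inverse T) sequentially"
    using T(1) by real_asymp
  moreover have "((\<lambda>n::nat. 1 - 2 * ln n / (T * ln n - ln 2)) \<longlongrightarrow> 1 - 2 * inverse T) sequentially"
    using T(1) by real_asymp
  ultimately have "\<forall>\<^sub>F n::nat in sequentially. 1 - 2 * ln n / (T * ln n + ln 4) < u"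
    "\<forall>\<^sub>F n::nat in sequentially. l < 1 - 2 * ln n / (T * ln n - ln 2)"
    using assms unfolding inv by (auto intro: order_tendstoD)
  moreover have "\<forall>\<^sub>F n::nat in sequentially. 2 * real n \<le> n powr T" "\<forall>\<^sub>F n::nat in sequentially. 1 + real n \<le> n powr T"
    using T by real_asymp+
  moreover have "\<forall>\<^sub>F n::nat in sequentially. 2 \<le> n" by (rule eventually_ge_at_top)
  ultimately have "\<forall>\<^sub>F n::nat in sequentially. 1 - 2 * ln n / (T * ln n + ln 4) < u \<and>
     l < 1 - 2 * ln n / (T * ln n - ln 2) \<and> 2 * real n \<le> n powr T \<and> 1 + real n \<le> n powr T \<and> 2 \<le> n"
    by eventually_elim simp
  then obtain n :: nat where n: "1 - 2 * ln n / (T * ln n + ln 4) < u"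
     "l < 1 - 2 * ln n / (T * ln n - ln 2)" "2 * real n \<le> n powr T" "1 + real n \<le> n powr T" "2 \<le> n"
    by (auto simp: eventually_sequentially)
  define p where "p = int n"
  define b where "b = \<lfloor>n powr (T - 1)\<rfloor>"
  \<comment> \<open>Congruent to 1 modulo \<open>p\<close>, hence prime to \<open>p\<close>, and
    within a factor 2 of \<open>n powr T\<close> up to an additive 1.\<close>
  define a where "a = 1 + p * b"
  have n0: "0 < real n" using n by simp
  have nT: "n powr T = n * n powr (T - 1)" using n0 by (simp add: powr_mult_base)
  have "n powr 1 \<le> n powr (T - 1)" using T n by (intro powr_mono) auto
  then have b2: "2 \<le> b" using n unfolding b_def by (simp add: le_floor_iff)
  have b: "real_of_int b \<le> n powr (T - 1)" "n powr (T - 1) < b + 1" unfolding b_def by linarith+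
  have p2: "2 \<le> p" using n unfolding p_def by simp
  have a2p: "2 * p \<le> a"
  proof -
    have "p * 2 \<le> p * b" using p2 b2 by (intro mult_left_mono) auto
    then show ?thesis unfolding a_def by simp
  qed
  have cop: "coprime a p"
    unfolding a_def by (metis add.commute coprime_1_left coprime_iff_gcd_eq_1 gcd.commute gcd_add_mult mult.commute)
  have a_real: "real_of_int a = 1 + n * b" unfolding a_def p_def by simp
  have lnp: "0 < ln (real n)" using n by simp
  have up: "real_of_int a \<le> 1 + n powr T"
    unfolding a_real nT using b n0 by (simp add: mult_left_mono)
  have lo: "n powr T / 2 \<le> a"
  proof -
    have "n * n powr (T - 1) \<le> real n * (real_of_int b + 1)" using b n0 by (intro mult_left_mono) auto
    then show ?thesis using n(3) unfolding a_real nT by (simp add: algebra_simps)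
  qed
  have lna: "T * ln n - ln 2 \<le> ln a"
  proof -
    have "ln (n powr T / 2) \<le> ln (real_of_int a)" using lo n0 by (intro ln_mono) auto
    then show ?thesis using n0 by (simp add: ln_div ln_powr)
  qed
  have ln2a: "ln (real_of_int (2 * (a + p))) \<le> T * ln n + ln 4"
  proof -
    have "real_of_int (2 * (a + p)) \<le> 4 * n powr T" using up n(4) unfolding p_def by simp
    moreover have "0 < real_of_int (2 * (a + p))" using a2p p2 by simp
    ultimately have "ln (real_of_int (2 * (a + p))) \<le> ln (4 * n powr T)" by (intro ln_mono) auto
    then show ?thesis using n0 by (simp add: ln_mult ln_powr)
  qed
  have pos: "0 < T * ln n - ln 2"
  proof -
    have "ln 2 \<le> ln (real n)" using n by simp
    moreover have "2 * ln (real n) \<le> T * ln n" using T lnp by (intro mult_right_mono) auto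
    ultimately show ?thesis using lnp by linarith
  qed
  show thesis
  proof (rule that[OF p2 a2p cop])
    fix r assume r: "ln (real_of_int a) \<le> r" "r \<le> ln (real_of_int (2 * (a + p)))"
    have r': "T * ln n - ln 2 \<le> r" "r \<le> T * ln n + ln 4" "0 < r" using r lna ln2a pos by linarith+
    have "2 * ln n / r \<le> 2 * ln n / (T * ln n - ln 2)" "2 * ln n / (T * ln n + ln 4) \<le> 2 * ln n / r"
      using r' pos lnp by (auto intro!: divide_left_mono mult_pos_pos)
    then show "l < 1 - 2 * ln p / r \<and> 1 - 2 * ln p / r < u" using n(1,2) unfolding p_def by simp
  qed
qed

text \<open>The value of \<open>c\<close> makes \<open>(1 - x) * (real B + 3) \<le> 1 / 20\<close>
  hold for all \<open>x \<ge> c\<close>, as the abstract system demands.\<close>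

lemma spectrum_dense:
  fixes t :: "nat \<Rightarrow> nat" and B :: nat
  assumes t: "\<And>i. 0 < t i" "\<And>i. t i \<le> B"
  defines "c \<equiv> 1 - 1 / (20 * (real B + 3))"
  assumes lu: "c \<le> l" "l < u" "u \<le> 1"
  obtains x where "l < x" "x < u"
    "(ereal x, ereal (1 - 1 / (1 + (1 + sigma t) * x)), ereal ((1 + (1 + sigma t) * x) / sigma t),
      ereal (1 + (1 + sigma t) * x)) \<in> joint_spectrum"
proof -
  define cf where "cf k = contfrac (map t (rev [1..<k + 2]))" for k
  define \<rho> where "\<rho> = real_of_ereal (limsup (\<lambda>k. ereal (cf k)))"
  have sig: "sigma t = 1 / \<rho>" unfolding sigma_def \<rho>_def cf_def ..
  have cf1: "1 \<le> cf k" for k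
    unfolding cf_def by (rule contfrac_rev_bounds(1)[where t = t and B = B, OF t])
  have cf2: "cf k \<le> real B + 1" for k
    unfolding cf_def by (rule contfrac_rev_bounds(2)[where t = t and B = B, OF t])
  have cf3: "cf (Suc k) = t (Suc (Suc k)) + 1 / cf k" for k
    unfolding cf_def by (rule contfrac_rev_Suc)
  note rho = limsup_real[of 1 cf "real B + 1", OF cf1 cf2, folded \<rho>_def]
  have c0: "0 < c" unfolding c_def by (simp add: field_simps)
  obtain p a where ap: "2 \<le> p" "2 * p \<le> a" "coprime a p"
    and ap_r: "\<And>r. ln (real_of_int a) \<le> r \<Longrightarrow> r \<le> ln (real_of_int (2 * (a + p))) \<Longrightarrow> l < 1 - 2 * ln p / r \<and> 1 - 2 * ln p / r < u"
    by (rule parameters[OF less_le_trans[OF c0 lu(1)] lu(2,3)]) (rule that)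
  \<comment> \<open>The shift by 2 matches the continued fractions: \<open>cf 0\<close> is
    \<open>t 1\<close>, and \<open>cf (Suc k)\<close> brings in the digit
    \<open>t (Suc (Suc k))\<close>.\<close>
  define s where "s k = t (Suc (Suc k))" for k
  interpret sturmian_matrices a p s B
    using ap t by unfold_locales (auto simp: s_def Suc_le_eq)
  \<comment> \<open>The growth rate is known only up to the bounds of \<open>rate_bounds\<close>,
    which is why \<open>parameters\<close> treats every \<open>r\<close> between them.\<close>
  have x: "l < x" "x < u" using ap_r[OF rate_bounds] unfolding x_def by auto
  have "(1 - x) * (20 * (real B + 3)) \<le> 1 / (20 * (real B + 3)) * (20 * (real B + 3))"
    using x lu unfolding c_def by (intro mult_right_mono) auto
  then have "(1 - x) * (real B + 3) \<le> 1 / 20" by (simp add: field_simps)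
  then interpret sys: sturmian_system \<xi> x \<rho> "real B" s W "\<lambda>k. m21 (M k)" Z1 "\<lambda>k. - m12 (M k)"
    "\<lambda>k j. m11 (Q k j)" "\<lambda>k j. m12 (Q k j)" "\<lambda>k j. m22 (Q k j)"
    using cf1 cf2 cf3 rho unfolding s_def[symmetric] by (intro system[of cf]) auto
  show thesis
  proof (rule that[OF x])
    show "(ereal x, ereal (1 - 1 / (1 + (1 + sigma t) * x)), ereal ((1 + (1 + sigma t) * x) / sigma t),
        ereal (1 + (1 + sigma t) * x)) \<in> joint_spectrum"
      unfolding sig joint_spectrum_def using sys.exponents sys.not_algebraic by (intro CollectI exI[of _ \<xi>]) simp
  qed
qed

theorem corollary1p4:
  fixes \<sigma> :: real
  assumes "\<sigma> \<in> sigma_values"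
  shows "\<exists>c::real. 0 \<le> c \<and> c < 1 \<and>
    spectrum_curve \<sigma> c \<subseteq> closure (joint_spectrum \<inter> spectrum_curve \<sigma> c)"
proof -
  obtain t where t: "\<sigma> = sigma t" "\<And>k. 0 < t k" "bdd_above (range t)"
    using assms unfolding sigma_values_def by auto
  then obtain B where B: "\<And>k. t k \<le> B" unfolding bdd_above_def by auto
  define c where "c = 1 - 1 / (20 * (real B + 3))"
  define F where "F x = (ereal x, ereal (1 - 1 / (1 + (1 + \<sigma>) * x)), ereal ((1 + (1 + \<sigma>) * x) / \<sigma>),
      ereal (1 + (1 + \<sigma>) * x))" for x
  have c: "0 \<le> c" "c < 1" unfolding c_def by (simp_all add: field_simps)
  have sig: "0 \<le> \<sigma>"
  proof -
    have "1 \<le> real_of_ereal (limsup (\<lambda>k. ereal (contfrac (map t (rev [1..<k + 2])))))"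
      by (rule limsup_real(1)) (rule contfrac_rev_bounds[OF t(2) B])+
    then show ?thesis unfolding t(1) sigma_def by simp
  qed
  have curve: "spectrum_curve \<sigma> c = F ` {c..1}" unfolding spectrum_curve_def F_def by auto
  define S where "S = {x \<in> {c..1}. F x \<in> joint_spectrum}"
  have dense: "{c..1} \<subseteq> closure S"
  proof
    fix x assume x: "x \<in> {c..1}"
    show "x \<in> closure S"
      unfolding closure_approachable
    proof (intro allI impI)
      fix e :: real assume e: "0 < e"
      \<comment> \<open>Cutting the interval with \<open>c\<close> and 1 keeps it nonempty also at
        the end points of the parameter range, since \<open>c < 1\<close>.\<close>
      have lu: "max c (x - e) < min 1 (x + e)" using x e c by auto
      obtain y where "max c (x - e) < y" "y < min 1 (x + e)" "F y \<in> joint_spectrum"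
      proof (rule spectrum_dense[where t = t and B = B and l = "max c (x - e)" and u = "min 1 (x + e)", OF t(2) B])
        show "1 - 1 / (20 * (real B + 3)) \<le> max c (x - e)" unfolding c_def by simp
        show "max c (x - e) < min 1 (x + e)" by (rule lu)
      qed (simp, use that in \<open>simp add: F_def t(1)\<close>)
      then show "\<exists>y\<in>S. dist y x < e" unfolding S_def by (intro bexI[of _ y]) (auto simp: dist_real_def)
    qed
  qed
  have "closure S \<subseteq> {c..1}" by (rule closure_minimal) (auto simp: S_def)
  \<comment> \<open>Continuity carries density of the parameters \<open>S\<close> over to density of
    the points on the curve.\<close>
  moreover have "continuous_on {c..1} F"
  proof -
    have nz: "1 + (1 + \<sigma>) * x \<noteq> 0" if "x \<in> {c..1}" for x
    proof -
      have "0 \<le> (1 + \<sigma>) * x" using that c sig by auto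
      then show ?thesis by linarith
    qed
    have "continuous_on {c..1} (\<lambda>x. 1 - 1 / (1 + (1 + \<sigma>) * x))"
      using nz by (intro continuous_intros) blast
    moreover have "continuous_on {c..1} (\<lambda>x. (1 + (1 + \<sigma>) * x) / \<sigma>)"
      "continuous_on {c..1} (\<lambda>x. 1 + (1 + \<sigma>) * x)"
      unfolding divide_inverse by (intro continuous_intros)+
    ultimately show ?thesis unfolding F_def
      by (intro continuous_on_Pair continuous_on_ereal continuous_on_id)
  qed
  ultimately have "continuous_on (closure S) F" by (rule continuous_on_subset[rotated])
  then have "F ` closure S \<subseteq> closure (joint_spectrum \<inter> F ` {c..1})"
  proof (rule image_closure_subset)
    show "F ` S \<subseteq> closure (joint_spectrum \<inter> F ` {c..1})"
      by (rule order_trans[OF _ closure_subset]) (auto simp: S_def)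
  qed simp
  then have "F ` {c..1} \<subseteq> closure (joint_spectrum \<inter> F ` {c..1})"
    by (rule order_trans[OF image_mono[OF dense]])
  then show ?thesis using c unfolding curve[symmetric] by (intro exI[of _ c] conjI)
qed

end
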